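(* Let \(T\) be a tree on \(n\) vertices with maximum degree \(\Delta\). Then \[\operatorname{MinBis}(T) \leq \frac{8\Delta}{\operatorname{diam}^*(T)}.\] Moreover, a bisection of \(T\) whose width satisfies this bound can be computed in \(\mathcal{O}(n)\) time.
   Context: A bisection \((B,W)\) of a graph \(G\) is a partition of \(V(G)\) into two sets \(B,W\) whose sizes differ by at most one; its width \(e_G(B,W)\) is the number of edges with one end in \(B\) and the other in \(W\). \(\operatorname{MinBis}(G)\) is the minimum width of a bisection of \(G\). For a tree \(T\), the relative diameter \(\operatorname{diam}^*(T)\) is \(|V(P)|/|V(T)|\), where \(P\) is a longest path in \(T\). *)

theory Defs
  imports Complex_Main
begin

section \<open>Finite simple graphs and bisections\<close>

definition simple_graph :: "'a set \<Rightarrow> 'a set set \<Rightarrow> bool" where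
  "simple_graph V E \<longleftrightarrow> finite V \<and> E \<subseteq> {{u, v} | u v. u \<in> V \<and> v \<in> V \<and> u \<noteq> v}"

definition is_path :: "'a set \<Rightarrow> 'a set set \<Rightarrow> 'a list \<Rightarrow> bool" where
  "is_path V E p \<longleftrightarrow>
     p \<noteq> [] \<and> set p \<subseteq> V \<and> distinct p \<and> successively (\<lambda>u v. {u, v} \<in> E) p"

definition is_cycle :: "'a set \<Rightarrow> 'a set set \<Rightarrow> 'a list \<Rightarrow> bool" where
  "is_cycle V E p \<longleftrightarrow> is_path V E p \<and> 3 \<le> length p \<and> {last p, hd p} \<in> E"

definition connected_graph :: "'a set \<Rightarrow> 'a set set \<Rightarrow> bool" where
  "connected_graph V E \<longleftrightarrow>
     V \<noteq> {} \<and> (\<forall>u\<in>V. \<forall>v\<in>V. \<exists>p. is_path V E p \<and> hd p = u \<and> last p = v)"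

definition tree :: "'a set \<Rightarrow> 'a set set \<Rightarrow> bool" where
  "tree V E \<longleftrightarrow> simple_graph V E \<and> connected_graph V E \<and> (\<nexists>p. is_cycle V E p)"

definition degree :: "'a set set \<Rightarrow> 'a \<Rightarrow> nat" where
  "degree E v = card {e \<in> E. v \<in> e}"

definition max_degree :: "'a set \<Rightarrow> 'a set set \<Rightarrow> nat" where
  "max_degree V E = Max (degree E ` V)"

definition bisection :: "'a set \<Rightarrow> 'a set \<Rightarrow> 'a set \<Rightarrow> bool" where
  "bisection V B W \<longleftrightarrow>
     B \<union> W = V \<and> B \<inter> W = {} \<and> \<bar>int (card B) - int (card W)\<bar> \<le> 1"

definition width :: "'a set set \<Rightarrow> 'a set \<Rightarrow> 'a set \<Rightarrow> nat" where
  "width E B W = card {e \<in> E. \<exists>b\<in>B. \<exists>w\<in>W. e = {b, w}}"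

definition min_bis :: "'a set \<Rightarrow> 'a set set \<Rightarrow> nat" where
  "min_bis V E = Min {width E B W | B W. bisection V B W}"

text \<open>Paths have distinct vertices, so the length of the list is the number of vertices of
  the path.\<close>

definition rel_diam :: "'a set \<Rightarrow> 'a set set \<Rightarrow> real" where
  "rel_diam V E = real (Max {length p | p. is_path V E p}) / real (card V)"

section \<open>Random access machine with uniform cost\<close>

text \<open>
  Running time is measured on a random access machine with unit-cost addition, truncated
  subtraction, comparison and indirect addressing on natural numbers, programmed by structured
  while programs. The memory is divided into arrays of unbounded length; an array name is part
  of the program text, so a program uses a fixed number of arrays (which could be
  interleaved in a single memory with constant overhead) and a scalar variable is cell 0 of
  an array. There is no unit-cost multiplication or bitwise operation. Each operator, constant, memory access, assignment and
  branching costs one unit.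
\<close>

type_synonym memory = "string \<Rightarrow> nat \<Rightarrow> nat"

datatype aexp = Const nat | Cell string aexp | Plus aexp aexp | Minus aexp aexp

datatype bexp = Less aexp aexp | Neg bexp | Conj bexp bexp

datatype com =
    Skip
  | Store string aexp aexp
  | Seq com com
  | Cond bexp com com
  | While bexp com

primrec aval :: "aexp \<Rightarrow> memory \<Rightarrow> nat" where
  "aval (Const k) s = k"
| "aval (Cell x a) s = s x (aval a s)"
| "aval (Plus a b) s = aval a s + aval b s"
| "aval (Minus a b) s = aval a s - aval b s"

primrec bval :: "bexp \<Rightarrow> memory \<Rightarrow> bool" where
  "bval (Less a b) s \<longleftrightarrow> aval a s < aval b s"
| "bval (Neg b) s \<longleftrightarrow> \<not> bval b s"
| "bval (Conj b c) s \<longleftrightarrow> bval b s \<and> bval c s"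

primrec acost :: "aexp \<Rightarrow> nat" where
  "acost (Const k) = 1"
| "acost (Cell x a) = 1 + acost a"
| "acost (Plus a b) = 1 + acost a + acost b"
| "acost (Minus a b) = 1 + acost a + acost b"

primrec bcost :: "bexp \<Rightarrow> nat" where
  "bcost (Less a b) = 1 + acost a + acost b"
| "bcost (Neg b) = 1 + bcost b"
| "bcost (Conj b c) = 1 + bcost b + bcost c"

text \<open>\<open>exec c s t s'\<close>: started in memory \<open>s\<close>, the program \<open>c\<close> terminates after \<open>t\<close> time units
  with memory \<open>s'\<close>.\<close>

inductive exec :: "com \<Rightarrow> memory \<Rightarrow> nat \<Rightarrow> memory \<Rightarrow> bool" where
  Skip: "exec Skip s 1 s"
| Store: "exec (Store x a b) s (1 + acost a + acost b) (s(x := (s x)(aval a s := aval b s)))"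
| Seq: "exec c s t s' \<Longrightarrow> exec d s' t' s'' \<Longrightarrow> exec (Seq c d) s (t + t') s''"
| CondTrue: "bval b s \<Longrightarrow> exec c s t s' \<Longrightarrow> exec (Cond b c d) s (1 + bcost b + t) s'"
| CondFalse: "\<not> bval b s \<Longrightarrow> exec d s t s' \<Longrightarrow> exec (Cond b c d) s (1 + bcost b + t) s'"
| WhileFalse: "\<not> bval b s \<Longrightarrow> exec (While b c) s (1 + bcost b) s"
| WhileTrue: "bval b s \<Longrightarrow> exec c s t s' \<Longrightarrow> exec (While b c) s' t' s'' \<Longrightarrow>
    exec (While b c) s (1 + bcost b + t + t') s''"

inductive_cases exec_SkipE: "exec Skip s t s'"
inductive_cases exec_StoreE: "exec (Store x a b) s t s'"
inductive_cases exec_SeqE: "exec (Seq c d) s t s'"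
inductive_cases exec_CondE: "exec (Cond b c d) s t s'"
inductive_cases exec_WhileE: "exec (While b c) s t s'"

lemma exec_deterministic:
  "exec c s t s' \<Longrightarrow> exec c s u r \<Longrightarrow> u = t \<and> r = s'"
proof (induction arbitrary: u r rule: exec.induct)
  case (Skip s)
  then show ?case by (elim exec_SkipE) simp
next
  case (Store x a b s)
  then show ?case by (elim exec_StoreE) simp
next
  case (Seq c s t s' d t' s'')
  from Seq.prems show ?case by (rule exec_SeqE) (use Seq.IH in fastforce)
next
  case (CondTrue b s c t s' d)
  from CondTrue.prems show ?case
    by (rule exec_CondE) (use CondTrue.hyps CondTrue.IH in fastforce)+
next
  case (CondFalse b s d t s' c)
  from CondFalse.prems show ?case
    by (rule exec_CondE) (use CondFalse.hyps CondFalse.IH in fastforce)+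
next
  case (WhileFalse b s c)
  from WhileFalse.prems show ?case
    by (rule exec_WhileE) (use WhileFalse.hyps in fastforce)+
next
  case (WhileTrue b s c t s' t' s'')
  from WhileTrue.prems show ?case
    by (rule exec_WhileE) (use WhileTrue.hyps WhileTrue.IH in fastforce)+
qed

text \<open>Graphs on the vertex set \<open>{0, \<dots>, n - 1}\<close> are input as a list of edges, in any order and
  with the ends of each edge in any order. All cells that do not hold the input are 0.\<close>

definition edge_list :: "(nat \<times> nat) list \<Rightarrow> nat set set \<Rightarrow> bool" where
  "edge_list es E \<longleftrightarrow>
     distinct (map (\<lambda>(u, v). {u, v}) es) \<and> set (map (\<lambda>(u, v). {u, v}) es) = E"

definition input_memory :: "nat \<Rightarrow> (nat \<times> nat) list \<Rightarrow> memory" where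
  "input_memory n es = (\<lambda>x i.
     if x = ''n'' \<and> i = 0 then n
     else if x = ''end1'' \<and> i < length es then fst (es ! i)
     else if x = ''end2'' \<and> i < length es then snd (es ! i)
     else 0)"

definition output_black :: "nat \<Rightarrow> memory \<Rightarrow> nat set" where
  "output_black n s = {v. v < n \<and> s ''black'' v \<noteq> 0}"

definition output_white :: "nat \<Rightarrow> memory \<Rightarrow> nat set" where
  "output_white n s = {v. v < n \<and> s ''black'' v = 0}"

end

theory Submission
  imports Defs
begin

text \<open>
  Root the tree at a vertex and let \<open>k\<close> be the number of vertices on a longest path that starts at
  the root. Every path has at most \<open>2 k\<close> vertices, so it suffices to find a bisection of width at
  most \<open>4 \<Delta> n / k\<close>. List the vertices in a preorder that visits, among the children of a vertex, the
  child on that path last and otherwise a child with the largest subtree last. Let \<open>\<lambda>(v)\<close> count the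
  edges on the way from the root to \<open>v\<close> that do not lead to the last child. Cutting the list
  before \<open>v\<close> cuts at most \<open>max(1, \<lambda>(v)) \<Delta>\<close> edges, and since \<open>\<lambda>\<close> grows only when the subtree
  size halves, every interval of \<open>z\<close> positions between two consecutive path vertices at distance \<open>\<sigma>\<close>
  contains a position with \<open>2^\<lambda> z \<le> 4 \<sigma>\<close>.

  To colour \<open>m\<close> of \<open>z\<close> cyclically arranged positions black, let \<open>X\<close> be the set of path positions. If
  \<open>X\<close> meets \<open>X + m\<close>, two cheap cuts suffice. Otherwise merge the points of \<open>X\<close> and \<open>X + m\<close> around the
  cycle into maximal runs of points of one kind. A run of \<open>q\<close> points has a hull of \<open>z'\<close> positions and
  lies in a gap of length \<open>\<sigma>\<close> between two points of the other kind; the quantities \<open>\<sigma> + z' - 1\<close> add up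
  to \<open>2 z\<close> and the \<open>q\<close> to \<open>2 |X|\<close>, so that some run has \<open>q z \<ge> |X| (\<sigma> + z' - 1) \<ge> 2 |X| z'\<close>. Cutting the gap
  at a position of the hull with smallest \<open>\<lambda>\<close> settles everything outside the hull, and the hull,
  in which the path is at least twice as dense as before, is coloured in the same way. The density
  doubles in each round, so the widths form a convergent series, and the length halves, so the
  running time is linear.
\<close>


section \<open>Trees\<close>

text \<open>A block of \<open>m\<close> cyclically consecutive positions has two boundaries. Only
  the one inside the gap is paid for; the other one falls into the translated hull and is left to
  the next round. The hull begins and ends at path positions, so closing it off costs at most twice
  the maximum degree. The averaging inequality is used twice. With \<open>y = z / |X|\<close> it
  bounds the gap by \<open>y\<close> hull lengths, so that \<open>2 ^ \<lambda> \<le> 4 * y\<close>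
  at the cut, and it gives the hull a quotient of at most \<open>y / 2\<close>. A cost logarithmic
  in \<open>y\<close> is thus set against a quantity that halves, and a budget linear in
  \<open>y\<close>, namely \<open>4 * y\<close>, covers all rounds. For \<open>y < 2\<close> the
  path holds more than half of the positions, so its two copies meet and the process ends. At the
  start \<open>y = n / k\<close>; the 4 becomes 8 because only half of a longest path is guaranteed
  to descend from the root. The list may be closed to a cycle free of charge, since no edge crosses
  before the root. For arbitrary vertex sets the bound is obtained from a run of the program on a
  numbered copy of the tree.\<close>

lemma simple_graph_edgeD:
  assumes "simple_graph V E" "{u, v} \<in> E"
  shows "u \<in> V" "v \<in> V" "u \<noteq> v"
proof -
  obtain a b where "{u, v} = {a, b}" "a \<in> V" "b \<in> V" "a \<noteq> b"
    using assms unfolding simple_graph_def by blast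
  then show "u \<in> V" "v \<in> V" "u \<noteq> v" by (auto simp: doubleton_eq_iff)
qed

lemma is_path_singleton: "v \<in> V \<Longrightarrow> is_path V E [v]"
  by (simp add: is_path_def)

lemma is_path_appendD1: "is_path V E (xs @ ys) \<Longrightarrow> xs \<noteq> [] \<Longrightarrow> is_path V E xs"
  by (auto simp: is_path_def successively_append_iff)

lemma is_path_snoc:
  assumes "is_path V E p" "{last p, w} \<in> E" "w \<in> V" "w \<notin> set p"
  shows "is_path V E (p @ [w])"
  using assms by (auto simp: is_path_def successively_append_iff)

lemma is_path_mono: "is_path V F p \<Longrightarrow> F \<subseteq> E \<Longrightarrow> is_path V E p"
  by (auto simp: is_path_def intro: successively_mono)

text \<open>Walks compose easily, paths do not. When a step returns to a vertex of the path, cutting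
  the path off at that vertex restores distinctness.\<close>

lemma path_of_reachable:
  assumes "(u, v) \<in> {(a, b). a \<in> V \<and> b \<in> V \<and> {a, b} \<in> F}\<^sup>*" "u \<in> V"
  shows "\<exists>p. is_path V F p \<and> hd p = u \<and> last p = v"
  using assms(1)
proof (induction rule: rtrancl_induct)
  case base
  show ?case using is_path_singleton[OF assms(2)] by (intro exI[of _ "[u]"]) auto
next
  case (step v w)
  then obtain p where p: "is_path V F p" "hd p = u" "last p = v" by blast
  have ne: "p \<noteq> []" using p by (simp add: is_path_def)
  show ?case
  proof (cases "w \<in> set p")
    case True
    then obtain xs ys where xy: "p = xs @ w # ys" by (meson split_list)
    then have "is_path V F (xs @ [w])" using is_path_appendD1[of V F "xs @ [w]" ys] p by simp
    moreover have "hd (xs @ [w]) = u" using p(2) xy by (cases xs) auto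
    ultimately show ?thesis by (intro exI[of _ "xs @ [w]"]) simp
  next
    case False
    then show ?thesis using is_path_snoc[OF p(1)] p step ne by (intro exI[of _ "p @ [w]"]) auto
  qed
qed

text \<open>Every vertex has a neighbour closer to \<open>r\<close>, the second vertex of a shortest
  path. The edges to such neighbours already connect \<open>V\<close>, so any further edge would
  close a cycle with the path between its ends.\<close>

lemma tree_rooted:
  assumes T: "tree V E" and r: "r \<in> V"
  shows "\<exists>(\<rho> :: 'a \<Rightarrow> nat) par. (\<forall>v\<in>V - {r}. par v \<in> V \<and> \<rho> (par v) < \<rho> v)
    \<and> E = (\<lambda>v. {v, par v}) ` (V - {r})"
proof -
  have sg: "simple_graph V E" and con: "connected_graph V E" and nc: "\<nexists>p. is_cycle V E p"
    using T by (auto simp: tree_def)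
  define R where "R v k \<longleftrightarrow> (\<exists>p. is_path V E p \<and> hd p = v \<and> last p = r \<and> length p = k)" for v k
  define \<rho> where "\<rho> v = (LEAST k. R v k)" for v
  have ex: "\<exists>w. w \<in> V \<and> \<rho> w < \<rho> v \<and> {v, w} \<in> E" if v: "v \<in> V - {r}" for v
  proof -
    have "\<exists>k. R v k" using con v r unfolding R_def connected_graph_def by blast
    then have "R v (\<rho> v)" unfolding \<rho>_def by (metis LeastI)
    then obtain p where p: "is_path V E p" "hd p = v" "last p = r" "length p = \<rho> v"
      by (auto simp: R_def)
    then obtain q where q: "p = v # q" by (cases p) (auto simp: is_path_def)
    have "q \<noteq> []" using q p(3) v by auto
    then obtain w xs where w: "q = w # xs" by (cases q) auto
    then have pw: "is_path V E (w # xs)" "{v, w} \<in> E" "w \<in> V" using p(1) q by (auto simp: is_path_def)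
    then have "R w (length (w # xs))" using p(3) q w unfolding R_def by (intro exI[of _ "w # xs"]) auto
    then have "\<rho> w \<le> length (w # xs)" unfolding \<rho>_def by (rule Least_le)
    then show ?thesis using pw p(4) q w by auto
  qed
  define par where "par v = (SOME w. w \<in> V \<and> \<rho> w < \<rho> v \<and> {v, w} \<in> E)" for v
  have par: "par v \<in> V \<and> \<rho> (par v) < \<rho> v \<and> {v, par v} \<in> E" if "v \<in> V - {r}" for v
    unfolding par_def by (rule someI_ex[OF ex[OF that]])
  define F where "F = (\<lambda>v. {v, par v}) ` (V - {r})"
  let ?S = "{(a, b). a \<in> V \<and> b \<in> V \<and> {a, b} \<in> F}"
  have FE: "F \<subseteq> E" using par by (auto simp: F_def)
  have "sym ?S" by (auto simp: sym_def insert_commute)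
  then have sym: "sym (?S\<^sup>*)" by (rule sym_rtrancl)
  have reach: "v \<in> V \<Longrightarrow> (v, r) \<in> ?S\<^sup>*" for v
  proof (induction "\<rho> v" arbitrary: v rule: less_induct)
    case less
    show ?case
    proof (cases "v = r")
      case False
      then have "(v, par v) \<in> ?S" using par[of v] less.prems by (auto simp: F_def)
      moreover have "(par v, r) \<in> ?S\<^sup>*" using less.hyps[of "par v"] par[of v] less.prems False by simp
      ultimately show ?thesis by (rule converse_rtrancl_into_rtrancl)
    qed simp
  qed
  have "E \<subseteq> F"
  proof
    fix e assume e: "e \<in> E"
    then obtain a b where ab: "e = {a, b}" "a \<in> V" "b \<in> V" "a \<noteq> b"
      using subsetD[OF conjunct2[OF sg[unfolded simple_graph_def]] e] by blast
    have "(a, b) \<in> ?S\<^sup>*" using reach[OF ab(2)] symD[OF sym reach[OF ab(3)]] by (rule rtrancl_trans)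
    then obtain p where p: "is_path V F p" "hd p = a" "last p = b" using path_of_reachable[OF _ ab(2)] by blast
    show "e \<in> F"
    proof (rule ccontr)
      assume ne: "e \<notin> F"
      \<comment> \<open>A path of two vertices would be the edge \<open>e\<close> itself, which
        would then belong to \<open>F\<close>.\<close>
      have "3 \<le> length p"
      proof (rule ccontr)
        assume "\<not> ?thesis"
        moreover obtain q where q: "p = a # q" using p by (cases p) (auto simp: is_path_def)
        moreover have "q \<noteq> []" using q p ab by auto
        ultimately obtain y where "p = [a, y]" by (cases q; cases "tl q") auto
        then show False using p ne ab by (auto simp: is_path_def)
      qed
      moreover have "{last p, hd p} \<in> E" using p e ab by (simp add: insert_commute)
      ultimately have "is_cycle V E p" using is_path_mono[OF p(1) FE] by (simp add: is_cycle_def)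
      then show False using nc by blast
    qed
  qed
  then have "E = F" using FE by simp
  then show ?thesis using par unfolding F_def by (intro exI[of _ \<rho>] exI[of _ par] conjI ballI) simp_all
qed

text \<open>Two vertices with the same edge would be parents of each other, which
  \<open>\<rho>\<close> forbids.\<close>

lemma inj_on_parent_edge:
  assumes "\<And>v. v \<in> A \<Longrightarrow> \<rho> (par v) < (\<rho> v :: nat)"
  shows "inj_on (\<lambda>v. {v, par v}) A"
proof (rule inj_onI)
  fix v w assume vw: "v \<in> A" "w \<in> A" "{v, par v} = {w, par w}"
  then show "v = w" using assms[of v] assms[of w] by (auto simp: doubleton_eq_iff)
qed

lemma tree_card_edges:
  assumes "tree V E" shows "card E = card V - 1"
proof -
  obtain r where r: "r \<in> V" using assms by (auto simp: tree_def connected_graph_def)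
  obtain \<rho> :: "'a \<Rightarrow> nat" and par where par: "\<forall>v\<in>V - {r}. par v \<in> V \<and> \<rho> (par v) < \<rho> v"
    "E = (\<lambda>v. {v, par v}) ` (V - {r})"
    using tree_rooted[OF assms r] by blast
  have "card E = card (V - {r})"
    unfolding par(2) by (rule card_image[OF inj_on_parent_edge[where \<rho> = \<rho>]]) (use par in auto)
  then show ?thesis using r assms by (auto simp: tree_def simple_graph_def)
qed

section \<open>Depth of a rooted tree and the length of its paths\<close>

context
  fixes V :: "'a set" and E :: "'a set set" and r :: 'a and par :: "'a \<Rightarrow> 'a" and dep :: "'a \<Rightarrow> nat" and M :: nat
  assumes E: "E = (\<lambda>v. {v, par v}) ` (V - {r})"
    and dep: "\<And>v. v \<in> V - {r} \<Longrightarrow> dep v = dep (par v) + 1"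
    and M: "\<And>v. v \<in> V \<Longrightarrow> dep v \<le> M"
begin

lemma parent_edge_cases:
  assumes "{u, w} \<in> E"
  obtains "u \<in> V - {r}" "w = par u" | "w \<in> V - {r}" "u = par w"
proof -
  obtain v where "v \<in> V - {r}" "{u, w} = {v, par v}" using assms unfolding E by blast
  then show ?thesis using that by (metis doubleton_eq_iff)
qed

text \<open>After one step away from the root a path keeps descending: the only way up is the
  parent, and the parent has just been visited.\<close>

lemma descending_path_length:
  assumes "successively (\<lambda>u v. {u, v} \<in> E) (u # w # xs)" "distinct (u # w # xs)"
    "w \<in> V - {r}" "u = par w"
  shows "dep u + length (w # xs) \<le> M"
  using assms
proof (induction xs arbitrary: u w)
  case Nil
  then show ?case using dep[of w] M[of w] by simp
next
  case (Cons x xs)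
  have e: "{w, x} \<in> E" using Cons.prems by simp
  have "x \<noteq> par w" using Cons.prems by auto
  then have "x \<in> V - {r}" "w = par x" using parent_edge_cases[OF e] by blast+
  then have "dep w + length (x # xs) \<le> M" using Cons.IH[of w x] Cons.prems by simp
  then show ?case using dep[of w] Cons.prems by simp
qed

text \<open>A path first climbs and then descends. The climb is limited by the depth of its head,
  and the descent ends at depth at most \<open>M\<close>.\<close>

lemma path_length_le_dep:
  assumes "successively (\<lambda>u v. {u, v} \<in> E) p" "distinct p" "p \<noteq> []" "set p \<subseteq> V"
  shows "length p \<le> dep (hd p) + M + 1"
  using assms
proof (induction p)
  case (Cons u q)
  show ?case
  proof (cases q)
    case Nil then show ?thesis by simp
  next
    case q: (Cons w xs)
    then have e: "{u, w} \<in> E" using Cons.prems by simp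
    from e show ?thesis
    proof (cases rule: parent_edge_cases)
      case 1
      then show ?thesis using Cons q dep[of u] by simp
    next
      case 2
      then show ?thesis using descending_path_length[of u w xs] Cons.prems q by simp
    qed
  qed
qed simp

lemma path_length_le:
  assumes "is_path V E p" shows "length p \<le> 2 * M + 1"
  using path_length_le_dep[of p] M[of "hd p"] assms unfolding is_path_def
  by (smt (verit) add_mono_thms_linordered_semiring(3) hd_in_set le_trans mult_2 subsetD)

end

section \<open>Transport of graphs along injections\<close>

lemma is_path_image:
  assumes f: "inj_on f V" and p: "is_path V E p"
  shows "is_path (f ` V) ((`) f ` E) (map f p)"
proof -
  have "successively (\<lambda>u v. {f u, f v} \<in> (`) f ` E) p"
    using p unfolding is_path_def by (auto elim!: successively_mono intro: rev_image_eqI)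
  moreover have "inj_on f (set p)" using f p by (auto simp: is_path_def intro: inj_on_subset)
  ultimately show ?thesis using p by (auto simp: is_path_def distinct_map successively_map)
qed

text \<open>With the inverse at hand, a lemma about images also carries paths and cycles back from
  the image to the original graph.\<close>

lemma graph_image_inverse:
  assumes f: "inj_on f V" and sg: "simple_graph V E"
  defines "g \<equiv> inv_into V f"
  shows "g ` f ` V = V" "(`) g ` (`) f ` E = E" "inj_on g (f ` V)"
proof -
  have sub: "e \<subseteq> V" if "e \<in> E" for e using sg that unfolding simple_graph_def by blast
  have gf: "g ` f ` A = A" if "A \<subseteq> V" for A
    using that f unfolding g_def by (metis inv_into_image_cancel)
  show "g ` f ` V = V" by (rule gf) simp
  show "inj_on g (f ` V)" unfolding g_def by (simp add: inj_on_inv_into)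
  show "(`) g ` (`) f ` E = E" 
  proof -
    have "(`) g ` (`) f ` E = (\<lambda>e. g ` f ` e) ` E" by (rule image_image)
    also have "\<dots> = (\<lambda>e. e) ` E" by (rule image_cong) (use gf sub in auto)
    finally show ?thesis by simp
  qed
qed

lemma simple_graph_image:
  assumes "inj_on f V" "simple_graph V E"
  shows "simple_graph (f ` V) ((`) f ` E)"
  unfolding simple_graph_def
proof
  show "finite (f ` V)" using assms(2) by (simp add: simple_graph_def)
  show "(`) f ` E \<subseteq> {{u, v} |u v. u \<in> f ` V \<and> v \<in> f ` V \<and> u \<noteq> v}"
  proof
    fix e assume "e \<in> (`) f ` E"
    then obtain d where d: "d \<in> E" "e = f ` d" by blast
    obtain a b where "d = {a, b}" "a \<in> V" "b \<in> V" "a \<noteq> b"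
      using subsetD[OF conjunct2[OF assms(2)[unfolded simple_graph_def]] d(1)] by blast
    moreover from this have "f a \<noteq> f b" using inj_onD[OF assms(1)] by blast
    ultimately show "e \<in> {{u, v} |u v. u \<in> f ` V \<and> v \<in> f ` V \<and> u \<noteq> v}" using d(2) by auto
  qed
qed

lemma path_lengths_image:
  assumes f: "inj_on f V" and sg: "simple_graph V E"
  shows "{length p | p. is_path (f ` V) ((`) f ` E) p} = {length p | p. is_path V E p}"
proof -
  note g = graph_image_inverse[OF f sg]
  have "\<exists>q. is_path V E q \<and> length q = length p" if "is_path (f ` V) ((`) f ` E) p" for p
    using is_path_image[OF g(3) that] unfolding g by (metis length_map)
  moreover have "\<exists>q. is_path (f ` V) ((`) f ` E) q \<and> length q = length p" if "is_path V E p" for p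
    using is_path_image[OF f that] by (metis length_map)
  ultimately show ?thesis by (auto; metis)
qed

lemma tree_image:
  assumes f: "inj_on f V" and T: "tree V E"
  shows "tree (f ` V) ((`) f ` E)"
proof -
  have sg: "simple_graph V E" and con: "connected_graph V E" and nc: "\<nexists>p. is_cycle V E p"
    using T by (auto simp: tree_def)
  note g = graph_image_inverse[OF f sg]
  let ?g = "inv_into V f"
  have "connected_graph (f ` V) ((`) f ` E)"
    unfolding connected_graph_def
  proof (intro conjI ballI)
    show "f ` V \<noteq> {}" using con by (simp add: connected_graph_def)
    fix u v assume "u \<in> f ` V" "v \<in> f ` V"
    then obtain a b where ab: "a \<in> V" "b \<in> V" "u = f a" "v = f b" by blast
    then obtain p where p: "is_path V E p" "hd p = a" "last p = b"
      using con unfolding connected_graph_def by blast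
    then show "\<exists>p. is_path (f ` V) ((`) f ` E) p \<and> hd p = u \<and> last p = v"
      using is_path_image[OF f p(1)] ab by (intro exI[of _ "map f p"]) (auto simp: is_path_def hd_map last_map)
  qed
  moreover have "\<nexists>p. is_cycle (f ` V) ((`) f ` E) p"
  proof
    assume "\<exists>p. is_cycle (f ` V) ((`) f ` E) p"
    then obtain p where p: "is_path (f ` V) ((`) f ` E) p" "3 \<le> length p" "{last p, hd p} \<in> (`) f ` E"
      by (auto simp: is_cycle_def)
    have "is_path V E (map ?g p)" using is_path_image[OF g(3) p(1)] unfolding g .
    moreover have "?g ` {last p, hd p} \<in> (`) ?g ` (`) f ` E" using p(3) by (rule imageI)
    then have "?g ` {last p, hd p} \<in> E" unfolding g .
    moreover have "p \<noteq> []" using p by auto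
    ultimately have "is_cycle V E (map ?g p)" using p(2) by (simp add: is_cycle_def hd_map last_map)
    then show False using nc by blast
  qed
  ultimately show ?thesis using simple_graph_image[OF f sg] by (simp add: tree_def)
qed

lemma degree_image:
  assumes f: "inj_on f V" and sg: "simple_graph V E" and v: "v \<in> V"
  shows "degree ((`) f ` E) (f v) = degree E v"
proof -
  have sub: "e \<subseteq> V" if "e \<in> E" for e using sg that unfolding simple_graph_def by blast
  have "{e \<in> (`) f ` E. f v \<in> e} = (`) f ` {e \<in> E. v \<in> e}"
  proof -
    have "f v \<in> f ` e \<longleftrightarrow> v \<in> e" if "e \<in> E" for e
      by (rule inj_on_image_mem_iff[OF f v sub[OF that]])
    then show ?thesis by blast
  qed
  moreover have "inj_on ((`) f) {e \<in> E. v \<in> e}"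
    by (rule inj_on_subset[OF inj_on_image_Pow[OF f]]) (use sub in auto)
  ultimately show ?thesis by (simp add: degree_def card_image)
qed

lemma width_image:
  assumes f: "inj_on f V" and sg: "simple_graph V E" and BW: "B \<subseteq> V" "W \<subseteq> V"
  shows "width ((`) f ` E) (f ` B) (f ` W) = width E B W"
proof -
  have sub: "e \<subseteq> V" if "e \<in> E" for e using sg that unfolding simple_graph_def by blast
  have "{e \<in> (`) f ` E. \<exists>b\<in>f ` B. \<exists>w\<in>f ` W. e = {b, w}} = (`) f ` {e \<in> E. \<exists>b\<in>B. \<exists>w\<in>W. e = {b, w}}"
  proof -
    have "f ` e = {f b, f w} \<longleftrightarrow> e = {b, w}" if "e \<in> E" "b \<in> B" "w \<in> W" for e b w
      using inj_on_image_eq_iff[OF f sub[OF that(1)], of "{b, w}"] that BW by auto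
    then show ?thesis by (intro set_eqI iffI) (auto simp: image_iff, metis+)
  qed
  moreover have "inj_on ((`) f) {e \<in> E. \<exists>b\<in>B. \<exists>w\<in>W. e = {b, w}}"
    by (rule inj_on_subset[OF inj_on_image_Pow[OF f]]) (use sub in auto)
  ultimately show ?thesis by (simp add: width_def card_image)
qed

lemma min_bis_le:
  assumes "finite V" "bisection V B W"
  shows "min_bis V E \<le> width E B W"
proof -
  have "{width E B W | B W. bisection V B W} \<subseteq> (\<lambda>(B, W). width E B W) ` (Pow V \<times> Pow V)"
    by (force simp: bisection_def)
  then have "finite {width E B W | B W. bisection V B W}"
    by (rule finite_subset) (use assms in simp)
  then show ?thesis unfolding min_bis_def by (rule Min_le) (use assms in blast)
qed

section \<open>Shifted points on a cycle\<close>

text \<open>The cyclic translate \<open>X - \<nu>\<close>, encoded by the membership test that the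
  program evaluates.\<close>

definition shifted :: "nat \<Rightarrow> nat set \<Rightarrow> nat \<Rightarrow> nat set" where
  "shifted z X \<nu> = {i. i < z \<and> (i + \<nu>) mod z \<in> X}"

text \<open>The gap \<open>{s..<e}\<close> owns its left end, so that the arcs tile all slots once
  \<open>0 \<in> X\<close>.\<close>

definition arc :: "nat \<Rightarrow> nat set \<Rightarrow> nat \<Rightarrow> nat \<Rightarrow> bool" where
  "arc z X s e \<longleftrightarrow> s \<in> X \<and> s < e \<and> e \<le> z \<and> (e = z \<or> e \<in> X) \<and> (\<forall>x\<in>X. \<not> (s < x \<and> x < e))"

text \<open>A run of points of \<open>X\<close> in a gap of \<open>X + m\<close> becomes, after translation by \<open>-m\<close>, a run of points of a
  shifted copy of \<open>X\<close> in an arc of \<open>X\<close>. Hence it is enough to look at the arcs of \<open>X\<close>, for the two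
  shifts \<open>m\<close> and \<open>z - m\<close>. As \<open>0 \<in> X\<close> in all applications, no arc wraps around.\<close>

definition heavy_arc :: "nat \<Rightarrow> nat set \<Rightarrow> nat \<Rightarrow> nat \<Rightarrow> nat \<Rightarrow> bool" where
  "heavy_arc z X \<nu> s e \<longleftrightarrow> arc z X s e \<and> (let H = shifted z X \<nu> \<inter> {s<..<e} in
     H \<noteq> {} \<and> card X * ((e - s) + (Max H - Min H)) \<le> z * card H)"

text \<open>The smaller index is excluded from the range because an arc owns its left end.\<close>

definition same_arc :: "nat set \<Rightarrow> nat \<Rightarrow> nat \<Rightarrow> bool" where
  "same_arc X i j \<longleftrightarrow> (\<forall>x\<in>X. \<not> (min i j < x \<and> x \<le> max i j))"

text \<open>A charging scheme for the left side of the inequality in \<open>heavy_arc\<close>: a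
  slot receives one unit if its arc holds a shifted point, and another one if it lies in the
  half-open hull of the shifted points of its arc.\<close>

definition cell_weight :: "nat \<Rightarrow> nat set \<Rightarrow> nat \<Rightarrow> nat \<Rightarrow> nat" where
  "cell_weight z X \<nu> i =
     (if \<exists>c\<in>shifted z X \<nu>. same_arc X i c then 1 else 0) +
     (if \<exists>c\<in>shifted z X \<nu>. \<exists>d\<in>shifted z X \<nu>. c \<le> i \<and> i < d \<and> same_arc X c d then 1 else 0)"

section \<open>Cyclic shifts modulo \<open>z\<close>\<close>

lemma bij_betw_add_mod:
  fixes z \<nu> :: nat
  assumes "0 < z"
  shows "bij_betw (\<lambda>i. (i + \<nu>) mod z) {..<z} {..<z}"
proof -
  have "inj_on (\<lambda>i. (i + \<nu>) mod z) {..<z}"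
  proof (rule inj_onI)
    fix i j assume ij: "i \<in> {..<z}" "j \<in> {..<z}" "(i + \<nu>) mod z = (j + \<nu>) mod z"
    then have "int (i + \<nu>) mod int z = int (j + \<nu>) mod int z"
      by (metis zmod_int)
    then have "int i mod int z = int j mod int z"
      by (metis add_diff_cancel_right' mod_diff_left_eq of_nat_add)
    then show "i = j" using ij by (metis lessThan_iff mod_less of_nat_eq_iff zmod_int)
  qed
  moreover have "(\<lambda>i. (i + \<nu>) mod z) ` {..<z} \<subseteq> {..<z}" using assms by auto
  ultimately show ?thesis
    by (metis bij_betw_def endo_inj_surj finite_lessThan)
qed

lemma add_mod_shift_inverse:
  fixes z \<nu> i :: nat
  assumes "i < z" "\<nu> \<le> z"
  shows "((i + \<nu>) mod z + (z - \<nu>)) mod z = i"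
proof -
  have "((i + \<nu>) mod z + (z - \<nu>)) mod z = (i + \<nu> + (z - \<nu>)) mod z"
    by (simp add: mod_add_left_eq)
  then show ?thesis using assms by simp
qed

lemma card_shifted:
  assumes "0 < z" "X \<subseteq> {..<z}"
  shows "card (shifted z X \<nu>) = card X"
proof -
  have b: "bij_betw (\<lambda>i. (i + \<nu>) mod z) {..<z} {..<z}" by (rule bij_betw_add_mod[OF assms(1)])
  have "(\<lambda>i. (i + \<nu>) mod z) ` shifted z X \<nu> = X"
  proof
    show "X \<subseteq> (\<lambda>i. (i + \<nu>) mod z) ` shifted z X \<nu>"
    proof
      fix x assume x: "x \<in> X"
      then have "x \<in> (\<lambda>i. (i + \<nu>) mod z) ` {..<z}"
        using b assms(2) unfolding bij_betw_def by blast
      then obtain i where "i < z" "x = (i + \<nu>) mod z" by blast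
      then show "x \<in> (\<lambda>i. (i + \<nu>) mod z) ` shifted z X \<nu>"
        using x by (auto simp: shifted_def)
    qed
  qed (auto simp: shifted_def)
  moreover have "inj_on (\<lambda>i. (i + \<nu>) mod z) (shifted z X \<nu>)"
    using b by (rule inj_on_subset[OF bij_betw_imp_inj_on]) (auto simp: shifted_def)
  ultimately show ?thesis by (metis card_image)
qed

lemma mod_shift_eq:
  fixes i d z :: nat
  assumes "j = (i + \<nu>) mod z" "d \<le> j" "d \<le> i" "i < z"
  shows "(i - d + \<nu>) mod z = j - d"
proof -
  have "i + \<nu> = (i + \<nu>) div z * z + j" using assms(1) by simp
  then have "i - d + \<nu> = (j - d) + (i + \<nu>) div z * z" using assms by linarith
  moreover have "j < z" using assms by auto
  ultimately show ?thesis by (metis less_imp_diff_less mod_less mod_mult_self1)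
qed

lemma mod_shift_eq_add:
  fixes i d z :: nat
  assumes "j = (i + \<nu>) mod z" "j + d < z"
  shows "(i + d + \<nu>) mod z = j + d"
proof -
  have "i + \<nu> = (i + \<nu>) div z * z + j" using assms(1) by simp
  then have "i + d + \<nu> = (j + d) + (i + \<nu>) div z * z" by linarith
  then show ?thesis using assms by (metis mod_less mod_mult_self1)
qed

text \<open>A cell between two points of the shifted set and without a point of \<open>X\<close> in between is
  moved by the shift into an arc that lies between two neighbouring points of \<open>X\<close>; the points of
  the inversely shifted set in that arc would come from points of \<open>X\<close> in the excluded range.\<close>

lemma cell_weight_two_imp_zero:
  assumes X: "X \<subseteq> {..<z}" and nu: "\<nu> \<le> z"
    and nohit: "\<And>x. x \<in> X \<Longrightarrow> x \<notin> shifted z X \<nu>"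
    and c: "c \<in> shifted z X \<nu>" and d: "d \<in> shifted z X \<nu>"
    and cid: "c \<le> i" "i < d" and cd: "same_arc X c d"
  shows "cell_weight z X (z - \<nu>) ((i + \<nu>) mod z) = 0"
proof -
  define j where "j = (i + \<nu>) mod z"
  have dz: "d < z" and cX: "(c + \<nu>) mod z \<in> X" and dX: "(d + \<nu>) mod z \<in> X"
    using c d by (auto simp: shifted_def)
  have inj: "u = v" if "u < z" "v < z" "(u + \<nu>) mod z = (v + \<nu>) mod z" for u v
    using inj_onD[OF bij_betw_imp_inj_on[OF bij_betw_add_mod[of z \<nu>]], of u v] that dz by simp
  have noX: "x \<notin> X" if "c \<le> x" "x \<le> d" for x
    using that cd cid nohit[of c] c by (cases "x = c") (auto simp: same_arc_def)
  have "\<not> same_arc X j g" if g: "g \<in> shifted z X (z - \<nu>)" for g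
  proof
    assume sa: "same_arc X j g"
    define a where "a = (g + (z - \<nu>)) mod z"
    have a: "a \<in> X" "a < z" and gz: "g < z" using g X by (auto simp: shifted_def a_def)
    have ga: "(a + \<nu>) mod z = g"
      using add_mod_shift_inverse[of g z "z - \<nu>"] gz nu by (simp add: a_def)
    show False
    proof (cases "g \<le> j")
      case True
      show False
      proof (cases "j - g \<le> i - c")
        case True
        have "(i - (j - g) + \<nu>) mod z = j - (j - g)"
          by (rule mod_shift_eq) (use j_def True cid dz in auto)
        then have "(i - (j - g) + \<nu>) mod z = (a + \<nu>) mod z" using \<open>g \<le> j\<close> ga by simp
        then have "a = i - (j - g)" using inj[of a "i - (j - g)"] a cid dz by simp
        then show False using noX[of a] a(1) True cid by auto
      next
        case False
        then have "(i - (i - c) + \<nu>) mod z = j - (i - c)"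
          by (intro mod_shift_eq) (use j_def cid dz in auto)
        then have "j - (i - c) \<in> X" using cX cid by simp
        moreover have "g < j - (i - c)" using False True by simp
        ultimately show False using sa True unfolding same_arc_def by (metis diff_le_self max.absorb1 min.absorb2)
      qed
    next
      case gj: False
      show False
      proof (cases "d - i \<le> g - j")
        case True
        then have "(i + (d - i) + \<nu>) mod z = j + (d - i)"
          by (intro mod_shift_eq_add) (use j_def gz gj in auto)
        then have "j + (d - i) \<in> X" using dX cid by simp
        moreover have "j < j + (d - i)" "j + (d - i) \<le> g" using gj True cid by auto
        ultimately show False using sa gj unfolding same_arc_def by (metis max.absorb2 min.absorb1 nat_le_linear)
      next
        case False
        have "(i + (g - j) + \<nu>) mod z = j + (g - j)"
          by (intro mod_shift_eq_add) (use j_def gz gj in auto)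
        then have "(i + (g - j) + \<nu>) mod z = (a + \<nu>) mod z" using gj ga by simp
        then have "a = i + (g - j)" using inj[of a "i + (g - j)"] a False dz by simp
        then show False using noX[of a] a(1) False cid by auto
      qed
    qed
  qed
  moreover have "same_arc X j e" if "c' \<le> j" "j < e" "same_arc X c' e" for c' e
    using that unfolding same_arc_def by (simp add: min_def max_def)
  ultimately have "\<not> (\<exists>c\<in>shifted z X (z - \<nu>). same_arc X j c)"
    "\<not> (\<exists>c\<in>shifted z X (z - \<nu>). \<exists>d\<in>shifted z X (z - \<nu>). c \<le> j \<and> j < d \<and> same_arc X c d)"
    by blast+
  then show ?thesis unfolding cell_weight_def j_def[symmetric] by simp
qed

text \<open>Pair each slot with its translate, weighed for the inverse shift. A weight of 2 at one
  of them forces 0 at the other, so a pair never weighs more than 2, and translation is a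
  bijection.\<close>

lemma sum_cell_weight_le:
  assumes z: "0 < z" and X: "X \<subseteq> {..<z}" and nu: "\<nu> \<le> z"
    and nohit: "\<And>x. x \<in> X \<Longrightarrow> x \<notin> shifted z X \<nu>"
    and nohit': "\<And>x. x \<in> X \<Longrightarrow> x \<notin> shifted z X (z - \<nu>)"
  shows "(\<Sum>i<z. cell_weight z X \<nu> i) + (\<Sum>i<z. cell_weight z X (z - \<nu>) i) \<le> 2 * z"
proof -
  have *: "cell_weight z X \<nu> i + cell_weight z X (z - \<nu>) ((i + \<nu>) mod z) \<le> 2" if i: "i < z" for i
  proof -
    let ?j = "(i + \<nu>) mod z"
    have j: "?j < z" using z by simp
    have le: "cell_weight z X \<mu> l \<le> 2" for \<mu> l by (auto simp: cell_weight_def)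
    have two: "\<exists>c d. c \<in> shifted z X \<mu> \<and> d \<in> shifted z X \<mu> \<and> c \<le> l \<and> l < d \<and> same_arc X c d"
      if "\<not> cell_weight z X \<mu> l \<le> 1" for \<mu> l
      using that by (auto simp: cell_weight_def split: if_splits)
    consider "cell_weight z X \<nu> i \<le> 1 \<and> cell_weight z X (z - \<nu>) ?j \<le> 1"
      | "\<not> cell_weight z X \<nu> i \<le> 1" | "\<not> cell_weight z X (z - \<nu>) ?j \<le> 1" by blast
    then show ?thesis
    proof cases
      case 1 then show ?thesis by simp
    next
      case 2
      then have "cell_weight z X (z - \<nu>) ?j = 0"
        using two[OF 2] cell_weight_two_imp_zero[OF X nu nohit] by blast
      then show ?thesis using le[of \<nu> i] by simp
    next
      case 3
      \<comment> \<open>Inverting the shift twice gives back \<open>\<nu>\<close>, so the same lemma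
        applies with the roles exchanged.\<close>
      then have "cell_weight z X (z - (z - \<nu>)) ((?j + (z - \<nu>)) mod z) = 0"
        using two[OF 3] cell_weight_two_imp_zero[OF X _ nohit', of _ _ ?j] by (metis diff_le_self)
      then have "cell_weight z X \<nu> i = 0"
        using add_mod_shift_inverse[OF i nu] nu by simp
      then show ?thesis using le[of "z - \<nu>" ?j] by simp
    qed
  qed
  have "(\<Sum>i<z. cell_weight z X (z - \<nu>) i) = (\<Sum>i<z. cell_weight z X (z - \<nu>) ((i + \<nu>) mod z))"
    by (rule sum.reindex_bij_betw[OF bij_betw_add_mod[OF z], symmetric])
  then have "(\<Sum>i<z. cell_weight z X \<nu> i) + (\<Sum>i<z. cell_weight z X (z - \<nu>) i)
    = (\<Sum>i<z. cell_weight z X \<nu> i + cell_weight z X (z - \<nu>) ((i + \<nu>) mod z))"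
    by (simp add: sum.distrib)
  also have "\<dots> \<le> (\<Sum>i<z. 2)" by (rule sum_mono) (use * in auto)
  finally show ?thesis by simp
qed

section \<open>Averaging over the arcs\<close>

definition arc_end :: "nat \<Rightarrow> nat set \<Rightarrow> nat \<Rightarrow> nat" where
  "arc_end z X s = Min (insert z {x\<in>X. s < x})"

lemma arc_arc_end:
  assumes "X \<subseteq> {..<z}" "s \<in> X"
  shows "arc z X s (arc_end z X s)"
proof -
  have f: "finite (insert z {x\<in>X. s < x})" using assms finite_subset by fastforce
  have "arc_end z X s \<in> insert z {x\<in>X. s < x}"
    unfolding arc_end_def by (rule Min_in) (use f in auto)
  moreover have "arc_end z X s \<le> x" if "x = z \<or> x \<in> X \<and> s < x" for x
    unfolding arc_end_def by (rule Min_le) (use f that in auto)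
  ultimately show ?thesis using assms unfolding arc_def by force
qed

lemma arc_unique:
  assumes "arc z X s e" "arc z X s' e'" "i \<in> {s..<e}" "i \<in> {s'..<e'}"
  shows "s = s'" "e = e'"
proof -
  have sle: "\<not> s < s'" using assms unfolding arc_def by (metis atLeastLessThan_iff order_le_less_trans)
  have sle': "\<not> s' < s" using assms unfolding arc_def by (metis atLeastLessThan_iff order_le_less_trans)
  show ss: "s = s'" using sle sle' by simp
  have "\<not> e < e'" "\<not> e' < e" using assms ss unfolding arc_def by (metis not_le)+
  then show "e = e'" by simp
qed

text \<open>The arc of a slot starts at the last point of \<open>X\<close> up to it, which exists
  because \<open>0 \<in> X\<close>.\<close>

lemma arcs_cover:
  assumes X: "X \<subseteq> {..<z}" "0 \<in> X"
  shows "(\<Union>s\<in>X. {s..<arc_end z X s}) = {..<z}"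
proof
  show "(\<Union>s\<in>X. {s..<arc_end z X s}) \<subseteq> {..<z}"
    using arc_arc_end[OF X(1)] by (fastforce simp: arc_def)
  show "{..<z} \<subseteq> (\<Union>s\<in>X. {s..<arc_end z X s})"
  proof
    fix i assume i: "i \<in> {..<z}"
    define s where "s = Max {x\<in>X. x \<le> i}"
    have ne: "{x\<in>X. x \<le> i} \<noteq> {}" using X by auto
    have f: "finite {x\<in>X. x \<le> i}" by simp
    have s: "s \<in> X" "s \<le> i" using Max_in[OF f ne] by (auto simp: s_def)
    have "x \<le> s" if "x \<in> X" "x \<le> i" for x using Max_ge[OF f] that by (simp add: s_def)
    then have "i < arc_end z X s"
      using arc_arc_end[OF X(1) s(1)] i unfolding arc_def by (metis lessThan_iff linorder_not_less)
    then show "i \<in> (\<Union>s\<in>X. {s..<arc_end z X s})" using s by auto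
  qed
qed

text \<open>In an arc with a shifted point every slot earns one unit, which pays for
  \<open>e - s\<close>; the \<open>Max H - Min H\<close> slots of the half-open hull earn a second
  one.\<close>

lemma arc_weight_le:
  assumes a: "arc z X s e" and H: "H = shifted z X \<nu> \<inter> {s<..<e}" "H \<noteq> {}"
  shows "(e - s) + (Max H - Min H) \<le> (\<Sum>i\<in>{s..<e}. cell_weight z X \<nu> i)"
proof -
  have fH: "finite H" using H by simp
  have M: "Max H \<in> H" "Min H \<in> H" using fH H(2) by auto
  have sa: "same_arc X i j" if "i \<in> {s..<e}" "j \<in> {s..<e}" for i j
    using that a unfolding same_arc_def arc_def
    by (metis atLeastLessThan_iff max_def min_def order.strict_trans1 order_le_less_trans)
  have "(\<Sum>i\<in>{s..<e}. 1 + (if i \<in> {Min H..<Max H} then 1 else 0)) \<le> (\<Sum>i\<in>{s..<e}. cell_weight z X \<nu> i)"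
  proof (rule sum_mono)
    fix i assume i: "i \<in> {s..<e}"
    have 1: "\<exists>c\<in>shifted z X \<nu>. same_arc X i c" using M(1) sa[OF i, of "Max H"] H(1) by (intro bexI[of _ "Max H"]) simp_all
    have 2: "\<exists>c\<in>shifted z X \<nu>. \<exists>d\<in>shifted z X \<nu>. c \<le> i \<and> i < d \<and> same_arc X c d"
      if "i \<in> {Min H..<Max H}"
      using that M sa[of "Min H" "Max H"] H(1) 
      by (intro bexI[of _ "Min H"] bexI[of _ "Max H"]) simp_all
    show "1 + (if i \<in> {Min H..<Max H} then 1 else 0) \<le> cell_weight z X \<nu> i"
      unfolding cell_weight_def using 1 2 by auto
  qed
  moreover have "(\<Sum>i\<in>{s..<e}. 1 + (if i \<in> {Min H..<Max H} then 1 else (0::nat)))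
     = (e - s) + card ({s..<e} \<inter> {Min H..<Max H})"
  proof -
    have "(\<Sum>i\<in>A. if i \<in> B then 1 else (0::nat)) = card (A \<inter> B)" if "finite A" for A B :: "nat set"
      using that by (simp add: sum.If_cases)
    then show ?thesis unfolding sum.distrib by (simp only: finite_atLeastLessThan) simp
  qed
  moreover have "card ({s..<e} \<inter> {Min H..<Max H}) = Max H - Min H"
  proof -
    have "{s..<e} \<inter> {Min H..<Max H} = {Min H..<Max H}" using M H(1) by auto
    then show ?thesis by (metis card_atLeastLessThan)
  qed
  ultimately show ?thesis by linarith
qed

text \<open>If no arc were heavy for either shift, the reversed strict inequalities, summed over all
  arcs and both shifts, would force a total weight above \<open>2 * z\<close>.\<close>

lemma heavy_arc_exists:
  assumes z: "0 < z" and X: "X \<subseteq> {..<z}" "0 \<in> X" and nu: "\<nu> \<le> z"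
    and nohit: "\<And>x. x \<in> X \<Longrightarrow> x \<notin> shifted z X \<nu>"
    and nohit': "\<And>x. x \<in> X \<Longrightarrow> x \<notin> shifted z X (z - \<nu>)"
  shows "\<exists>s e. heavy_arc z X \<nu> s e \<or> heavy_arc z X (z - \<nu>) s e"
proof (rule ccontr)
  assume no: "\<not> ?thesis"
  let ?k = "card X"
  have finX: "finite X" using X finite_subset by blast
  have k: "0 < ?k" using X finX by (auto simp: card_gt_0_iff)
  have "z * ?k < ?k * (\<Sum>i<z. cell_weight z X \<mu> i)"
    if noh: "\<And>x. x \<in> X \<Longrightarrow> x \<notin> shifted z X \<mu>" and ng: "\<And>s e. \<not> heavy_arc z X \<mu> s e" for \<mu>
  proof -
    let ?H = "\<lambda>s. shifted z X \<mu> \<inter> {s<..<arc_end z X s}"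
    have disj: "\<forall>s\<in>X. \<forall>t\<in>X. s \<noteq> t \<longrightarrow> {s..<arc_end z X s} \<inter> {t..<arc_end z X t} = {}"
      using arc_unique[OF arc_arc_end[OF X(1)] arc_arc_end[OF X(1)]] by blast
    have "shifted z X \<mu> \<subseteq> (\<Union>s\<in>X. {s..<arc_end z X s})"
      unfolding arcs_cover[OF X] by (auto simp: shifted_def)
    have "\<exists>s\<in>X. c \<in> {s<..<arc_end z X s}" if cs: "c \<in> shifted z X \<mu>" for c
    proof -
      obtain s where s: "s \<in> X" "c \<in> {s..<arc_end z X s}"
        using \<open>shifted z X \<mu> \<subseteq> _\<close> cs by blast
      then have "s \<noteq> c" using noh[of s] cs by blast
      then show ?thesis using s by (intro bexI[of _ s]) simp_all
    qed
    then have U: "shifted z X \<mu> = (\<Union>s\<in>X. ?H s)" by blast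
    have disjH: "\<forall>s\<in>X. \<forall>t\<in>X. s \<noteq> t \<longrightarrow> ?H s \<inter> ?H t = {}"
    proof (intro ballI impI)
      fix s t assume "s \<in> X" "t \<in> X" "s \<noteq> t"
      then have "{s..<arc_end z X s} \<inter> {t..<arc_end z X t} = {}" using disj by blast
      moreover have "?H s \<subseteq> {s..<arc_end z X s}" "?H t \<subseteq> {t..<arc_end z X t}" by auto
      ultimately show "?H s \<inter> ?H t = {}" by blast
    qed
    have cardU: "card (shifted z X \<mu>) = (\<Sum>s\<in>X. card (?H s))"
      by (subst U, rule card_UN_disjoint) (use finX disjH in simp_all)
    \<comment> \<open>The summand 1 records that the inequality is strict on arcs with shifted
      points. Empty arcs only satisfy the weak form, so one nonempty arc is exhibited below.\<close>
    have le: "z * card (?H s) + (if ?H s = {} then 0 else 1)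
        \<le> ?k * (\<Sum>i\<in>{s..<arc_end z X s}. cell_weight z X \<mu> i)"
      if s: "s \<in> X" for s
    proof (cases "?H s = {}")
      case False
      have a: "arc z X s (arc_end z X s)" by (rule arc_arc_end[OF X(1) s])
      have "z * card (?H s) < ?k * ((arc_end z X s - s) + (Max (?H s) - Min (?H s)))"
        using ng[of s "arc_end z X s"] a False unfolding heavy_arc_def Let_def by auto
      also have "\<dots> \<le> ?k * (\<Sum>i\<in>{s..<arc_end z X s}. cell_weight z X \<mu> i)"
        by (rule mult_le_mono2[OF arc_weight_le[OF a refl False]])
      finally show ?thesis by simp
    qed auto
    have "shifted z X \<mu> \<noteq> {}" using card_shifted[OF z X(1), of \<mu>] k by auto
    then obtain s0 where s0: "s0 \<in> X" "?H s0 \<noteq> {}" using U by blast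
    have "z * ?k = (\<Sum>s\<in>X. z * card (?H s))"
      using cardU card_shifted[OF z X(1)] by (simp add: sum_distrib_left)
    also have "\<dots> < (\<Sum>s\<in>X. z * card (?H s) + (if ?H s = {} then 0 else 1))"
      by (rule sum_strict_mono_ex1) (use finX s0 in simp, simp, use s0 in \<open>intro bexI[of _ s0], simp_all\<close>)
    also have "\<dots> \<le> (\<Sum>s\<in>X. ?k * (\<Sum>i\<in>{s..<arc_end z X s}. cell_weight z X \<mu> i))"
      by (rule sum_mono) (rule le)
    also have "\<dots> = ?k * (\<Sum>i\<in>(\<Union>s\<in>X. {s..<arc_end z X s}). cell_weight z X \<mu> i)"
      by (subst sum.UNION_disjoint) (use finX disj in \<open>simp_all add: sum_distrib_left\<close>)
    finally show ?thesis unfolding arcs_cover[OF X] .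
  qed
  then have "z * ?k < ?k * (\<Sum>i<z. cell_weight z X \<nu> i)"
    "z * ?k < ?k * (\<Sum>i<z. cell_weight z X (z - \<nu>) i)"
    using no nohit nohit' by blast+
  then have "2 * (z * ?k) < ?k * ((\<Sum>i<z. cell_weight z X \<nu> i) + (\<Sum>i<z. cell_weight z X (z - \<nu>) i))"
    unfolding distrib_left by linarith
  also have "\<dots> \<le> ?k * (2 * z)"
    by (rule mult_le_mono2[OF sum_cell_weight_le[OF z X(1) nu nohit nohit']])
  finally show False by simp
qed

section \<open>Preorder layout and cut sizes\<close>

definition children :: "nat \<Rightarrow> (nat \<Rightarrow> nat) \<Rightarrow> nat \<Rightarrow> nat set" where
  "children n P u = {j. 0 < j \<and> j < n \<and> P j = u}"

text \<open>\<open>sz u\<close> is the number of proper descendants of \<open>u\<close>, and \<open>sp u\<close> is the child that is visited last.\<close>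

locale tree_layout =
  fixes n :: nat and P sz sp pos lam :: "nat \<Rightarrow> nat"
  assumes n_pos: "0 < n"
    and P_less: "\<And>j. 0 < j \<Longrightarrow> j < n \<Longrightarrow> P j < j"
    and sz: "\<And>u. u < n \<Longrightarrow> sz u = (\<Sum>j\<in>children n P u. sz j + 1)"
    and sp_ch: "\<And>u. u < n \<Longrightarrow> children n P u \<noteq> {} \<Longrightarrow> sp u \<in> children n P u"
    and heavy: "\<And>u j. u < n \<Longrightarrow> lam u \<noteq> 0 \<Longrightarrow> j \<in> children n P u \<Longrightarrow> sz j \<le> sz (sp u)"
    and pos_root: "pos 0 = 0" and lam_root: "lam 0 = 0"
    and pos_special: "\<And>u j. j \<in> children n P u \<Longrightarrow> sp u = j \<Longrightarrow> pos j = pos u + sz u - sz j"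
    and lam_special: "\<And>u j. j \<in> children n P u \<Longrightarrow> sp u = j \<Longrightarrow> lam j = lam u"
    and pos_other: "\<And>u j. j \<in> children n P u \<Longrightarrow> sp u \<noteq> j \<Longrightarrow>
          pos j = pos u + 1 + (\<Sum>l\<in>{l\<in>children n P u. l < j \<and> l \<noteq> sp u}. sz l + 1)"
    and lam_other: "\<And>u j. j \<in> children n P u \<Longrightarrow> sp u \<noteq> j \<Longrightarrow> lam j = lam u + 1"
begin

abbreviation ch :: "nat \<Rightarrow> nat set" where "ch \<equiv> children n P"

text \<open>The positions occupied by the subtree of \<open>u\<close>.\<close>

definition J :: "nat \<Rightarrow> nat set" where "J u = {pos u..pos u + sz u}"

text \<open>A vertex \<open>w\<close> stands for the edge to its parent. These are the edges between
  the first \<open>p\<close> positions and the rest, since a parent always precedes its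
  children.\<close>

definition crossing :: "nat \<Rightarrow> nat set" where
  "crossing p = {w. 0 < w \<and> w < n \<and> pos (P w) < p \<and> p \<le> pos w}"

section \<open>Subtrees as intervals of positions\<close>

lemma finite_ch [simp]: "finite (ch u)"
  by (rule finite_subset[of _ "{..<n}"]) (auto simp: children_def)

lemma chD: "j \<in> ch u \<Longrightarrow> 0 < j \<and> j < n \<and> P j = u \<and> u < j \<and> u < n"
  using P_less[of j] by (auto simp: children_def)

lemma ch_P: "0 < j \<Longrightarrow> j < n \<Longrightarrow> j \<in> ch (P j)"
  by (simp add: children_def)

text \<open>Summed over all \<open>u\<close>, the recursion counts every vertex other than the root
  once as a child, and everything but \<open>sz 0\<close> cancels.\<close>

lemma sz_root: "sz 0 = n - 1"
proof -
  have "(\<Sum>u<n. sz u) = (\<Sum>u<n. \<Sum>j\<in>ch u. sz j + 1)" by (rule sum.cong) (use sz in auto)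
  also have "\<dots> = (\<Sum>j\<in>(\<Union>u\<in>{..<n}. ch u). sz j + 1)"
    by (rule sum.UNION_disjoint[symmetric]) (auto simp: children_def)
  also have "(\<Union>u\<in>{..<n}. ch u) = {..<n} - {0}"
    using P_less by (fastforce simp: children_def)
  also have "(\<Sum>j\<in>{..<n} - {0}. sz j + 1) = (\<Sum>j\<in>{..<n} - {0}. sz j) + (n - 1)"
    using n_pos by (simp only: sum.distrib) simp
  also have "(\<Sum>u<n. sz u) = sz 0 + (\<Sum>j\<in>{..<n} - {0}. sz j)"
    using n_pos by (intro sum.remove) auto
  finally show ?thesis by simp
qed

lemma sz_child: "j \<in> ch u \<Longrightarrow> sz j + 1 \<le> sz u"
  using sz[of u] member_le_sum[of j "ch u" "\<lambda>j. sz j + 1"] chD by simp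

lemma sz_subset: "A \<subseteq> ch u \<Longrightarrow> u < n \<Longrightarrow> (\<Sum>j\<in>A. sz j + 1) \<le> sz u"
  using sz[of u] sum_mono2[of "ch u" A "\<lambda>j. sz j + 1"] by simp

text \<open>The offset of \<open>j\<close>, its own subtree and the subtree of the last child are
  disjoint parts of the sum that makes up \<open>sz u\<close>.\<close>

lemma other_before_special:
  assumes j: "j \<in> ch u" "sp u \<noteq> j"
  shows "pos j + sz j < pos (sp u)"
proof -
  have u: "u < n" and s: "sp u \<in> ch u" using j chD sp_ch by blast+
  let ?A = "{l\<in>ch u. l < j \<and> l \<noteq> sp u}"
  have "(\<Sum>l\<in>insert (sp u) (insert j ?A). sz l + 1) \<le> sz u" using j s u by (intro sz_subset) auto
  moreover have "(\<Sum>l\<in>insert (sp u) (insert j ?A). sz l + 1) = sz (sp u) + 1 + (sz j + 1 + (\<Sum>l\<in>?A. sz l + 1))"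
    using j by (subst sum.insert; simp)
  ultimately show ?thesis using pos_special[OF s refl] pos_other[OF j] by linarith
qed

lemma child_interval:
  assumes j: "j \<in> ch u"
  shows "pos u < pos j" "pos j + sz j \<le> pos u + sz u"
proof -
  have s: "sp u \<in> ch u" "u < n" using j chD sp_ch by blast+
  have sp: "pos u < pos (sp u)" "pos (sp u) + sz (sp u) \<le> pos u + sz u"
    using pos_special[OF s(1) refl] sz_child[OF s(1)] by linarith+
  show "pos u < pos j" by (cases "sp u = j") (use sp pos_other[OF j] in auto)
  show "pos j + sz j \<le> pos u + sz u"
    by (cases "sp u = j") (use sp other_before_special[OF j] in auto)
qed

lemma J_child: "j \<in> ch u \<Longrightarrow> J j \<subseteq> J u - {pos u}"
  using child_interval[of j u] by (auto simp: J_def)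

lemma other_before_other:
  assumes "j \<in> ch u" "l \<in> ch u" "sp u \<noteq> j" "sp u \<noteq> l" "l < j"
  shows "pos l + sz l < pos j"
proof -
  let ?A = "{i\<in>ch u. i < l \<and> i \<noteq> sp u}" and ?B = "{i\<in>ch u. i < j \<and> i \<noteq> sp u}"
  have "(\<Sum>i\<in>insert l ?A. sz i + 1) \<le> (\<Sum>i\<in>?B. sz i + 1)"
    by (rule sum_mono2) (use assms in auto)
  then show ?thesis using pos_other[of l u] pos_other[of j u] assms by simp
qed

lemma J_disjoint:
  assumes "j \<in> ch u" "l \<in> ch u" "j \<noteq> l"
  shows "J j \<inter> J l = {}"
proof -
  consider "sp u = j" | "sp u = l" | "sp u \<noteq> j" "sp u \<noteq> l" "l < j" | "sp u \<noteq> j" "sp u \<noteq> l" "j < l"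
    using assms(3) by linarith
  then have "pos l + sz l < pos j \<or> pos j + sz j < pos l"
    using assms other_before_special[of l u] other_before_special[of j u]
      other_before_other[of j u l] other_before_other[of l u j] by cases auto
  then show ?thesis by (auto simp: J_def)
qed

text \<open>The intervals of the children are disjoint and contained in
  \<open>J u - {pos u}\<close>, and both sides have \<open>sz u\<close> elements.\<close>

lemma J_tile:
  assumes u: "u < n" and p: "p \<in> J u" "p \<noteq> pos u"
  obtains j where "j \<in> ch u" "p \<in> J j"
proof -
  have "card (\<Union>j\<in>ch u. J j) = (\<Sum>j\<in>ch u. card (J j))"
    by (rule card_UN_disjoint) (use J_disjoint in \<open>auto simp: J_def\<close>)
  also have "\<dots> = sz u" using sz[OF u] by (simp add: J_def)
  also have "\<dots> = card (J u - {pos u})" by (simp add: J_def)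
  finally have "(\<Union>j\<in>ch u. J j) = J u - {pos u}"
    using J_child by (intro card_subset_eq) (auto simp: J_def)
  then show ?thesis using p that by blast
qed

lemma J_surj: "u < n \<Longrightarrow> p \<in> J u \<Longrightarrow> \<exists>v<n. pos v = p"
proof (induction "sz u" arbitrary: u rule: less_induct)
  case less
  show ?case
  proof (cases "p = pos u")
    case False
    then obtain j where j: "j \<in> ch u" "p \<in> J j" using J_tile less.prems by blast
    then show ?thesis using less.hyps[of j] sz_child[OF j(1)] chD[OF j(1)] by auto
  qed (use less in auto)
qed

lemma bij_pos: "bij_betw pos {..<n} {..<n}"
proof -
  have "{..<n} \<subseteq> pos ` {..<n}"
  proof
    fix p assume "p \<in> {..<n}"
    then have "p \<in> J 0" using sz_root pos_root by (auto simp: J_def)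
    then show "p \<in> pos ` {..<n}" using J_surj[OF n_pos] by auto
  qed
  moreover have "card (pos ` {..<n}) \<le> n" using card_image_le[of "{..<n}" pos] by simp
  ultimately have "pos ` {..<n} = {..<n}"
    by (metis card_lessThan card_mono card_subset_eq finite_imageI finite_lessThan le_antisym)
  then show ?thesis by (metis bij_betw_def card_lessThan eq_card_imp_inj_on finite_lessThan)
qed

lemma pos_inj: "v < n \<Longrightarrow> w < n \<Longrightarrow> pos v = pos w \<Longrightarrow> v = w"
  using bij_betw_imp_inj_on[OF bij_pos] by (auto dest: inj_onD)

lemma pos_less: "v < n \<Longrightarrow> pos v < n"
  using bij_betwE[OF bij_pos] by auto

lemma vertex_at: "p < n \<Longrightarrow> \<exists>v<n. pos v = p"
  using bij_pos unfolding bij_betw_def by (metis imageE lessThan_iff)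

text \<open>As \<open>lam\<close> never decreases downwards, a position with \<open>lam\<close> 0
  cannot lie in the interval of a vertex with positive \<open>lam\<close>; this is how the ends of
  arcs are located later.\<close>

lemma J_laminar:
  "c < n \<Longrightarrow> a < n \<Longrightarrow> pos a \<in> J c \<Longrightarrow> J a \<subseteq> J c \<and> lam c \<le> lam a"
proof (induction "sz c" arbitrary: c rule: less_induct)
  case less
  show ?case
  proof (cases "pos a = pos c")
    case True
    then show ?thesis using pos_inj less by blast
  next
    case False
    then obtain d where d: "d \<in> ch c" "pos a \<in> J d" using J_tile less.prems by blast
    have "J a \<subseteq> J d \<and> lam d \<le> lam a"
      using less.hyps[of d] less.prems sz_child[OF d(1)] chD[OF d(1)] d by auto
    moreover have "lam c \<le> lam d" using lam_special[OF d(1)] lam_other[OF d(1)] by (cases "sp c = d") auto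
    ultimately show ?thesis using J_child[OF d(1)] by auto
  qed
qed

lemma finite_crossing [simp]: "finite (crossing p)"
  by (rule finite_subset[of _ "{..<n}"]) (auto simp: crossing_def)

text \<open>An edge whose upper end lies properly below \<open>u\<close> stays within the interval
  of one child of \<open>u\<close> and cannot pass over the start of another. The edge above
  \<open>u\<close> is lost because \<open>u\<close> itself precedes \<open>v\<close>.\<close>

lemma crossing_child:
  assumes v: "v \<in> ch u"
  shows "crossing (pos v) \<subseteq> {w\<in>ch u. pos v \<le> pos w} \<union> (crossing (pos u) - {u})"
proof
  fix w assume w: "w \<in> crossing (pos v)"
  then have w': "0 < w" "w < n" "pos (P w) < pos v" "pos v \<le> pos w" by (auto simp: crossing_def)
  have wch: "w \<in> ch (P w)" using w' ch_P by blast
  have Pw: "P w < n" using chD[OF wch] by simp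
  show "w \<in> {w\<in>ch u. pos v \<le> pos w} \<union> (crossing (pos u) - {u})"
  proof (cases "P w = u")
    case True then show ?thesis using wch w' by auto
  next
    case False
    have u: "u < n" "v < n" using chD[OF v] by auto
    have "pos (P w) < pos u"
    proof (rule ccontr)
      assume "\<not> ?thesis"
      then have "pos (P w) \<in> J u" using w' child_interval[OF v] by (auto simp: J_def)
      then obtain c where c: "c \<in> ch u" "pos (P w) \<in> J c"
        using J_tile[OF u(1)] False pos_inj[OF Pw u(1)] by blast
      then have "J (P w) \<subseteq> J c" using J_laminar chD[OF c(1)] Pw by blast
      moreover have "pos v \<in> J (P w)" using w' child_interval[OF wch] by (auto simp: J_def)
      moreover have "pos v \<in> J v" by (simp add: J_def)
      ultimately have "c = v" using J_disjoint[OF c(1) v] by blast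
      then show False using c(2) w' by (simp add: J_def)
    qed
    then show ?thesis using w' child_interval[OF v] by (auto simp: crossing_def)
  qed
qed

text \<open>A vertex with \<open>lam\<close> 0 is reached through last children only, so its subtree
  takes the final positions of every interval around it.\<close>

lemma lam_zero_end: "v < n \<Longrightarrow> lam v = 0 \<Longrightarrow> pos v + sz v = n - 1"
proof (induction v rule: less_induct)
  case (less v)
  show ?case
  proof (cases "v = 0")
    case True
    then show ?thesis using pos_root sz_root by simp
  next
    case False
    then have v: "v \<in> ch (P v)" using less ch_P by simp
    then have sp: "sp (P v) = v" using less.prems lam_other[OF v] by fastforce
    then have "pos (P v) + sz (P v) = n - 1" using less.IH lam_special[OF v sp] chD[OF v] less.prems by auto
    then show ?thesis using pos_special[OF v sp] sz_child[OF v] by simp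
  qed
qed

text \<open>Follow the child whose interval contains \<open>i\<close>. If it starts at
  \<open>i\<close>, or if its interval ends within the range so that a sibling starts there, a
  suitable child has been found. Otherwise the range lies inside the child, and the potential
  \<open>2 ^ lam a * (sz a + 1)\<close> has not grown: a last child keeps \<open>lam\<close>, and
  any other child increases \<open>lam\<close> by one while the subtree at least halves.\<close>

lemma exists_small_lam_below:
  assumes "a < n" "lam a \<noteq> 0" "i \<le> i'" "{i..i'} \<subseteq> J a"
  shows "\<exists>v<n. pos v \<in> {i..i'} \<and> 2 ^ lam v * (i' - i + 1) \<le> 2 ^ lam a * (2 * (sz a + 1))"
  using assms
proof (induction "sz a" arbitrary: a rule: less_induct)
  case less
  have iJ: "i \<in> J a" "i' \<in> J a" using less.prems by auto
  then have len: "i' - i + 1 \<le> sz a + 1" by (auto simp: J_def)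
  have child: ?case if d: "d \<in> ch a" "pos d \<in> {i..i'}" for d
  proof -
    have "lam d \<le> lam a + 1" using lam_special[OF d(1)] lam_other[OF d(1)] by (cases "sp a = d") auto
    then have "2 ^ lam d * (i' - i + 1) \<le> 2 ^ (lam a + 1) * (sz a + 1)"
      using len by (intro mult_le_mono power_increasing) auto
    then show ?thesis using d chD[OF d(1)] by (intro exI[of _ d]) simp
  qed
  show ?case
  proof (cases "i = pos a")
    case True
    have "2 ^ lam a * (i' - i + 1) \<le> 2 ^ lam a * (2 * (sz a + 1))" using len by (intro mult_le_mono) auto
    then show ?thesis using True less.prems by (intro exI[of _ a]) auto
  next
    case False
    then obtain c where c: "c \<in> ch a" "i \<in> J c" using J_tile less.prems iJ by blast
    have cn: "c < n" using chD[OF c(1)] by simp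
    consider "i = pos c" | "pos c < i" "pos c + sz c < i'" | "pos c < i" "i' \<le> pos c + sz c"
      using c(2) unfolding J_def by fastforce
    then show ?thesis
    proof cases
      case 1 then show ?thesis using child[OF c(1)] less.prems by auto
    next
      case 2
      \<comment> \<open>The first position after the subtree of \<open>c\<close>. It belongs to a
        sibling, whose interval is disjoint from that of \<open>c\<close> and hence begins exactly
        there.\<close>
      define p where "p = pos c + sz c + 1"
      have p: "p \<in> {i..i'}" using 2 c(2) by (auto simp: p_def J_def)
      then have "p \<in> J a" "p \<noteq> pos a" using less.prems(4) child_interval[OF c(1)] by (auto simp: p_def)
      then obtain d where d: "d \<in> ch a" "p \<in> J d" using J_tile less.prems by blast
      have "d \<noteq> c" using d(2) by (auto simp: p_def J_def)
      then have "J c \<inter> J d = {}" using J_disjoint c d by blast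
      moreover have "pos c + sz c \<in> J c" by (simp add: J_def)
      ultimately have "pos c + sz c \<notin> J d" by blast
      then have "pos d = p" using d(2) by (auto simp: p_def J_def)
      then show ?thesis using child[OF d(1)] p by simp
    next
      case 3
      have sub: "{i..i'} \<subseteq> J c" using 3 by (auto simp: J_def)
      have lam: "lam c \<noteq> 0" using lam_special[OF c(1)] lam_other[OF c(1)] less.prems by (cases "sp a = c") auto
      obtain v where v: "v < n" "pos v \<in> {i..i'}" "2 ^ lam v * (i' - i + 1) \<le> 2 ^ lam c * (2 * (sz c + 1))"
        using less.hyps[of c] sz_child[OF c(1)] cn lam less.prems sub by auto
      have "2 ^ lam c * (2 * (sz c + 1)) \<le> 2 ^ lam a * (2 * (sz a + 1))"
      proof (cases "sp a = c")
        case True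
        then show ?thesis using lam_special[OF c(1)] sz_child[OF c(1)] by simp
      next
        case False
        have s: "sp a \<in> ch a" using sp_ch c less.prems by blast
        \<comment> \<open>Two disjoint subtrees below \<open>a\<close>, of which the one at
          \<open>c\<close> is not the larger: this is the halving.\<close>
        have "(\<Sum>l\<in>{c, sp a}. sz l + 1) \<le> sz a" using c s less.prems by (intro sz_subset) auto
        then have "2 * (sz c + 1) \<le> sz a + 1" using heavy[OF less.prems(1,2) c(1)] False by simp
        then have "2 ^ lam a * (2 * (2 * (sz c + 1))) \<le> 2 ^ lam a * (2 * (sz a + 1))"
          by (intro mult_le_mono) auto
        then show ?thesis using lam_other[OF c(1) False] by simp
      qed
      then show ?thesis using v by (intro exI[of _ v]) linarith
    qed
  qed
qed

text \<open>At a path vertex sizes need not halve, because its last child is chosen for the path and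
  not by size. The range is therefore moved to a child \<open>c\<close> with
  \<open>lam c = 1\<close> whose interval stays inside the arc; the factor 4 is \<open>2 ^ 1\<close>
  times the 2 of the estimate below \<open>c\<close>.\<close>

lemma exists_small_lam_arc:
  assumes x: "x < n" "lam x = 0" and ii: "pos x < i" "i \<le> i'" "i' < e" and e: "e \<le> n"
    and noX: "\<And>v. v < n \<Longrightarrow> pos x < pos v \<Longrightarrow> pos v < e \<Longrightarrow> lam v \<noteq> 0"
    and eX: "\<And>v. v < n \<Longrightarrow> pos v = e \<Longrightarrow> lam v = 0"
  shows "\<exists>v<n. pos v \<in> {i..i'} \<and> 2 ^ lam v * (i' - i + 1) \<le> 4 * (e - pos x)"
proof -
  have Jx: "J x = {pos x..n - 1}" using lam_zero_end[OF x] by (simp add: J_def)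
  have len: "i' - i + 1 \<le> e - pos x" using ii by auto
  have child: ?thesis if d: "d \<in> ch x" "pos d \<in> {i..i'}" for d
  proof -
    have "lam d \<le> 1" using lam_special[OF d(1)] lam_other[OF d(1)] x by (cases "sp x = d") auto
    then have "2 ^ lam d * (i' - i + 1) \<le> 2 ^ 1 * (e - pos x)"
      using len by (intro mult_le_mono power_increasing) auto
    then show ?thesis using d chD[OF d(1)] by (intro exI[of _ d]) simp
  qed
  have "i \<in> J x" "i \<noteq> pos x" using ii e Jx by auto
  then obtain c where c: "c \<in> ch x" "i \<in> J c" using J_tile[OF x(1)] by blast
  have cn: "c < n" using chD[OF c(1)] by simp
  consider "i = pos c" | "pos c < i" "pos c + sz c < i'" | "pos c < i" "i' \<le> pos c + sz c"
    using c(2) unfolding J_def by fastforce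
  then show ?thesis
  proof cases
    case 1 then show ?thesis using child[OF c(1)] ii by auto
  next
    case 2
    define p where "p = pos c + sz c + 1"
    have p: "p \<in> {i..i'}" using 2 c(2) by (auto simp: p_def J_def)
    then have "p \<in> J x" "p \<noteq> pos x" using child_interval[OF c(1)] ii e Jx by (auto simp: p_def)
    then obtain d where d: "d \<in> ch x" "p \<in> J d" using J_tile x by blast
    have "d \<noteq> c" using d(2) by (auto simp: p_def J_def)
    then have "J c \<inter> J d = {}" using J_disjoint c d by blast
    moreover have "pos c + sz c \<in> J c" by (simp add: J_def)
    ultimately have "pos c + sz c \<notin> J d" by blast
    then have "pos d = p" using d(2) by (auto simp: p_def J_def)
    then show ?thesis using child[OF d(1)] p by simp
  next
    case 3
    have sub: "{i..i'} \<subseteq> J c" using 3 by (auto simp: J_def)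
    have lam: "lam c \<noteq> 0" using noX[of c] cn 3 ii child_interval[OF c(1)] by auto
    have lam1: "lam c = 1" using lam lam_special[OF c(1)] lam_other[OF c(1)] x by (cases "sp x = c") auto
    \<comment> \<open>If the interval of \<open>c\<close> reached \<open>e\<close>, then
      \<open>e < n\<close>, and the vertex at \<open>e\<close> would inherit a positive
      \<open>lam\<close> from \<open>c\<close>.\<close>
    have "pos c + sz c < e"
    proof (rule ccontr)
      assume "\<not> ?thesis"
      then have eJ: "e \<in> J c" using 3 ii by (auto simp: J_def)
      then have "e \<le> n - 1" using J_child[OF c(1)] Jx by auto
      then have "e < n" using n_pos by simp
      then obtain v where v: "v < n" "pos v = e" using vertex_at by blast
      then have "lam c \<le> lam v" using J_laminar[OF cn v(1)] eJ by auto
      then show False using eX[OF v] lam by simp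
    qed
    then have "sz c + 1 \<le> e - pos x" using child_interval[OF c(1)] by simp
    moreover obtain v where "v < n" "pos v \<in> {i..i'}" and "2 ^ lam v * (i' - i + 1) \<le> 2 ^ lam c * (2 * (sz c + 1))"
      using exists_small_lam_below[OF cn lam ii(2) sub] by blast
    ultimately show ?thesis using lam1 by (intro exI[of _ v]) simp
  qed
qed

lemma crossing_root [simp]: "crossing 0 = {}"
  by (auto simp: crossing_def)

text \<open>Between the positions of two ends of different colour there is a place where the colour
  changes, and the edge crosses there.\<close>

lemma crossing_step_le:
  assumes bd: "\<And>i. col i \<noteq> col (i - 1) \<Longrightarrow> 0 < i \<Longrightarrow> i < n \<Longrightarrow> i \<in> Q" and "finite Q"
  shows "card {w. 0 < w \<and> w < n \<and> col (pos w) \<noteq> col (pos (P w))} \<le> (\<Sum>p\<in>Q. card (crossing p))"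
proof -
  have step: "\<exists>p. a < p \<and> p \<le> b \<and> col p \<noteq> col (p - 1)" if "a < b" "col a \<noteq> col b" for a b :: nat
    using that
  proof (induction b)
    case (Suc b)
    show ?case
    proof (cases "col b = col (Suc b)")
      case True
      then have "a < b" using Suc.prems by (metis less_SucE)
      then show ?thesis using Suc True by (metis le_SucI)
    next
      case False then show ?thesis using Suc.prems by (intro exI[of _ "Suc b"]) auto
    qed
  qed simp
  have "{w. 0 < w \<and> w < n \<and> col (pos w) \<noteq> col (pos (P w))} \<subseteq> (\<Union>p\<in>Q. crossing p)"
  proof
    fix w assume "w \<in> {w. 0 < w \<and> w < n \<and> col (pos w) \<noteq> col (pos (P w))}"
    then have w: "0 < w" "w < n" "col (pos w) \<noteq> col (pos (P w))" by auto
    have "pos (P w) < pos w" using child_interval[OF ch_P[OF w(1,2)]] by simp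
    then obtain p where p: "pos (P w) < p" "p \<le> pos w" "col p \<noteq> col (p - 1)" using step w by metis
    then have "p \<in> Q" using bd[of p] pos_less[OF w(2)] by auto
    then show "w \<in> (\<Union>p\<in>Q. crossing p)" using w p by (auto simp: crossing_def)
  qed
  then have "card {w. 0 < w \<and> w < n \<and> col (pos w) \<noteq> col (pos (P w))} \<le> card (\<Union>p\<in>Q. crossing p)"
    using assms(2) by (intro card_mono) auto
  also have "\<dots> \<le> (\<Sum>p\<in>Q. card (crossing p))" by (rule card_UN_le[OF assms(2)])
  finally show ?thesis .
qed

section \<open>Cut sizes in terms of the degree\<close>

context
  fixes D :: nat
  assumes D: "\<And>u. u < n \<Longrightarrow> card (ch u) + (if u = 0 then 0 else 1) \<le> D"
begin

text \<open>Going down to the last child trades the edge above the parent for a single edge. Any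
  other child raises the bound by \<open>D - 1\<close>, which is enough for all edges from the
  parent to its children: one of its at most \<open>D\<close> edges leads upwards, and at the root
  the summand 1 makes up for it.\<close>

lemma crossing_pos_le:
  "v < n \<Longrightarrow> card (crossing (pos v)) \<le> (if v = 0 then 0 else 1 + lam v * (D - 1))"
proof (induction v rule: less_induct)
  case (less v)
  show ?case
  proof (cases "v = 0")
    case False
    define u where "u = P v"
    have v: "v \<in> ch u" using False less.prems ch_P by (simp add: u_def)
    have u: "u < v" "u < n" using chD[OF v] by auto
    have "card (crossing (pos v)) \<le> card {w\<in>ch u. pos v \<le> pos w} + card (crossing (pos u) - {u})"
      by (rule order_trans[OF card_mono[OF _ crossing_child[OF v]] card_Un_le]) simp
    moreover have "card (crossing (pos u) - {u}) \<le> (if u = 0 then 0 else lam u * (D - 1))"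
    proof (cases "u = 0")
      case False
      then have "u \<in> crossing (pos u)"
        using u child_interval[OF ch_P[of u]] by (auto simp: crossing_def)
      then show ?thesis using less.IH[OF u] False by simp
    qed (use pos_root in simp)
    moreover have "card {w\<in>ch u. pos v \<le> pos w} + (if u = 0 then 0 else lam u * (D - 1)) \<le> 1 + lam v * (D - 1)"
    proof (cases "sp u = v")
      case True
      have "{w\<in>ch u. pos v \<le> pos w} \<subseteq> {v}"
      proof
        fix w assume "w \<in> {w\<in>ch u. pos v \<le> pos w}"
        then have "w \<in> ch u" "pos v \<le> pos w" by simp_all
        then show "w \<in> {v}" using other_before_special[of w u] True by (cases "w = v") simp_all
      qed
      then have "card {w\<in>ch u. pos v \<le> pos w} \<le> 1"
        using card_mono[of "{v}" "{w\<in>ch u. pos v \<le> pos w}"] by simp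
      then show ?thesis using lam_special[OF v True] lam_root by (cases "u = 0") simp_all
    next
      case other: False
      have "card {w\<in>ch u. pos v \<le> pos w} \<le> card (ch u)" by (rule card_mono) auto
      then show ?thesis using D[OF u(2)] lam_other[OF v other] lam_root by (cases "u = 0") simp_all
    qed
    ultimately show ?thesis using False by simp
  qed (use pos_root in simp)
qed

lemma degree_bound_pos: "0 < v \<Longrightarrow> v < n \<Longrightarrow> 1 \<le> D"
  using D[of v] by simp

lemma crossing_pos_le_lam: "v < n \<Longrightarrow> card (crossing (pos v)) \<le> max 1 (lam v) * D"
proof -
  assume v: "v < n"
  show ?thesis
  proof (cases "v = 0")
    case False
    then obtain D' where D': "D = Suc D'" using degree_bound_pos[of v] v by (cases D) auto
    show ?thesis using crossing_pos_le[OF v] False D' by (cases "lam v") (auto split: if_splits)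
  qed (use pos_root in simp)
qed

text \<open>At most one edge crosses before a path vertex, and for \<open>x \<noteq> 0\<close> it is
  the edge that ends at \<open>x\<close>. So every edge that crosses right after \<open>x\<close>
  starts at \<open>x\<close>.\<close>

lemma crossing_after_path_le:
  assumes x: "x < n" "lam x = 0"
  shows "card (crossing (Suc (pos x))) \<le> D"
proof -
  have "crossing (Suc (pos x)) \<subseteq> ch x"
  proof
    fix w assume w: "w \<in> crossing (Suc (pos x))"
    then have w': "0 < w" "w < n" "pos (P w) \<le> pos x" "pos x < pos w" by (auto simp: crossing_def)
    have wch: "w \<in> ch (P w)" using w' ch_P by blast
    show "w \<in> ch x"
    proof (rule ccontr)
      assume "w \<notin> ch x"
      then have "P w \<noteq> x" using wch by auto
      then have "pos (P w) < pos x" using w' pos_inj[of "P w" x] x chD[OF wch] by fastforce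
      then have wc: "w \<in> crossing (pos x)" using w' by (auto simp: crossing_def)
      then have x0: "x \<noteq> 0" using pos_root by (metis crossing_root empty_iff)
      then have "x \<in> crossing (pos x)" using x child_interval[OF ch_P[of x]] by (auto simp: crossing_def)
      moreover have "w \<noteq> x" using w' by auto
      ultimately have "2 \<le> card (crossing (pos x))"
        using card_mono[of "crossing (pos x)" "{w, x}"] wc by simp
      then show False using crossing_pos_le[OF x(1)] x0 x by simp
    qed
  qed
  then show ?thesis using D[OF x(1)] card_mono[of "ch x"] by (meson add_leD1 finite_ch order_trans)
qed

end

end

section \<open>Refining a colouring\<close>

definition recolored :: "(nat \<Rightarrow> nat) \<Rightarrow> nat \<Rightarrow> nat \<Rightarrow> nat \<Rightarrow> nat \<Rightarrow> (nat \<Rightarrow> nat) \<Rightarrow> (nat \<Rightarrow> nat) \<Rightarrow> bool" where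
  "recolored w z r \<nu> c col col' \<longleftrightarrow>
     (\<forall>i<z. col' (w ((r + i) mod z)) = (if i < \<nu> then c else 1 - c)) \<and>
     (\<forall>p. p \<notin> w ` {..<z} \<longrightarrow> col' p = col p)"

text \<open>A black block of length \<open>m\<close> and a white block of length
  \<open>z - m\<close> leave the same number of black slots.\<close>

lemma sum_recolored:
  assumes rec: "recolored w z r \<nu> c col col'" and z: "0 < z" "z \<le> n"
    and w: "inj_on w {..<z}" "\<And>i. i < z \<Longrightarrow> w i < n"
    and m: "m = (\<Sum>i<z. col (w i))" "m \<le> z"
    and \<nu>c: "\<nu> = m \<and> c = 1 \<or> \<nu> = z - m \<and> c = 0"
  shows "(\<Sum>p<n. col' p) = (\<Sum>p<n. col p)"
proof -
  have "(\<Sum>i<z. col' (w i)) = (\<Sum>i<z. col' (w ((i + r) mod z)))"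
    by (rule sum.reindex_bij_betw[OF bij_betw_add_mod[OF z(1)], symmetric])
  also have "\<dots> = (\<Sum>i<z. if i < \<nu> then c else 1 - c)"
    by (rule sum.cong) (use rec in \<open>auto simp: recolored_def add.commute\<close>)
  also have "\<dots> = card ({..<z} \<inter> {i. i < \<nu>}) * c + card ({..<z} \<inter> - {i. i < \<nu>}) * (1 - c)"
    by (simp add: sum.If_cases)
  also have "{..<z} \<inter> {i. i < \<nu>} = {..<\<nu>}" using \<nu>c m by auto
  also have "{..<z} \<inter> - {i. i < \<nu>} = {\<nu>..<z}" by auto
  finally have "(\<Sum>i<z. col' (w i)) = m" using \<nu>c m(2) by auto
  then have "(\<Sum>p\<in>w ` {..<z}. col' p) = (\<Sum>p\<in>w ` {..<z}. col p)"
    using m(1) w(1) by (simp add: sum.reindex)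
  moreover have "(\<Sum>p\<in>{..<n} - w ` {..<z}. col' p) = (\<Sum>p\<in>{..<n} - w ` {..<z}. col p)"
    by (rule sum.cong) (use rec in \<open>auto simp: recolored_def\<close>)
  moreover have "w ` {..<z} \<subseteq> {..<n}" using w(2) by auto
  ultimately show ?thesis
    by (metis (no_types, lifting) finite_lessThan sum.subset_diff)
qed

text \<open>The cost of a segment, in units of \<open>D\<close>, as a function of the number of
  slots per path slot. Below 2 more than half of the slots are path slots, and two cuts at path
  slots suffice.\<close>

definition budget :: "real \<Rightarrow> real" where
  "budget y = (if y < 2 then 2 else 4 * y)"

text \<open>Halving \<open>y\<close> frees about \<open>2 * y\<close>, which has to pay for a cut at
  a position with \<open>lam = l\<close> and for the two ends of the hull. For
  \<open>l \<ge> 4\<close> this follows from \<open>2 * l + 4 \<le> 2 ^ l \<le> 4 * y\<close>;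
  smaller \<open>l\<close> are covered by \<open>y \<ge> 2\<close>, or by \<open>y \<ge> 4\<close>
  when \<open>y'\<close> is not yet below 2.\<close>

lemma budget_step:
  assumes y: "2 \<le> y" "y' \<le> y / 2" and l: "2 ^ l \<le> 4 * y"
  shows "real (max 1 l) + 2 + budget y' \<le> budget y"
proof -
  have pow: "2 * real l + 4 \<le> 2 ^ l" if "4 \<le> l"
  proof -
    have "2 * l + 4 \<le> 2 ^ l" using that by (induction l rule: dec_induct) auto
    then have "real (2 * l + 4) \<le> real (2 ^ l)" by (rule of_nat_mono)
    then show ?thesis by simp
  qed
  show ?thesis
  proof (cases "y' < 2")
    case True
    have "real (max 1 l) \<le> 4 * y - 4"
    proof (cases "4 \<le> l")
      case False then have "real (max 1 l) \<le> 3" by simp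
      then show ?thesis using y by simp
    qed (use pow l y in auto)
    then show ?thesis using True y by (simp add: budget_def)
  next
    case False
    have "real (max 1 l) + 2 \<le> 2 * y"
    proof (cases "4 \<le> l")
      case F: False then have "real (max 1 l) \<le> 3" by simp
      then show ?thesis using y False by simp
    qed (use pow l y False in auto)
    then show ?thesis using False y by (simp add: budget_def)
  qed
qed

text \<open>All that the refinement has to know about the tree: \<open>lm p\<close> is
  \<open>lam\<close> at position \<open>p\<close>, and \<open>c p\<close> is the price of a cut
  before \<open>p\<close>. By \<open>c_0\<close> the step from the last position back to 0 is free,
  so positions may be treated cyclically.\<close>

locale cut_profile =
  fixes n :: nat and lm c :: "nat \<Rightarrow> nat" and D :: nat
  assumes n_pos: "0 < n" and lm_0: "lm 0 = 0"
    and c_le: "\<And>p. p < n \<Longrightarrow> c p \<le> max 1 (lm p) * D"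
    and c_after: "\<And>p. p < n \<Longrightarrow> lm p = 0 \<Longrightarrow> c ((p + 1) mod n) \<le> D"
    and small_lm: "\<And>x i i' e. \<lbrakk>x < n; lm x = 0; x < i; i \<le> i'; i' < e; e \<le> n;
        \<And>p. x < p \<Longrightarrow> p < e \<Longrightarrow> lm p \<noteq> 0; e = n \<or> lm e = 0\<rbrakk>
      \<Longrightarrow> \<exists>p\<in>{i..i'}. 2 ^ lm p * (i' - i + 1) \<le> 4 * (e - x)"
    and c_0: "c 0 = 0"
begin

abbreviation prev :: "nat \<Rightarrow> nat" where "prev p \<equiv> (p + (n - 1)) mod n"

definition zeros :: "(nat \<Rightarrow> nat) \<Rightarrow> nat \<Rightarrow> nat set" where
  "zeros w z = {i. i < z \<and> lm (w i) = 0}"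

text \<open>\<open>w\<close> lists the positions of a segment. Consecutive entries are cyclic neighbours except at joins,
  which arise when the hull of a run wraps around the end of the previous segment. Both sides of
  a join are path positions where a cut has been paid for already, i.e. which belong to \<open>Q\<close>.\<close>

definition segment :: "(nat \<Rightarrow> nat) \<Rightarrow> nat \<Rightarrow> nat set \<Rightarrow> bool" where
  "segment w z Q \<longleftrightarrow> 0 < z \<and> z \<le> n \<and> inj_on w {..<z} \<and> (\<forall>i<z. w i < n) \<and> lm (w 0) = 0 \<and>
     finite Q \<and> w 0 \<in> Q \<and> (w (z - 1) + 1) mod n \<in> Q \<and>
     (\<forall>i. 0 < i \<and> i < z \<longrightarrow> w i = (w (i - 1) + 1) mod n \<or>
        lm (w i) = 0 \<and> lm (w (i - 1)) = 0 \<and> w i \<in> Q \<and> (w (i - 1) + 1) mod n \<in> Q) \<and>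
     (lm (w (z - 1)) = 0 \<or> z = n \<and> (\<forall>i<n. w i = i))"

text \<open>\<open>Q\<close> collects the cuts that are paid for. Other colour changes are tolerated
  only between consecutive entries of the segment that are cyclic neighbours, because the next
  recolouring overwrites them.\<close>

definition bounded_outside :: "(nat \<Rightarrow> nat) \<Rightarrow> nat \<Rightarrow> (nat \<Rightarrow> nat) \<Rightarrow> nat set \<Rightarrow> bool" where
  "bounded_outside w z col Q \<longleftrightarrow> (\<forall>p<n. col p \<noteq> col (prev p) \<longrightarrow>
     p \<in> Q \<or> (\<exists>i. 0 < i \<and> i < z \<and> p = w i \<and> prev p = w (i - 1)))"

lemma prev_Suc: "p < n \<Longrightarrow> prev ((p + 1) mod n) = p"
proof -
  assume p: "p < n"
  have "((p + 1) mod n + (n - 1)) mod n = (p + 1 + (n - 1)) mod n" by (rule mod_add_left_eq)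
  also have "p + 1 + (n - 1) = p + n" using n_pos by simp
  finally show ?thesis using p by simp
qed

lemma segment_link:
  "segment w z Q \<Longrightarrow> 0 < i \<Longrightarrow> i < z \<Longrightarrow> w i = (w (i - 1) + 1) mod n \<or>
     lm (w i) = 0 \<and> lm (w (i - 1)) = 0 \<and> w i \<in> Q \<and> (w (i - 1) + 1) mod n \<in> Q"
  unfolding segment_def by blast

lemma Suc_prev: "p < n \<Longrightarrow> (prev p + 1) mod n = p"
  using n_pos by (simp add: mod_Suc_eq)

text \<open>Within the segment the recolouring leaves two switches, at slot \<open>r\<close> and at
  slot \<open>i\<close>. A change across an end of the segment or at a join lies in \<open>Q\<close>
  by the definition of \<open>segment\<close>.\<close>

lemma boundary_recolored:
  assumes seg: "segment w z Q" and bd: "bounded_outside w z col Q"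
    and rec: "recolored w z r \<nu> cc col col'" and r: "r < z" "\<nu> \<le> z"
    and p: "p < n" "col' p \<noteq> col' (prev p)"
  defines "i \<equiv> (r + \<nu>) mod z"
  shows "p \<in> Q \<or> p = w r \<or> (p = w i \<and> 0 < i \<and> prev p = w (i - 1))"
proof (cases "p \<in> w ` {..<z}")
  case False
  show ?thesis
  proof (cases "prev p \<in> w ` {..<z}")
    case pr: False
    then have "col p \<noteq> col (prev p)" using p False rec by (simp add: recolored_def)
    then show ?thesis using bd p False unfolding bounded_outside_def by auto
  next
    case True
    then obtain j where j: "j < z" "prev p = w j" by auto
    have "p = (w j + 1) mod n" using Suc_prev[OF p(1)] j by simp
    moreover have "p \<noteq> w (Suc j)" if "Suc j < z" using False that by auto
    moreover have "j = z - 1" if "\<not> Suc j < z" using j that by simp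
    moreover have "(w (z - 1) + 1) mod n \<in> Q" using seg by (simp add: segment_def)
    ultimately have "p \<in> Q" using segment_link[OF seg, of "Suc j"] by (cases "Suc j < z") auto
    then show ?thesis by simp
  qed
next
  case True
  then obtain l where l: "l < z" "p = w l" by auto
  consider "l = 0" | "0 < l" "p \<in> Q" | "0 < l" "w l = (w (l - 1) + 1) mod n"
    using seg l unfolding segment_def by auto
  then show ?thesis
  proof cases
    case 1 then show ?thesis using seg l by (simp add: segment_def)
  next
    case 3
    have wl: "w (l - 1) < n" using seg l unfolding segment_def by auto
    have pr: "prev p = w (l - 1)" using prev_Suc[OF wl] 3 l by simp
    define j where "j = (l + (z - r)) mod z"
    have j: "j < z" using l by (simp add: j_def)
    have jl: "(r + j) mod z = l" using add_mod_shift_inverse[of l z "z - r"] l r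
      by (simp add: j_def add.commute)
    show ?thesis
    proof (cases "j = 0")
      case True then have "l = r" using jl r by simp
      then show ?thesis using l by simp
    next
      case j0: False
      have "(r + (j - 1)) mod z = l - 1"
      proof -
        have "(j - 1 + r) mod z = l - 1"
          using mod_shift_eq[of l j r z 1] jl j0 3 j by (simp add: add.commute)
        then show ?thesis by (simp add: add.commute)
      qed
      then have "col' (w (l - 1)) = (if j - 1 < \<nu> then cc else 1 - cc)"
        using rec j unfolding recolored_def by (metis less_imp_diff_less)
      moreover have "col' (w l) = (if j < \<nu> then cc else 1 - cc)"
        using rec j jl unfolding recolored_def by metis
      ultimately have "j = \<nu>" using p(2) pr l by (auto split: if_splits)
      then have "i = l" using jl by (simp add: i_def)
      then show ?thesis using l pr 3 by simp
    qed
  qed simp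
qed

text \<open>Both switches are at path slots and cost at most \<open>D\<close> each, so no further
  round is needed.\<close>

lemma recolor_hit:
  assumes seg: "segment w z Q" and bd: "bounded_outside w z col Q"
    and rec: "recolored w z r \<nu> cc col col'" and r: "r \<in> zeros w z" "(r + \<nu>) mod z \<in> zeros w z" "\<nu> \<le> z"
  shows "\<exists>Q'. finite Q' \<and> (\<forall>p<n. col' p \<noteq> col' (prev p) \<longrightarrow> p \<in> Q') \<and> sum c Q' \<le> sum c Q + 2 * D"
proof -
  let ?i = "(r + \<nu>) mod z"
  define Q' where "Q' = insert (w r) (insert (w ?i) Q)"
  have fin: "finite Q" and wn: "\<And>i. i < z \<Longrightarrow> w i < n" using seg by (auto simp: segment_def)
  have one: "c (w i) \<le> D" if "i \<in> zeros w z" for i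
    using c_le[of "w i"] wn that by (simp add: zeros_def)
  have ins: "sum c (insert a A) \<le> c a + sum c A" if "finite A" for a A
    using that by (cases "a \<in> A") (auto simp: insert_absorb)
  have "sum c Q' \<le> c (w r) + (c (w ?i) + sum c Q)"
    unfolding Q'_def using ins[of "insert (w ?i) Q" "w r"] ins[of Q "w ?i"] fin by simp
  then have "sum c Q' \<le> sum c Q + 2 * D" using one[OF r(1)] one[OF r(2)] by simp
  moreover have "\<forall>p<n. col' p \<noteq> col' (prev p) \<longrightarrow> p \<in> Q'"
    using boundary_recolored[OF seg bd rec _ r(3)] r(1) unfolding Q'_def zeros_def by blast
  ultimately show ?thesis using fin by (intro exI[of _ Q']) (simp add: Q'_def)
qed

text \<open>A join has path slots on both sides, so none occurs within an arc that has inner slots.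
  Such an arc does not wrap around either, as position 0 is a path position. This makes
  \<open>small_lm\<close>, a statement about positions, applicable to slots.\<close>

lemma arc_contiguous:
  assumes seg: "segment w z Q" and a: "arc z (zeros w z) s e" and e2: "s + 1 < e"
  shows "\<And>j. j < e - s \<Longrightarrow> w (s + j) = w s + j" and "w s + (e - s) \<le> n"
    "w s + (e - s) = n \<or> lm (w s + (e - s)) = 0"
proof -
  have wn: "\<And>i. i < z \<Longrightarrow> w i < n" using seg by (auto simp: segment_def)
  have ez: "e \<le> z" "s < e" using a by (auto simp: arc_def)
  have nz: "lm (w i) \<noteq> 0" if "s < i" "i < e" for i
  proof -
    have "i \<notin> zeros w z" using a that unfolding arc_def by blast
    then show ?thesis using that ez by (simp add: zeros_def)
  qed
  show con: "w (s + j) = w s + j" if "j < e - s" for j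
    using that
  proof (induction j)
    case (Suc j)
    have *: "lm (w (s + Suc j)) \<noteq> 0" using nz Suc.prems by simp
    then have "w (s + Suc j) = (w (s + j) + 1) mod n"
      using segment_link[OF seg, of "s + Suc j"] Suc.prems ez by simp
    moreover have "w (s + Suc j) \<noteq> 0" using * lm_0 by metis
    moreover have "w (s + j) < n" using wn Suc.prems ez by simp
    ultimately show ?case using Suc by (auto simp: mod_if split: if_splits)
  qed simp
  have last: "w (e - 1) = w s + (e - s - 1)" using con[of "e - s - 1"] e2 by simp
  have "w (e - 1) < n" using wn ez by simp
  then show le: "w s + (e - s) \<le> n" using last e2 by simp
  have nl: "lm (w (e - 1)) \<noteq> 0" using nz[of "e - 1"] e2 by simp
  show "w s + (e - s) = n \<or> lm (w s + (e - s)) = 0"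
  \<comment> \<open>Only the initial segment may end with a slot off the path.\<close>
  proof (cases "e = z")
    case True
    then have "z = n" "\<forall>i<n. w i = i" using seg nl unfolding segment_def by auto
    then show ?thesis using True ez e2 by simp
  next
    case False
    then have ee: "e < z" "e \<in> zeros w z" using a ez by (auto simp: arc_def)
    then have "w e = (w (e - 1) + 1) mod n" using segment_link[OF seg, of e] nl e2 by simp
    moreover have "lm (w e) = 0" using ee by (simp add: zeros_def)
    moreover have "w (e - 1) + 1 = w s + (e - s)" using last e2 by simp
    ultimately show ?thesis using le by (cases "w s + (e - s) = n") auto
  qed
qed

text \<open>The block starts at slot \<open>r\<close> in the hull of the run, and its other switch
  \<open>r + \<nu>\<close> lies in the translated hull \<open>w'\<close>, whose ends are path slots.
  Once the start of the block and the two ends of \<open>w'\<close> are paid for, all unpaid changes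
  are inside \<open>w'\<close>.\<close>

lemma recolor_run:
  assumes seg: "segment w z Q" and bd: "bounded_outside w z col Q"
    and rec: "recolored w z r \<nu> cc col col'" and nu: "\<nu> \<le> z"
    and good: "heavy_arc z (zeros w z) \<nu> s e"
    and H: "H = shifted z (zeros w z) \<nu> \<inter> {s<..<e}" "f = Min H" "l = Max H"
    and r: "r \<in> {f..l}" "\<And>i. i \<in> {f..l} \<Longrightarrow> lm (w r) \<le> lm (w i)"
    and w': "\<And>j. j < l - f + 1 \<Longrightarrow> w' j = w ((f + \<nu> + j) mod z)"
    and G: "real (sum c Q) \<le> D * (Y - budget (real z / card (zeros w z)))"
  defines "z' \<equiv> l - f + 1"
  shows "2 * z' \<le> z" and "\<exists>Q'. segment w' z' Q' \<and> bounded_outside w' z' col' Q' \<and>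
     real (sum c Q') \<le> D * (Y - budget (real z' / card (zeros w' z')))"
proof -
  let ?X = "zeros w z" and ?t = "\<lambda>j. (f + \<nu> + j) mod z"
  have z: "0 < z" "z \<le> n" and fin: "finite Q" and wn: "\<And>i. i < z \<Longrightarrow> w i < n" and inj: "inj_on w {..<z}"
    using seg by (auto simp: segment_def)
  have X: "?X \<subseteq> {..<z}" by (auto simp: zeros_def)
  have a: "arc z ?X s e" and H0: "H \<noteq> {}" and dens: "card ?X * ((e - s) + (l - f)) \<le> z * card H"
    using good unfolding heavy_arc_def Let_def H(1)[symmetric] H(2,3) by simp_all
  have fH: "finite H" using H by simp
  have fl: "f \<in> H" "l \<in> H" using Min_in[OF fH H0] Max_in[OF fH H0] H(2,3) by simp_all
  have sf: "s < f" "f \<le> l" "l < e" using fl Min_le[OF fH fl(2)] H(2) unfolding H(1) by simp_all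
  have ez: "e \<le> z" using a by (simp add: arc_def)
  have Hsub: "H \<subseteq> {f..l}" using Min_le[OF fH] Max_ge[OF fH] unfolding H(2,3) by auto
  then have qz: "card H \<le> z'" using card_mono[OF _ Hsub] sf by (simp add: z'_def)
  have q0: "0 < card H" using fH H0 by (simp add: card_gt_0_iff)
  \<comment> \<open>From \<open>s < f\<close> and \<open>l < e\<close> one gets
    \<open>e - s \<ge> l - f + 2\<close>. The resulting factor 2 halves both the length and the
    number of slots per path slot.\<close>
  have kz: "2 * (card ?X * z') \<le> z * card H"
  proof -
    have "2 * z' \<le> (e - s) + (l - f)" using sf by (auto simp: z'_def)
    then have "card ?X * (2 * z') \<le> card ?X * ((e - s) + (l - f))" by (rule mult_le_mono2)
    also have "card ?X * (2 * z') = 2 * (card ?X * z')" by simp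
    finally show ?thesis using dens by linarith
  qed
  have k0: "0 < card ?X" using a X finite_subset[OF X] by (auto simp: arc_def card_gt_0_iff)
  have "card H \<le> card (shifted z ?X \<nu>)" unfolding H(1) by (intro card_mono) (auto simp: shifted_def)
  then have qk: "card H \<le> card ?X" using card_shifted[OF z(1) X] by simp
  have "card ?X * (2 * z') = 2 * (card ?X * z')" by simp
  also note kz
  also have "z * card H \<le> card ?X * z" using mult_le_mono2[OF qk, of z] by (simp only: mult.commute)
  finally have "card ?X * (2 * z') \<le> card ?X * z" .
  then show half: "2 * z' \<le> z" using k0 by simp
  have z'0: "0 < z'" by (simp add: z'_def)
  have w'': "w' j = w (?t j)" if "j < z'" for j using w' that by (simp add: z'_def)
  have tinj: "inj_on ?t {..<z'}"
  proof (rule inj_onI)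
    fix i j assume ij: "i \<in> {..<z'}" "j \<in> {..<z'}" "?t i = ?t j"
    then have "(i + (f + \<nu>)) mod z = (j + (f + \<nu>)) mod z" by (simp add: add.commute)
    then show "i = j" using inj_onD[OF bij_betw_imp_inj_on[OF bij_betw_add_mod[OF z(1), of "f + \<nu>"]], of i j]
      ij half by simp
  qed
  have tz: "?t j < z" for j using z by simp
  have inH: "lm (w' j) = 0 \<longleftrightarrow> f + j \<in> H" if j: "j < z'" for j
  proof -
    have "s < f + j" "f + j < e" "f + j < z" using sf ez j by (auto simp: z'_def)
    then have "f + j \<in> H \<longleftrightarrow> (f + j + \<nu>) mod z \<in> ?X" unfolding H(1) shifted_def by simp
    also have "f + j + \<nu> = f + \<nu> + j" by simp
    finally show ?thesis using w''[OF j] tz[of j] by (simp add: zeros_def)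
  qed
  have k': "card (zeros w' z') = card H"
  proof -
    have "H = (\<lambda>j. f + j) ` zeros w' z'"
    proof
      show "(\<lambda>j. f + j) ` zeros w' z' \<subseteq> H" using inH by (auto simp: zeros_def)
      show "H \<subseteq> (\<lambda>j. f + j) ` zeros w' z'"
      proof
        fix i assume i: "i \<in> H"
        then have "f \<le> i" "i \<le> l" using Hsub by auto
        then have "i - f \<in> zeros w' z'" "i = f + (i - f)"
          using i inH[of "i - f"] by (simp_all add: zeros_def z'_def)
        then show "i \<in> (\<lambda>j. f + j) ` zeros w' z'" by blast
      qed
    qed
    then show ?thesis by (simp add: card_image)
  qed
  have lm0: "lm (w' 0) = 0" using inH[of 0] fl z'0 by simp
  have lml: "lm (w' (z' - 1)) = 0" using inH[of "z' - 1"] fl sf by (simp add: z'_def)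
  define Q' where "Q' = insert (w r) (insert (w' 0) (insert ((w' (z' - 1) + 1) mod n) Q))"
  have QQ: "Q \<subseteq> Q'" by (auto simp: Q'_def)
  have tS: "?t (Suc j) = (if ?t j = z - 1 then 0 else Suc (?t j))" for j
    using z by (auto simp: mod_Suc)
  \<comment> \<open>A new join can only arise where the hull passes from slot \<open>z - 1\<close>
    to slot 0. There both sides are path slots and the two cuts are in \<open>Q\<close>, unless the
    segment is the whole cycle and its ends are neighbours.\<close>
  have link: "w' j = (w' (j - 1) + 1) mod n \<or>
        lm (w' j) = 0 \<and> lm (w' (j - 1)) = 0 \<and> w' j \<in> Q' \<and> (w' (j - 1) + 1) mod n \<in> Q'"
    if j: "0 < j" "j < z'" for j
  proof -
    obtain j' where j': "j = Suc j'" using j by (cases j) auto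
    have eqs: "w' j = w (?t (Suc j'))" "w' (j - 1) = w (?t j')" using w''[of j] w''[of j'] j j' by simp_all
    show ?thesis
    proof (cases "?t j' = z - 1")
      case True
      then have eqs': "w' j = w 0" "w' (j - 1) = w (z - 1)" using eqs tS[of j'] by simp_all
      show ?thesis
      proof (cases "lm (w (z - 1)) = 0")
        case True
        then show ?thesis using seg QQ eqs' unfolding segment_def by auto
      next
        case False
        then have "z = n" "\<forall>i<n. w i = i" using seg unfolding segment_def by auto
        then show ?thesis using eqs' z by simp
      qed
    next
      case False
      then have i: "0 < ?t (Suc j')" "?t (Suc j') - 1 = ?t j'" using tS[of j'] by simp_all
      show ?thesis using segment_link[OF seg i(1) tz] QQ unfolding eqs i(2) by blast
    qed
  qed
  have "segment w' z' Q'"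
    unfolding segment_def
  proof (intro conjI allI impI)
    show "inj_on w' {..<z'}"
    proof (rule inj_onI)
      fix i j assume ij: "i \<in> {..<z'}" "j \<in> {..<z'}" "w' i = w' j"
      then have "?t i = ?t j" using w'' inj_onD[OF inj, of "?t i" "?t j"] tz by simp
      then show "i = j" using inj_onD[OF tinj] ij by blast
    qed
    show "z' \<le> n" using half z by simp
    show "w' i < n" if "i < z'" for i using w''[OF that] wn[OF tz] by simp
    show "finite Q'" "w' 0 \<in> Q'" "(w' (z' - 1) + 1) mod n \<in> Q'" using fin by (simp_all add: Q'_def)
    show "lm (w' (z' - 1)) = 0 \<or> z' = n \<and> (\<forall>i<n. w' i = i)" using lml by simp
    fix j assume "0 < j \<and> j < z'"
    then show "w' j = (w' (j - 1) + 1) mod n \<or>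
        lm (w' j) = 0 \<and> lm (w' (j - 1)) = 0 \<and> w' j \<in> Q' \<and> (w' (j - 1) + 1) mod n \<in> Q'"
      using link by blast
  qed (use z'0 lm0 in simp_all)
  moreover have rz: "r < z" using r sf ez by auto
  have "bounded_outside w' z' col' Q'"
    unfolding bounded_outside_def
  proof (intro allI impI)
    fix p assume p: "p < n" "col' p \<noteq> col' (prev p)"
    let ?i = "(r + \<nu>) mod z"
    consider "p \<in> Q \<or> p = w r" | "p = w ?i" "0 < ?i" "prev p = w (?i - 1)"
      using boundary_recolored[OF seg bd rec rz nu p] by metis
    then show "p \<in> Q' \<or> (\<exists>i>0. i < z' \<and> p = w' i \<and> prev p = w' (i - 1))"
    proof cases
      case 1 then show ?thesis by (auto simp: Q'_def)
    next
      case 2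
      \<comment> \<open>The second switch is slot \<open>r - f\<close> of \<open>w'\<close>; if that
        is slot 0, it is an end of the hull and belongs to \<open>Q'\<close>.\<close>
      have "r + \<nu> = f + \<nu> + (r - f)" using r(1) by simp
      then have ri: "?i = ?t (r - f)" "r - f < z'" using r(1) by (metis, simp add: z'_def)
      show ?thesis
      proof (cases "r = f")
        case True
        then have "p = w' 0" using 2 ri w''[of 0] z'0 by simp
        then show ?thesis by (simp add: Q'_def)
      next
        case False
        then obtain j where j: "r - f = Suc j" using r by (cases "r - f") auto
        then have "?i - 1 = ?t j" using tS[of j] ri(1) 2(2) by (auto split: if_splits)
        then have "prev p = w' (r - f - 1)" using 2 w''[of j] j ri(2) by simp
        moreover have "p = w' (r - f)" using 2 ri w''[of "r - f"] by simp
        ultimately show ?thesis using ri(2) j by (intro disjI2 exI[of _ "r - f"]) simp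
      qed
    qed
  qed
  moreover have "real (sum c Q') \<le> D * (Y - budget (real z' / card (zeros w' z')))"
  proof -
    have ins: "sum c (insert a A) \<le> c a + sum c A" if "finite A" for a A
      using that by (cases "a \<in> A") (auto simp: insert_absorb)
    have "sum c Q' \<le> c (w r) + (c (w' 0) + (c ((w' (z' - 1) + 1) mod n) + sum c Q))"
      unfolding Q'_def using fin ins[of Q "(w' (z' - 1) + 1) mod n"] ins[of "insert ((w' (z' - 1) + 1) mod n) Q" "w' 0"]
        ins[of "insert (w' 0) (insert ((w' (z' - 1) + 1) mod n) Q)" "w r"] by simp
    moreover have w'n: "w' j < n" if "j < z'" for j using w'' wn tz that by simp
    have "c (w' 0) \<le> D" using c_le[OF w'n[OF z'0]] lm0 by simp
    moreover have "c ((w' (z' - 1) + 1) mod n) \<le> D" using c_after[OF w'n lml] z'0 by simp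
    moreover have "c (w r) \<le> max 1 (lm (w r)) * D" using c_le[OF wn[OF rz]] .
    ultimately have "sum c Q' \<le> D * (max 1 (lm (w r)) + 2) + sum c Q" by (simp add: algebra_simps)
    then have s1: "real (sum c Q') \<le> D * (real (max 1 (lm (w r))) + 2) + real (sum c Q)"
      by (metis of_nat_add of_nat_le_iff of_nat_mult of_nat_numeral)
    have se: "s + 1 < e" using sf by simp
    note con = arc_contiguous[OF seg a se]
    have sX: "lm (w s) = 0" "s < z" using a ez by (auto simp: arc_def zeros_def)
    have nz: "lm p \<noteq> 0" if "w s < p" "p < w s + (e - s)" for p
    proof -
      have "w (s + (p - w s)) = p" using con(1)[of "p - w s"] that by simp
      moreover have "s < s + (p - w s)" "s + (p - w s) < e" using that by arith+
      then have "s + (p - w s) \<notin> ?X" using a unfolding arc_def by blast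
      ultimately show ?thesis using that ez unfolding zeros_def by auto
    qed
    \<comment> \<open>The hull read as an interval of positions; the minimality of
      \<open>lm (w r)\<close> then transfers the bound from \<open>p\<close> to
      \<open>w r\<close>.\<close>
    have "\<exists>p\<in>{w s + (f - s)..w s + (l - s)}.
      2 ^ lm p * (w s + (l - s) - (w s + (f - s)) + 1) \<le> 4 * (w s + (e - s) - w s)"
      by (rule small_lm[OF wn[OF sX(2)] sX(1) _ _ _ con(2) nz con(3)]) (use sf in simp_all)
    then obtain p where p: "p \<in> {w s + (f - s)..w s + (l - s)}"
      "2 ^ lm p * (w s + (l - s) - (w s + (f - s)) + 1) \<le> 4 * (w s + (e - s) - w s)" by blast
    have pp: "w s + (f - s) \<le> p" "p \<le> w s + (l - s)" using p(1) by simp_all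
    then have ps: "w s \<le> p" "p - w s < e - s" "f \<le> s + (p - w s)" "s + (p - w s) \<le> l"
      using sf by arith+
    have "w (s + (p - w s)) = p" using con(1)[OF ps(2)] ps(1) by simp
    moreover have "s + (p - w s) \<in> {f..l}" using ps by simp
    ultimately have "lm (w r) \<le> lm p" using r(2) by metis
    then have "2 ^ lm (w r) * z' \<le> 2 ^ lm p * z'" by (intro mult_le_mono1 power_increasing) auto
    also have "\<dots> \<le> 4 * (e - s)" using p(2) sf by (simp add: z'_def)
    finally have "2 ^ lm (w r) * z' \<le> 4 * (e - s)" .
    \<comment> \<open>Heaviness enters here:
      \<open>card ?X * (e - s) \<le> z * card H \<le> z * z'\<close>, after which \<open>z'\<close>
      cancels.\<close>
    then have "card ?X * (2 ^ lm (w r) * z') \<le> card ?X * (4 * (e - s))" by (rule mult_le_mono2)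
    also have "\<dots> \<le> 4 * (z * card H)" using dens by (simp add: distrib_left)
    also have "\<dots> \<le> 4 * (z * z')" using qz by simp
    finally have "(card ?X * 2 ^ lm (w r)) * z' \<le> (4 * z) * z'" by (simp add: mult.assoc)
    then have "card ?X * 2 ^ lm (w r) \<le> 4 * z" using z'0 by simp
    then have "real (card ?X * 2 ^ lm (w r)) \<le> real (4 * z)" by (rule of_nat_mono)
    then have pw: "2 ^ lm (w r) \<le> 4 * (real z / card ?X)" using k0 by (simp add: field_simps)
    have "real (2 * (card ?X * z')) \<le> real (z * card H)" using kz by (rule of_nat_mono)
    then have y2: "real z' / card H \<le> (real z / card ?X) / 2" using k0 q0 by (simp add: field_simps)
    \<comment> \<open>A heavy run therefore occurs only if at most half of the slots are path slots,
      which is the range where \<open>budget\<close> is linear.\<close>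
    have "1 \<le> real z' / card H" using qz q0 by simp
    then have y1: "2 \<le> real z / card ?X" using y2 by simp
    have "real (max 1 (lm (w r))) + 2 + budget (real z' / card H) \<le> budget (real z / card ?X)"
      by (rule budget_step[OF y1 y2 pw])
    then have "D * (real (max 1 (lm (w r))) + 2 + budget (real z' / card H)) \<le> D * budget (real z / card ?X)"
      by (intro mult_left_mono) auto
    then show ?thesis using s1 G unfolding k' by (simp add: algebra_simps)
  qed
  ultimately show "\<exists>Q'. segment w' z' Q' \<and> bounded_outside w' z' col' Q' \<and>
     real (sum c Q') \<le> D * (Y - budget (real z' / card (zeros w' z')))" by blast
qed

lemma initial_segment: "segment (\<lambda>i. i) n {0}" "bounded_outside (\<lambda>i. i) n col {0}" "sum c {0} = 0"
proof -
  show "segment (\<lambda>i. i) n {0}" using n_pos lm_0 by (auto simp: segment_def)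
  show "bounded_outside (\<lambda>i. i) n col {0}"
    unfolding bounded_outside_def
  proof (intro allI impI)
    fix p assume p: "p < n"
    have "prev p = p - 1" if "0 < p"
    proof -
      have "p + (n - 1) = n + (p - 1)" using that p by simp
      then have "prev p = (n + (p - 1)) mod n" by (rule arg_cong)
      then show ?thesis using p by (simp only: mod_add_self1) simp
    qed
    then show "p \<in> {0} \<or> (\<exists>i>0. i < n \<and> p = i \<and> prev p = i - 1)" using p by auto
  qed
  show "sum c {0} = 0" using c_0 by simp
qed

end

section \<open>Running time of loop-free programs and loops\<close>

abbreviation Var :: "string \<Rightarrow> aexp" where "Var x \<equiv> Cell x (Const 0)"

abbreviation Set :: "string \<Rightarrow> aexp \<Rightarrow> com" where "Set x a \<equiv> Store x (Const 0) a"

primrec block :: "com list \<Rightarrow> com" where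
  "block [] = Skip"
| "block (c # cs) = (if cs = [] then c else Seq c (block cs))"

primrec loop_free :: "com \<Rightarrow> bool" where
  "loop_free Skip = True"
| "loop_free (Store x a b) = True"
| "loop_free (Seq c d) = (loop_free c \<and> loop_free d)"
| "loop_free (Cond b c d) = (loop_free c \<and> loop_free d)"
| "loop_free (While b c) = False"

text \<open>A functional semantics of the loop-free fragment, so that loop bodies can be executed by
  simplification. The value at \<open>While\<close> is a dummy, as is the one in
  \<open>max_cost\<close>.\<close>

primrec run :: "com \<Rightarrow> memory \<Rightarrow> memory" where
  "run Skip s = s"
| "run (Store x a b) s = s(x := (s x)(aval a s := aval b s))"
| "run (Seq c d) s = run d (run c s)"
| "run (Cond b c d) s = (if bval b s then run c s else run d s)"
| "run (While b c) s = s"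

primrec max_cost :: "com \<Rightarrow> nat" where
  "max_cost Skip = 1"
| "max_cost (Store x a b) = 1 + acost a + acost b"
| "max_cost (Seq c d) = max_cost c + max_cost d"
| "max_cost (Cond b c d) = 1 + bcost b + max (max_cost c) (max_cost d)"
| "max_cost (While b c) = 0"

primrec writes :: "com \<Rightarrow> string set" where
  "writes Skip = {}"
| "writes (Store x a b) = {x}"
| "writes (Seq c d) = writes c \<union> writes d"
| "writes (Cond b c d) = writes c \<union> writes d"
| "writes (While b c) = writes c"

definition ends :: "com \<Rightarrow> memory \<Rightarrow> nat \<Rightarrow> (memory \<Rightarrow> bool) \<Rightarrow> bool" where
  "ends c s T Q \<longleftrightarrow> (\<exists>t s'. exec c s t s' \<and> t \<le> T \<and> Q s')"

lemma exec_run: "loop_free c \<Longrightarrow> \<exists>t\<le>max_cost c. exec c s t (run c s)"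
proof (induction c arbitrary: s)
  case Skip
  show ?case by (intro exI[of _ 1]) (simp add: exec.Skip[simplified])
next
  case (Store x a b)
  show ?case by (intro exI[of _ "1 + acost a + acost b"]) (simp add: exec.Store[simplified] del: fun_upd_apply)
next
  case (Seq c d)
  then obtain t t' where "t \<le> max_cost c" "exec c s t (run c s)"
    "t' \<le> max_cost d" "exec d (run c s) t' (run d (run c s))" by fastforce
  then show ?case by (intro exI[of _ "t + t'"]) (auto intro: exec.Seq)
next
  case (Cond b c d)
  show ?case
  proof (cases "bval b s")
    case True
    obtain t where "t \<le> max_cost c" "exec c s t (run c s)" using Cond by fastforce
    then show ?thesis using True
      by (intro exI[of _ "1 + bcost b + t"] conjI)
        (use exec.CondTrue[OF True, of c t "run c s" d] in simp_all)
  next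
    case False
    obtain t where "t \<le> max_cost d" "exec d s t (run d s)" using Cond by fastforce
    then show ?thesis using False
      by (intro exI[of _ "1 + bcost b + t"] conjI)
        (use exec.CondFalse[OF False, of d t "run d s" c] in simp_all)
  qed
qed auto

lemma exec_writes: "exec c s t s' \<Longrightarrow> x \<notin> writes c \<Longrightarrow> s' x = s x"
  by (induction rule: exec.induct) auto

lemma ends_run: "loop_free c \<Longrightarrow> Q (run c s) \<Longrightarrow> max_cost c \<le> T \<Longrightarrow> ends c s T Q"
  unfolding ends_def using exec_run by (meson order_trans)

lemma ends_Seq:
  "ends c s T (\<lambda>s'. ends d s' U Q) \<Longrightarrow> ends (Seq c d) s (T + U) Q"
  unfolding ends_def by (meson add_mono exec.Seq)

text \<open>The frame rule is built in: the new postcondition may rely on all arrays that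
  \<open>c\<close> does not write.\<close>

lemma ends_mono:
  "ends c s T Q \<Longrightarrow> T \<le> U \<Longrightarrow> (\<And>s'. (\<And>x. x \<notin> writes c \<Longrightarrow> s' x = s x) \<Longrightarrow> Q s' \<Longrightarrow> R s') \<Longrightarrow> ends c s U R"
  unfolding ends_def using exec_writes by (metis order_trans)

lemma ends_SeqI:
  assumes "ends c s T Q" "\<And>s'. (\<And>x. x \<notin> writes c \<Longrightarrow> s' x = s x) \<Longrightarrow> Q s' \<Longrightarrow> ends d s' U R"
    and "T + U \<le> W"
  shows "ends (Seq c d) s W R"
  by (rule ends_mono[OF ends_Seq[OF ends_mono[OF assms(1) order_refl assms(2)]] assms(3)])

lemma ends_CondI:
  assumes "bval b s \<Longrightarrow> ends c s T Q" "\<not> bval b s \<Longrightarrow> ends d s T Q"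
  shows "ends (Cond b c d) s (1 + bcost b + T) Q"
proof (cases "bval b s")
  case True
  then obtain t s' where "exec c s t s'" "t \<le> T" "Q s'" using assms(1) by (auto simp: ends_def)
  then show ?thesis using exec.CondTrue[OF True] unfolding ends_def
    by (intro exI[of _ "1 + bcost b + t"] exI[of _ s']) simp
next
  case False
  then obtain t s' where "exec d s t s'" "t \<le> T" "Q s'" using assms(2) by (auto simp: ends_def)
  then show ?thesis using exec.CondFalse[OF False] unfolding ends_def
    by (intro exI[of _ "1 + bcost b + t"] exI[of _ s']) simp
qed

text \<open>Amortised analysis: each iteration is paid from the decrease of \<open>\<Phi>\<close>,
  which thereby also proves termination. The bound \<open>T\<close> may differ from one iteration to
  the next.\<close>

lemma ends_While:
  assumes step: "\<And>s. I s \<Longrightarrow> bval b s \<Longrightarrow> \<exists>T. ends c s T (\<lambda>s'. I s' \<and> 1 + bcost b + T + \<Phi> s' \<le> \<Phi> s)"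
    and "I s"
  shows "ends (While b c) s (\<Phi> s + 1 + bcost b) (\<lambda>s'. I s' \<and> \<not> bval b s')"
  using assms(2)
proof (induction "\<Phi> s" arbitrary: s rule: less_induct)
  case less
  show ?case
  proof (cases "bval b s")
    case False
    then show ?thesis unfolding ends_def using less.prems exec.WhileFalse[OF False]
      by (intro exI[of _ "1 + bcost b"] exI[of _ s]) simp
  next
    case True
    obtain T t s' where s': "exec c s t s'" "t \<le> T" "I s'" "1 + bcost b + T + \<Phi> s' \<le> \<Phi> s"
      using step[OF less.prems True] by (auto simp: ends_def)
    then obtain t' s'' where "exec (While b c) s' t' s''" "t' \<le> \<Phi> s' + 1 + bcost b"
      "I s''" "\<not> bval b s''"
      using less.hyps[of s'] by (auto simp: ends_def)
    then show ?thesis unfolding ends_def using exec.WhileTrue[OF True s'(1)] s'(2,4)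
      by (intro exI[of _ "1 + bcost b + t + t'"] exI[of _ s'']) simp
  qed
qed

section \<open>Counting loops\<close>

definition For :: "string \<Rightarrow> aexp \<Rightarrow> string \<Rightarrow> com \<Rightarrow> com" where
  "For v a h c = Seq (Set v a) (While (Less (Var v) (Var h)) (Seq c (Set v (Plus (Var v) (Const 1)))))"

lemma writes_For [simp]: "writes (For v a h c) = insert v (writes c)"
  by (auto simp: For_def)

text \<open>Of the 12 units added to each iteration, 6 are for the test and 6 for the
  increment.\<close>

lemma ends_For:
  assumes c: "loop_free c" "v \<notin> writes c" "h \<notin> writes c" "h \<noteq> v"
    and start: "aval a s \<le> s h 0" "I (aval a s) (s(v := (s v)(0 := aval a s)))"
    and step: "\<And>i s'. \<lbrakk>I i s'; aval a s \<le> i; i < s h 0; s' v 0 = i;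
        \<And>x. x \<notin> insert v (writes c) \<Longrightarrow> s' x = s x\<rbrakk>
      \<Longrightarrow> I (Suc i) ((run c s')(v := (s' v)(0 := Suc i)))"
    and T: "(s h 0) * (max_cost c + 12) + acost a + 10 \<le> T"
  shows "ends (For v a h c) s T (\<lambda>s'. I (s h 0) s')"
proof -
  let ?b = "Less (Var v) (Var h)" and ?c = "Seq c (Set v (Plus (Var v) (Const 1)))"
  let ?s = "s(v := (s v)(0 := aval a s))"
  define J where "J s' \<longleftrightarrow> I (s' v 0) s' \<and> aval a s \<le> s' v 0 \<and> s' v 0 \<le> s h 0 \<and>
    (\<forall>x. x \<notin> insert v (writes c) \<longrightarrow> s' x = s x)" for s'
  have "ends (While ?b ?c) ?s ((s h 0 - ?s v 0) * (max_cost c + 12) + 1 + bcost ?b)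
    (\<lambda>s'. J s' \<and> \<not> bval ?b s')"
  proof (rule ends_While)
    fix s' assume J: "J s'" and b: "bval ?b s'"
    have h: "s' h 0 = s h 0" using J c by (auto simp: J_def)
    then have lt: "s' v 0 < s h 0" using b by simp
    have frame: "run c s' x = s' x" if "x \<notin> writes c" for x
      using exec_run[OF c(1), of s'] exec_writes that by metis
    have "I (Suc (s' v 0)) ((run c s')(v := (s' v)(0 := Suc (s' v 0))))"
      by (rule step) (use J lt in \<open>auto simp: J_def\<close>)
    then have "J (run ?c s')" using lt J c frame by (auto simp: J_def)
    moreover have "run ?c s' v 0 = Suc (s' v 0)" using frame c by simp
    moreover have "(s h 0 - s' v 0) * (max_cost c + 12)
        = (s h 0 - Suc (s' v 0)) * (max_cost c + 12) + (max_cost c + 12)"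
      using lt by (metis Suc_diff_Suc add.commute mult_Suc)
    ultimately show "\<exists>T. ends ?c s' T (\<lambda>s''. J s'' \<and>
        1 + bcost ?b + T + (s h 0 - s'' v 0) * (max_cost c + 12) \<le> (s h 0 - s' v 0) * (max_cost c + 12))"
      by (intro exI[of _ "max_cost ?c"] ends_run) (use c lt in auto)
  next
    show "J ?s" using start c by (auto simp: J_def)
  qed
  then have "ends (Seq (Set v a) (While ?b ?c)) s
      (max_cost (Set v a) + ((s h 0 - ?s v 0) * (max_cost c + 12) + 1 + bcost ?b)) (\<lambda>s'. J s' \<and> \<not> bval ?b s')"
    by (intro ends_Seq ends_run[of "Set v a"]) simp_all
  then show ?thesis unfolding For_def
  proof (rule ends_mono)
    have "(s h 0 - ?s v 0) * (max_cost c + 12) \<le> s h 0 * (max_cost c + 12)" by (intro mult_le_mono1) simp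
    then show "max_cost (Set v a) + ((s h 0 - ?s v 0) * (max_cost c + 12) + 1 + bcost ?b) \<le> T"
      using T unfolding max_cost.simps bcost.simps acost.simps fun_upd_same by linarith
  next
    fix s' assume "J s' \<and> \<not> bval ?b s'"
    moreover from this have "s' h 0 = s h 0" using c by (auto simp: J_def)
    ultimately show "I (s h 0) s'" by (auto simp: J_def dest: order_antisym)
  qed
qed

text \<open>The cost of a loop and of up to 40 units of preparation is rounded to a single product,
  so that the bounds of successive phases add up by distributivity.\<close>

lemma loop_time:
  fixes a c m n :: nat
  assumes "m \<le> n" "a \<le> 40"
  shows "a + m * (c + 12) \<le> (n + 1) * (c + 40)"
proof -
  have "m * (c + 12) \<le> n * (c + 40)" using assms(1) by (intro mult_le_mono) auto
  moreover have "(n + 1) * (c + 40) = n * (c + 40) + (c + 40)" by simp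
  ultimately show ?thesis using assms(2) by linarith
qed

section \<open>Rooting the tree by leaf elimination\<close>

text \<open>No adjacency lists are needed: the degrees and the sums of the neighbours are enough, since the
  sum of a leaf is its only neighbour. The leaves are removed in the order \<open>b (n - 1), \<dots>, b 1\<close>, so that
  every vertex has a larger index than its parent.\<close>

definition nbrs :: "nat set set \<Rightarrow> nat \<Rightarrow> nat set" where
  "nbrs E v = {w. {v, w} \<in> E}"

definition edge_at :: "(nat \<times> nat) list \<Rightarrow> nat \<Rightarrow> nat set" where
  "edge_at es l = {fst (es ! l), snd (es ! l)}"

definition read_edge :: com where
  "read_edge = block
    [Set ''u'' (Cell ''end1'' (Var ''i'')), Set ''v'' (Cell ''end2'' (Var ''i'')),
     Store ''deg'' (Var ''u'') (Plus (Cell ''deg'' (Var ''u'')) (Const 1)),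
     Store ''deg'' (Var ''v'') (Plus (Cell ''deg'' (Var ''v'')) (Const 1)),
     Store ''sum'' (Var ''u'') (Plus (Cell ''sum'' (Var ''u'')) (Var ''v'')),
     Store ''sum'' (Var ''v'') (Plus (Cell ''sum'' (Var ''v'')) (Var ''u''))]"

definition read_edges :: com where
  "read_edges = Seq (Set ''e'' (Minus (Var ''n'') (Const 1))) (For ''i'' (Const 0) ''e'' read_edge)"

lemma edge_list_nth:
  assumes "edge_list es E"
  shows "edge_at es ` {..<length es} = E" "inj_on (edge_at es) {..<length es}" "length es = card E"
proof -
  have eq: "map (\<lambda>(u, v). {u, v}) es ! l = edge_at es l" if "l < length es" for l
    using that by (simp add: edge_at_def split_beta)
  have "E = set (map (\<lambda>(u, v). {u, v}) es)" using assms by (simp add: edge_list_def)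
  also have "\<dots> = edge_at es ` {..<length es}"
    unfolding set_conv_nth using eq by (auto simp del: nth_map)
  finally show 1: "edge_at es ` {..<length es} = E" ..
  have d: "distinct (map (\<lambda>(u, v). {u, v}) es)" using assms by (simp add: edge_list_def)
  show 2: "inj_on (edge_at es) {..<length es}"
  proof (rule inj_onI)
    fix k l assume "k \<in> {..<length es}" "l \<in> {..<length es}" "edge_at es k = edge_at es l"
    then show "k = l" using d eq[of k] eq[of l] nth_eq_iff_index_eq[OF d, of k l] by simp
  qed
  show "length es = card E" using card_image[OF 2] 1 by simp
qed

text \<open>As the edges are distinct, each one contributes a new neighbour to both of its ends.
  Hence cardinality and sum grow exactly as the counters of the program do.\<close>

lemma nbrs_image_Suc:
  fixes es :: "(nat \<times> nat) list"
  assumes i: "i < length es" and inj: "inj_on (edge_at es) {..<length es}"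
    and ab: "a = fst (es ! i)" "b = snd (es ! i)" "a \<noteq> b"
  defines "N \<equiv> \<lambda>i. nbrs (edge_at es ` {..<i})"
  shows "N (Suc i) v = (if v = a then insert b (N i a) else if v = b then insert a (N i b) else N i v)"
    "b \<notin> N i a" "a \<notin> N i b" "finite (N i v)"
proof -
  have new: "{a, b} \<notin> edge_at es ` {..<i}"
  proof
    assume "{a, b} \<in> edge_at es ` {..<i}"
    then obtain l where "l < i" "edge_at es i = edge_at es l" using ab by (auto simp: edge_at_def)
    then show False using inj_onD[OF inj, of i l] i by simp
  qed
  have S: "edge_at es ` {..<Suc i} = insert {a, b} (edge_at es ` {..<i})"
    using ab by (auto simp: lessThan_Suc edge_at_def)
  show "N (Suc i) v = (if v = a then insert b (N i a) else if v = b then insert a (N i b) else N i v)"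
    unfolding N_def nbrs_def S using ab(3) by (auto simp: doubleton_eq_iff)
  show "b \<notin> N i a" "a \<notin> N i b" using new by (auto simp: N_def nbrs_def insert_commute)
  have "N i v \<subseteq> \<Union> (edge_at es ` {..<i})" by (auto simp: N_def nbrs_def)
  then show "finite (N i v)" by (rule finite_subset) (auto simp: edge_at_def)
qed

lemma ends_read_edges:
  assumes el: "edge_list es E" and sg: "simple_graph V E" and len: "length es = n - 1"
    and s: "s ''n'' 0 = n" "\<And>i. i < n - 1 \<Longrightarrow> s ''end1'' i = fst (es ! i) \<and> s ''end2'' i = snd (es ! i)"
    "s ''deg'' = (\<lambda>_. 0)" "s ''sum'' = (\<lambda>_. 0)"
  shows "ends read_edges s ((n + 1) * (max_cost read_edge + 40))
    (\<lambda>s'. \<forall>v. s' ''deg'' v = card (nbrs E v) \<and> s' ''sum'' v = \<Sum> (nbrs E v))"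
proof -
  note nth = edge_list_nth[OF el]
  define I where "I i s \<longleftrightarrow> (\<forall>v. s ''deg'' v = card (nbrs (edge_at es ` {..<i}) v)
      \<and> s ''sum'' v = \<Sum> (nbrs (edge_at es ` {..<i}) v))" for i and s :: memory
  let ?s = "run (Set ''e'' (Minus (Var ''n'') (Const 1))) s"
  have s': "?s ''e'' 0 = n - 1" "\<And>x. x \<noteq> ''e'' \<Longrightarrow> ?s x = s x" using s by auto
  have "ends (For ''i'' (Const 0) ''e'' read_edge) ?s ((n - 1) * (max_cost read_edge + 12) + 11)
    (\<lambda>s'. I (?s ''e'' 0) s')"
  proof (rule ends_For)
    show "I (aval (Const 0) ?s) (?s(''i'' := (?s ''i'')(0 := aval (Const 0) ?s)))"
      using s by (simp add: I_def nbrs_def)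
    fix i s1 assume I: "I i s1" and "i < ?s ''e'' 0" and i1: "s1 ''i'' 0 = i"
      and fr: "\<And>x. x \<notin> insert ''i'' (writes read_edge) \<Longrightarrow> s1 x = ?s x"
    then have i: "i < n - 1" using s' by simp
    define a where "a = fst (es ! i)"
    define b where "b = snd (es ! i)"
    have ab: "s1 ''end1'' i = a" "s1 ''end2'' i = b"
      using fr s s' i by (simp_all add: read_edge_def a_def b_def)
    have "{a, b} \<in> E" using nth(1) i len by (auto simp: edge_at_def a_def b_def)
    then have ne: "a \<noteq> b" using simple_graph_edgeD(3)[OF sg] by blast
    have il: "i < length es" using i len by simp
    note N = nbrs_image_Suc[OF il nth(2) a_def b_def ne]
    show "I (Suc i) ((run read_edge s1)(''i'' := (s1 ''i'')(0 := Suc i)))"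
      using I ne N(2-4) ab i1 unfolding I_def N(1) by (simp add: read_edge_def)
  qed (use s' in \<open>simp_all add: read_edge_def\<close>)
  then have "ends (For ''i'' (Const 0) ''e'' read_edge) ?s ((n - 1) * (max_cost read_edge + 12) + 11)
    (\<lambda>s'. \<forall>v. s' ''deg'' v = card (nbrs E v) \<and> s' ''sum'' v = \<Sum> (nbrs E v))"
    unfolding s' I_def len[symmetric] nth(1) .
  then have "ends read_edges s (6 + ((n - 1) * (max_cost read_edge + 12) + 11))
    (\<lambda>s'. \<forall>v. s' ''deg'' v = card (nbrs E v) \<and> s' ''sum'' v = \<Sum> (nbrs E v))"
    unfolding read_edges_def by (intro ends_Seq ends_run[of "Set _ _"]) simp_all
  then show ?thesis
  proof (rule ends_mono)
    show "6 + ((n - 1) * (max_cost read_edge + 12) + 11) \<le> (n + 1) * (max_cost read_edge + 40)"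
      using loop_time[of "n - 1" n 17] by simp
  qed
qed

section \<open>The initial queue of leaves\<close>

definition push_leaf :: com where
  "push_leaf = Cond (Conj (Less (Const 0) (Cell ''deg'' (Var ''i''))) (Less (Cell ''deg'' (Var ''i'')) (Const 2)))
     (block [Set ''t'' (Minus (Var ''t'') (Const 1)), Store ''b'' (Var ''t'') (Var ''i'')]) Skip"

definition push_leaves :: com where
  "push_leaves = Seq (Set ''t'' (Var ''n'')) (For ''i'' (Const 1) ''n'' push_leaf)"

text \<open>The queue grows downwards from index \<open>n\<close>. Starting at vertex 1 leaves out
  the root, and at most \<open>i - 1\<close> pushes precede vertex \<open>i\<close>, so that cell 0
  of \<open>b\<close> is never written and keeps the value 0, the root.\<close>

lemma ends_push_leaves:
  assumes s: "s ''n'' 0 = n" "0 < n" "s ''b'' = (\<lambda>_. 0)"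
  shows "ends push_leaves s ((n + 1) * (max_cost push_leaf + 40))
    (\<lambda>s'. 1 \<le> s' ''t'' 0 \<and> s' ''t'' 0 \<le> n \<and> s' ''b'' 0 = 0 \<and> inj_on (s' ''b'') {s' ''t'' 0..<n} \<and>
      s' ''b'' ` {s' ''t'' 0..<n} = {v. 1 \<le> v \<and> v < n \<and> s ''deg'' v = 1})"
proof -
  define I where "I i s' \<longleftrightarrow> n + 1 - i \<le> s' ''t'' 0 \<and> s' ''t'' 0 \<le> n \<and> s' ''b'' 0 = 0 \<and> inj_on (s' ''b'') {s' ''t'' 0..<n} \<and>
      s' ''b'' ` {s' ''t'' 0..<n} = {v. 1 \<le> v \<and> v < i \<and> s ''deg'' v = 1}" for i and s' :: memory
  let ?s = "run (Set ''t'' (Var ''n'')) s"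
  have s': "?s ''t'' 0 = n" "?s ''n'' 0 = n" "\<And>x. x \<noteq> ''t'' \<Longrightarrow> ?s x = s x" using s by auto
  have "ends (For ''i'' (Const 1) ''n'' push_leaf) ?s (n * (max_cost push_leaf + 12) + 11) (\<lambda>s'. I (?s ''n'' 0) s')"
  proof (rule ends_For)
    show "I (aval (Const 1) ?s) (?s(''i'' := (?s ''i'')(0 := aval (Const 1) ?s)))"
      using s by (auto simp: I_def)
    fix i s1 assume I: "I i s1" and i1: "aval (Const 1) ?s \<le> i" and i2: "i < ?s ''n'' 0" and si: "s1 ''i'' 0 = i"
      and fr: "\<And>x. x \<notin> insert ''i'' (writes push_leaf) \<Longrightarrow> s1 x = ?s x"
    have dg: "s1 ''deg'' = s ''deg''" using fr by (simp add: push_leaf_def)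
    have i: "1 \<le> i" "i < n" using i1 i2 s' by simp_all
    define t where "t = s1 ''t'' 0"
    define b where "b = s1 ''b''"
    have t: "2 \<le> t" "t \<le> n" and b: "b 0 = 0" "inj_on b {t..<n}" "b ` {t..<n} = {v. 1 \<le> v \<and> v < i \<and> s ''deg'' v = 1}"
      using I i unfolding I_def t_def b_def by auto
    show "I (Suc i) ((run push_leaf s1)(''i'' := (s1 ''i'')(0 := Suc i)))"
    proof (cases "s ''deg'' i = 1")
      case True
      define b' where "b' = b(t - 1 := i)"
      have set: "{t - 1..<n} = insert (t - 1) {t..<n}" using t by auto
      have b'b: "b' ` {t..<n} = b ` {t..<n}" unfolding b'_def using t by (intro image_cong) auto
      have "inj_on b' {t..<n}" using b(2) t unfolding b'_def by (auto simp: inj_on_def)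
      moreover have "b' (t - 1) \<notin> b ` {t..<n}" using b(3) by (auto simp: b'_def)
      ultimately have "inj_on b' {t - 1..<n}" unfolding set using b'b t by (auto simp: inj_on_insert)
      moreover have "b' ` {t - 1..<n} = {v. 1 \<le> v \<and> v < Suc i \<and> s ''deg'' v = 1}"
        unfolding set image_insert b'b b(3) using True i by (auto simp: b'_def less_Suc_eq)
      moreover have "n + 1 - Suc i \<le> t - 1" "t - 1 \<le> n" "b' 0 = 0"
        using I t b unfolding I_def b'_def t_def by auto
      ultimately show ?thesis using True dg si unfolding I_def b'_def b_def t_def by (simp add: push_leaf_def)
    next
      case False
      have "\<not> (0 < s ''deg'' i \<and> s ''deg'' i < 2)" using False by auto
      then have "run push_leaf s1 = s1" using dg si by (auto simp: push_leaf_def)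
      moreover have "{v. 1 \<le> v \<and> v < Suc i \<and> s ''deg'' v = 1} = {v. 1 \<le> v \<and> v < i \<and> s ''deg'' v = 1}"
        using False by (auto simp: less_Suc_eq)
      moreover have "n + 1 - Suc i \<le> t" using conjunct1[OF I[unfolded I_def]] unfolding t_def by arith
      ultimately show ?thesis using t b unfolding I_def t_def b_def by simp
    qed
  qed (use s s' in \<open>simp_all add: push_leaf_def\<close>)
  then have "ends push_leaves s (5 + (n * (max_cost push_leaf + 12) + 11)) (\<lambda>s'. I (?s ''n'' 0) s')"
    unfolding push_leaves_def by (intro ends_Seq ends_run[of "Set _ _"]) simp_all
  then show ?thesis
  proof (rule ends_mono)
    show "5 + (n * (max_cost push_leaf + 12) + 11) \<le> (n + 1) * (max_cost push_leaf + 40)"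
      using loop_time[of n n 16] by simp
  qed (use s' in \<open>auto simp: I_def\<close>)
qed

text \<open>A rooting at vertex 0 that exists by \<open>tree_rooted\<close>. The program does not
  know \<open>par\<close> and \<open>\<rho>\<close>; they serve the analysis.\<close>

locale rooted_graph =
  fixes n :: nat and E :: "nat set set" and par \<rho> :: "nat \<Rightarrow> nat"
  assumes n_pos: "0 < n"
    and par: "\<And>v. 0 < v \<Longrightarrow> v < n \<Longrightarrow> par v < n \<and> \<rho> (par v) < \<rho> v"
    and E: "E = (\<lambda>v. {v, par v}) ` ({..<n} - {0})"
begin

lemma nbrs_iff: "w \<in> nbrs E v \<longleftrightarrow> 0 < v \<and> v < n \<and> w = par v \<or> 0 < w \<and> w < n \<and> v = par w"
  unfolding nbrs_def E by (auto simp: doubleton_eq_iff)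


text \<open>The cells \<open>{h..<n}\<close> of \<open>b\<close> hold the removed vertices and the
  cells \<open>{t..<h}\<close> the queue of current leaves. The remaining vertices \<open>A\<close>
  are closed under \<open>par\<close>, and their counters refer to the subgraph induced by
  \<open>A\<close>. When a vertex is removed, its neighbour sum stays frozen at its parent.\<close>

definition elim_inv :: "nat \<Rightarrow> nat \<Rightarrow> (nat \<Rightarrow> nat) \<Rightarrow> (nat \<Rightarrow> nat) \<Rightarrow> (nat \<Rightarrow> nat) \<Rightarrow> (nat \<Rightarrow> nat) \<Rightarrow> bool" where
  "elim_inv h t b ix dg sm \<longleftrightarrow> (let A = {..<n} - b ` {h..<n} in
     1 \<le> t \<and> t \<le> h \<and> h \<le> n \<and> inj_on b {t..<n} \<and> b ` {t..<n} \<subseteq> {1..<n} \<and> b 0 = 0 \<and> ix 0 = 0 \<and>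
     (\<forall>v\<in>A - {0}. par v \<in> A) \<and>
     (\<forall>v\<in>A. dg v = card (nbrs E v \<inter> A) \<and> sm v = \<Sum> (nbrs E v \<inter> A)) \<and>
     (\<forall>v\<in>A - {0}. dg v = 1 \<longleftrightarrow> v \<in> b ` {t..<h}) \<and>
     (\<forall>j\<in>{h..<n}. sm (b j) = par (b j) \<and> ix (b j) = j \<and>
        (par (b j) \<in> A \<or> (\<exists>l\<in>{h..<j}. par (b j) = b l))))"

lemma elim_step:
  assumes inv: "elim_inv h t b ix dg sm" and h: "1 < h"
  defines "w \<equiv> b (h - 1)"
  defines "p \<equiv> sm w"
  defines "dg' \<equiv> dg(p := dg p - 1)" and "sm' \<equiv> sm(p := sm p - w)" and "ix' \<equiv> ix(w := h - 1)"
  shows "dg' p = 1 \<and> 0 < p \<Longrightarrow> elim_inv (h - 1) (t - 1) (b(t - 1 := p)) ix' dg' sm'"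
    and "\<not> (dg' p = 1 \<and> 0 < p) \<Longrightarrow> elim_inv (h - 1) t b ix' dg' sm'"
proof -
  define A where "A = {..<n} - b ` {h..<n}"
  have t: "1 \<le> t" "t \<le> h" "h \<le> n" and inj: "inj_on b {t..<n}" and bsub: "b ` {t..<n} \<subseteq> {1..<n}"
    and b0: "b 0 = 0" and ix0: "ix 0 = 0"
    and anc: "\<And>v. v \<in> A \<Longrightarrow> v \<noteq> 0 \<Longrightarrow> par v \<in> A"
    and dg: "\<And>v. v \<in> A \<Longrightarrow> dg v = card (nbrs E v \<inter> A)" and sm: "\<And>v. v \<in> A \<Longrightarrow> sm v = \<Sum> (nbrs E v \<inter> A)"
    and queue: "\<And>v. v \<in> A \<Longrightarrow> v \<noteq> 0 \<Longrightarrow> dg v = 1 \<longleftrightarrow> v \<in> b ` {t..<h}"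
    and doneP: "\<And>j. h \<le> j \<Longrightarrow> j < n \<Longrightarrow> sm (b j) = par (b j) \<and> ix (b j) = j \<and>
        (par (b j) \<in> A \<or> (\<exists>l\<in>{h..<j}. par (b j) = b l))"
    using inv unfolding elim_inv_def A_def[symmetric] Let_def by auto
  have An: "A \<subseteq> {..<n}" by (auto simp: A_def)
  have bpos: "0 < b x \<and> b x < n" if "t \<le> x" "x < n" for x
    using bsub that by (force simp: image_subset_iff)
  have A0: "0 \<in> A"
  proof -
    have "0 \<notin> b ` {h..<n}"
    proof
      assume "0 \<in> b ` {h..<n}"
      then obtain x where "x \<in> {h..<n}" "b x = 0" by fastforce
      then show False using bpos[of x] t by simp
    qed
    then show ?thesis using n_pos by (simp add: A_def)
  qed
  have cardA: "card A = h"
  proof -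
    have "card (b ` {h..<n}) = n - h" using inj t by (subst card_image) (auto intro: inj_on_subset)
    moreover have "b ` {h..<n} \<subseteq> {..<n}" using bpos t by auto
    ultimately show ?thesis using t by (simp add: A_def card_Diff_subset)
  qed
  \<comment> \<open>The queue is not empty: among the remaining vertices other than the root, one
    with largest \<open>\<rho>\<close> has no child left and is a leaf.\<close>
  have "t < h"
  proof -
    have fin: "finite (A - {0})" by (simp add: A_def)
    have "card (A - {0}) = h - 1" using cardA A0 by simp
    then have ne: "A - {0} \<noteq> {}" using h by (metis card.empty diff_is_0_eq not_less)
    have "Max (\<rho> ` (A - {0})) \<in> \<rho> ` (A - {0})" using fin ne by (intro Max_in) auto
    then obtain v where v: "v \<in> A - {0}" "Max (\<rho> ` (A - {0})) = \<rho> v" by blast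
    have vmax: "\<rho> x \<le> \<rho> v" if "x \<in> A - {0}" for x
      unfolding v(2)[symmetric] using fin that by (intro Max_ge) auto
    have "nbrs E v \<inter> A = {par v}"
    proof
      show "nbrs E v \<inter> A \<subseteq> {par v}"
      proof
        fix x assume x: "x \<in> nbrs E v \<inter> A"
        show "x \<in> {par v}"
        proof (rule ccontr)
          assume "x \<notin> {par v}"
          then have "0 < x" "x < n" "v = par x" using x by (auto simp: nbrs_iff)
          then have "\<rho> v < \<rho> x" using par by blast
          then show False using vmax[of x] x \<open>0 < x\<close> by auto
        qed
      qed
      show "{par v} \<subseteq> nbrs E v \<inter> A" using v anc An by (auto simp: nbrs_iff)
    qed
    then have "dg v = 1" using dg v by simp
    then have "v \<in> b ` {t..<h}" using queue[of v] v by auto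
    then show ?thesis by auto
  qed
  have h1: "h - 1 \<in> {t..<n}" "h - 1 \<in> {t..<h}" using \<open>t < h\<close> t by auto
  have wA: "w \<in> A"
  proof -
    have "w \<notin> b ` {h..<n}"
    proof
      assume "w \<in> b ` {h..<n}"
      then obtain x where x: "x \<in> {h..<n}" "w = b x" by blast
      then have "h - 1 = x" using inj_onD[OF inj, of "h - 1" x] h1 t by (simp add: w_def)
      then show False using x h by auto
    qed
    moreover have "w < n" using bpos[of "h - 1"] h1 unfolding w_def by simp
    ultimately show ?thesis by (simp add: A_def)
  qed
  have w0: "0 < w" using bpos[of "h - 1"] h1 unfolding w_def by simp
  have "dg w = 1" using queue[OF wA] w0 h1(2) by (auto simp: w_def)
  then obtain x where x: "nbrs E w \<inter> A = {x}" using dg[OF wA] by (auto simp: card_1_singleton_iff)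
  have "par w \<in> nbrs E w \<inter> A" using anc[OF wA] w0 wA An by (auto simp: nbrs_iff)
  then have nw: "nbrs E w \<inter> A = {par w}" using x by auto
  then have pw: "p = par w" using sm[OF wA] by (simp add: p_def)
  have pA: "p \<in> A" and pne: "p \<noteq> w" using pw nw par[of w] w0 wA An by auto
  define A' where "A' = A - {w}"
  have set: "{h - 1..<n} = insert (h - 1) {h..<n}" using h t by auto
  have A'eq: "{..<n} - b ` {h - 1..<n} = A'" unfolding set A'_def A_def w_def by auto
  have nb: "nbrs E v \<inter> A' = (if v = p then nbrs E v \<inter> A - {w} else nbrs E v \<inter> A)"
    and wnb: "w \<in> nbrs E p \<inter> A" if "v \<in> A" for v
  proof -
    have wv: "w \<in> nbrs E v \<longleftrightarrow> v = p"
    proof -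
      have "w \<in> nbrs E v \<longleftrightarrow> v \<in> nbrs E w" by (auto simp: nbrs_def insert_commute)
      then show ?thesis using nw pw that by auto
    qed
    then show "nbrs E v \<inter> A' = (if v = p then nbrs E v \<inter> A - {w} else nbrs E v \<inter> A)" by (auto simp: A'_def)
    have "w \<in> nbrs E p" using w0 wA An pw by (auto simp: nbrs_iff)
    then show "w \<in> nbrs E p \<inter> A" using wA by simp
  qed
  have anc': "par v \<in> A'" if "v \<in> A'" "v \<noteq> 0" for v
  proof -
    have "par v \<noteq> w"
    proof
      assume *: "par v = w"
      then have "v \<in> nbrs E w \<inter> A" using that An by (auto simp: nbrs_iff A'_def)
      then have "v = par w" using nw by simp
      then show False using * par[of v] par[of w] that An wA w0 by (auto simp: A'_def)
    qed
    then show ?thesis using anc that by (simp add: A'_def)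
  qed
  have dgsm': "dg' v = card (nbrs E v \<inter> A') \<and> sm' v = \<Sum> (nbrs E v \<inter> A')" if "v \<in> A'" for v
  proof (cases "v = p")
    case True
    then show ?thesis using nb[OF pA] wnb[OF pA] dg[OF pA] sm[OF pA] unfolding dg'_def sm'_def
      by (simp add: sum_diff1_nat)
  next
    case False
    then show ?thesis using nb[of v] dg[of v] sm[of v] that by (simp add: dg'_def sm'_def A'_def)
  qed
  \<comment> \<open>A queued \<open>p\<close> would have a single remaining neighbour, yet both
    \<open>w\<close> and its own parent remain.\<close>
  have pq: "p \<notin> b ` {t..<h}" if p0: "p \<noteq> 0"
  proof
    assume "p \<in> b ` {t..<h}"
    then have "dg p = 1" using queue[OF pA p0] by simp
    then have "card (nbrs E p \<inter> A) = 1" using dg[OF pA] by simp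
    moreover have "{w, par p} \<subseteq> nbrs E p \<inter> A" using wnb[OF pA] anc[OF pA p0] p0 pA An by (auto simp: nbrs_iff)
    ultimately have "par p = w" by (metis card_1_singletonE insert_subset singletonD)
    then show False using par[of p] par[of w] pw p0 pA An w0 wA by auto
  qed
  have done': "sm' (b j) = par (b j) \<and> ix' (b j) = j \<and>
        (par (b j) \<in> A' \<or> (\<exists>l\<in>{h - 1..<j}. par (b j) = b l))" if j: "h - 1 \<le> j" "j < n" for j
  proof (cases "j = h - 1")
    case True
    then have bw: "b j = w" by (simp add: w_def)
    show ?thesis unfolding bw using True pw pne pA by (simp add: sm'_def ix'_def p_def A'_def)
  next
    case False
    then have j': "h \<le> j" using j by simp
    have "b j \<notin> A" using j' j by (auto simp: A_def)
    then have "b j \<noteq> p" "b j \<noteq> w" using pA wA by auto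
    moreover have "par (b j) \<in> A' \<or> (\<exists>l\<in>{h - 1..<j}. par (b j) = b l)"
    proof (cases "par (b j) = w")
      case True then show ?thesis using j' h by (intro disjI2 bexI[of _ "h - 1"]) (auto simp: w_def)
    next
      case F: False
      consider "par (b j) \<in> A" | l where "l \<in> {h..<j}" "par (b j) = b l" using doneP[OF j' j(2)] by blast
      then show ?thesis
      proof cases
        case 2 then have "l \<in> {h - 1..<j}" by auto
        then show ?thesis using 2 by blast
      qed (use F in \<open>simp add: A'_def\<close>)
    qed
    ultimately show ?thesis using doneP[OF j' j(2)] by (simp add: sm'_def ix'_def)
  qed
  have queue': "dg' v = 1 \<longleftrightarrow> v \<in> b ` {t..<h - 1} \<or> (v = p \<and> dg' p = 1)" if v: "v \<in> A'" "v \<noteq> 0" for v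
  proof (cases "v = p")
    case True
    then have "p \<notin> b ` {t..<h - 1}" using pq v by auto
    then show ?thesis using True by simp
  next
    case False
    have "{t..<h} = insert (h - 1) {t..<h - 1}" using \<open>t < h\<close> by auto
    then have "b ` {t..<h} = insert w (b ` {t..<h - 1})" by (simp add: w_def)
    then show ?thesis using False queue[of v] v by (simp add: dg'_def A'_def)
  qed
  have ix'0: "ix' 0 = 0" using ix0 w0 by (simp add: ix'_def)
  show "elim_inv (h - 1) t b ix' dg' sm'" if np: "\<not> (dg' p = 1 \<and> 0 < p)"
    unfolding elim_inv_def A'eq Let_def
    using t \<open>t < h\<close> inj bsub b0 ix'0 anc' dgsm' done' queue' np by auto
  show "elim_inv (h - 1) (t - 1) (b(t - 1 := p)) ix' dg' sm'" if push: "dg' p = 1 \<and> 0 < p"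
  proof -
    define b' where "b' = b(t - 1 := p)"
    have eq: "b' j = b j" if "t \<le> j" for j using that t by (auto simp: b'_def)
    have img: "b' ` {a..<c} = b ` {a..<c}" if "t \<le> a" for a c
      using eq that by (intro image_cong) auto
    have pnb: "p \<notin> b ` {t..<n}"
    proof
      assume "p \<in> b ` {t..<n}"
      then obtain j where j: "j \<in> {t..<n}" "p = b j" by blast
      then show False using pA pq push by (cases "j < h") (auto simp: A_def)
    qed
    have "insert p (b ` {t..<n}) \<subseteq> {1..<n}" using bsub push pA An by auto
    then have "card (insert p (b ` {t..<n})) \<le> n - 1" using card_mono[of "{1..<n}"] by fastforce
    \<comment> \<open>Removed and queued vertices are distinct and differ from the root, and so does
      \<open>p\<close>. By counting there is room for it without touching cell 0.\<close>
    then have t2: "2 \<le> t" using pnb inj t by (simp add: card_image)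
    have setl: "{t - 1..<n} = insert (t - 1) {t..<n}" "{t - 1..<h - 1} = insert (t - 1) {t..<h - 1}"
      using t \<open>t < h\<close> by auto
    have "inj_on b' {t..<n}" using inj eq by (auto simp: inj_on_def)
    moreover have "b' (t - 1) = p" by (simp add: b'_def)
    ultimately have inj': "inj_on b' {t - 1..<n}" unfolding setl using img[of t n] pnb t2 by (auto simp: inj_on_insert)
    have sub': "b' ` {t - 1..<n} \<subseteq> {1..<n}" unfolding setl image_insert img[OF order_refl]
      using \<open>b' (t - 1) = p\<close> bsub push pA An by auto
    have Aq: "{..<n} - b' ` {h - 1..<n} = A'" using img[of "h - 1" n] \<open>t < h\<close> A'eq by auto
    have q: "b' ` {t - 1..<h - 1} = insert p (b ` {t..<h - 1})"
      unfolding setl image_insert img[OF order_refl] by (simp add: b'_def)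
    have dn: "sm' (b' j) = par (b' j) \<and> ix' (b' j) = j \<and>
        (par (b' j) \<in> A' \<or> (\<exists>l\<in>{h - 1..<j}. par (b' j) = b' l))" if j: "h - 1 \<le> j" "j < n" for j
    proof -
      have "b' l = b l" if "l \<in> {h - 1..<n}" for l using eq[of l] that \<open>t < h\<close> by auto
      then show ?thesis using done'[OF j] j by auto
    qed
    show ?thesis
      unfolding b'_def[symmetric] elim_inv_def Aq Let_def q
      using t2 t \<open>t < h\<close> inj' sub' b0 ix'0 anc' dgsm' dn queue' push by (auto simp: b'_def)
  qed
qed

lemma elim_init:
  assumes "1 \<le> t" "t \<le> n" "b 0 = 0" "ix 0 = 0" "inj_on b {t..<n}" "b ` {t..<n} = {v. 1 \<le> v \<and> v < n \<and> dg v = 1}"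
    and "\<And>v. dg v = card (nbrs E v) \<and> sm v = \<Sum> (nbrs E v)"
  shows "elim_inv n t b ix dg sm"
proof -
  have "nbrs E v \<inter> {..<n} = nbrs E v" if "v < n" for v using par that by (auto simp: nbrs_iff)
  then show ?thesis using assms par unfolding elim_inv_def Let_def by auto
qed

text \<open>With \<open>h = 1\<close> only the root remains. A parent was removed after its child or
  is the root, hence it has the smaller index.\<close>

lemma elim_final:
  assumes inv: "elim_inv 1 t b ix dg sm"
  shows "bij_betw b {..<n} {..<n}" "b 0 = 0"
    "\<And>j. 0 < j \<Longrightarrow> j < n \<Longrightarrow> sm (b j) = par (b j) \<and> ix (par (b j)) < j \<and> b (ix (par (b j))) = par (b j)"
proof -
  define A where "A = {..<n} - b ` {1..<n}"
  have t: "t = 1" and inj: "inj_on b {1..<n}" and bsub: "b ` {1..<n} \<subseteq> {1..<n}" and b0: "b 0 = 0" and ix0: "ix 0 = 0"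
    and dn: "\<And>j. 1 \<le> j \<Longrightarrow> j < n \<Longrightarrow> sm (b j) = par (b j) \<and> ix (b j) = j \<and>
        (par (b j) \<in> A \<or> (\<exists>l\<in>{1..<j}. par (b j) = b l))"
    using inv unfolding elim_inv_def A_def[symmetric] Let_def by auto
  have eq: "b ` {1..<n} = {1..<n}" by (rule endo_inj_surj[OF _ bsub inj]) simp
  have A: "A = {0}" unfolding A_def eq using n_pos by auto
  have set: "{..<n} = insert 0 {1..<n}" using n_pos by auto
  show "bij_betw b {..<n} {..<n}" unfolding bij_betw_def set image_insert eq b0
    using inj eq b0 by (auto simp: inj_on_insert)
  show "b 0 = 0" by (rule b0)
  fix j assume j: "0 < j" "j < n"
  then consider "par (b j) = 0" | l where "l \<in> {1..<j}" "par (b j) = b l" using dn[of j] A by auto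
  then show "sm (b j) = par (b j) \<and> ix (par (b j)) < j \<and> b (ix (par (b j))) = par (b j)"
  proof cases
    case 1 then show ?thesis using dn[of j] j ix0 b0 by simp
  next
    case 2 then show ?thesis using dn[of j] dn[of l] j by simp
  qed
qed

end

definition eliminate_leaf :: com where
  "eliminate_leaf = block
    [Set ''h'' (Minus (Var ''n'') (Var ''i'')), Set ''w'' (Cell ''b'' (Var ''h'')),
     Store ''ix'' (Var ''w'') (Var ''h''), Set ''p'' (Cell ''sum'' (Var ''w'')),
     Store ''deg'' (Var ''p'') (Minus (Cell ''deg'' (Var ''p'')) (Const 1)),
     Store ''sum'' (Var ''p'') (Minus (Cell ''sum'' (Var ''p'')) (Var ''w'')),
     Cond (Conj (Less (Const 0) (Var ''p''))
        (Conj (Less (Const 0) (Cell ''deg'' (Var ''p''))) (Less (Cell ''deg'' (Var ''p'')) (Const 2))))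
       (block [Set ''t'' (Minus (Var ''t'') (Const 1)), Store ''b'' (Var ''t'') (Var ''p'')]) Skip]"

definition eliminate :: com where
  "eliminate = For ''i'' (Const 1) ''n'' eliminate_leaf"

context rooted_graph
begin

lemma ends_eliminate:
  assumes s: "s ''n'' 0 = n" "elim_inv n (s ''t'' 0) (s ''b'') (s ''ix'') (s ''deg'') (s ''sum'')"
  shows "ends eliminate s ((n + 1) * (max_cost eliminate_leaf + 40))
    (\<lambda>s'. elim_inv 1 (s' ''t'' 0) (s' ''b'') (s' ''ix'') (s' ''deg'') (s' ''sum''))"
proof -
  define I where "I i s \<longleftrightarrow> elim_inv (n + 1 - i) (s ''t'' 0) (s ''b'') (s ''ix'') (s ''deg'') (s ''sum'')"
    for i and s :: memory
  have "ends eliminate s (11 + n * (max_cost eliminate_leaf + 12)) (\<lambda>s'. I (s ''n'' 0) s')"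
    unfolding eliminate_def
  proof (rule ends_For)
    show "I (aval (Const 1) s) (s(''i'' := (s ''i'')(0 := aval (Const 1) s)))" using s by (simp add: I_def)
    fix i s1 assume I: "I i s1" and i0: "aval (Const 1) s \<le> i" "i < s ''n'' 0" and i1: "s1 ''i'' 0 = i"
      and fr: "\<And>x. x \<notin> insert ''i'' (writes eliminate_leaf) \<Longrightarrow> s1 x = s x"
    have i: "1 \<le> i" "i < n" using i0 s by simp_all
    have sn: "s1 ''n'' 0 = n" using fr s by (simp add: eliminate_leaf_def)
    have h: "1 < n + 1 - i" "n + 1 - i - 1 = n - i" "n + 1 - Suc i = n - i" using i by auto
    note st = elim_step[OF I[unfolded I_def] h(1), unfolded h(2)]
    let ?w = "s1 ''b'' (n - i)"
    let ?p = "s1 ''sum'' ?w"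
    show "I (Suc i) ((run eliminate_leaf s1)(''i'' := (s1 ''i'')(0 := Suc i)))"
    proof (cases "s1 ''deg'' ?p - 1 = 1 \<and> 0 < ?p")
      case True
      have "I (Suc i) ((run eliminate_leaf s1)(''i'' := (s1 ''i'')(0 := Suc i))) \<longleftrightarrow>
        elim_inv (n - i) (s1 ''t'' 0 - 1) ((s1 ''b'')(s1 ''t'' 0 - 1 := ?p)) ((s1 ''ix'')(?w := n - i))
          ((s1 ''deg'')(?p := s1 ''deg'' ?p - 1)) ((s1 ''sum'')(?p := s1 ''sum'' ?p - ?w))"
        unfolding I_def h(3) using True i1 sn by (simp add: eliminate_leaf_def)
      then show ?thesis using st(1) True by simp
    next
      case False
      then have *: "\<not> (0 < ?p \<and> 0 < s1 ''deg'' ?p - Suc 0 \<and> s1 ''deg'' ?p - Suc 0 < 2)" by auto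
      have "I (Suc i) ((run eliminate_leaf s1)(''i'' := (s1 ''i'')(0 := Suc i))) \<longleftrightarrow>
        elim_inv (n - i) (s1 ''t'' 0) (s1 ''b'') ((s1 ''ix'')(?w := n - i))
          ((s1 ''deg'')(?p := s1 ''deg'' ?p - 1)) ((s1 ''sum'')(?p := s1 ''sum'' ?p - ?w))"
        unfolding I_def h(3) using * i1 sn by (simp add: eliminate_leaf_def del: de_Morgan_conj)
      then show ?thesis using st(2) False by simp
    qed
  qed (use s n_pos in \<open>simp_all add: eliminate_leaf_def\<close>)
  then show ?thesis
    by (rule ends_mono) (rule loop_time, use s in \<open>auto simp: I_def\<close>)
qed

end

text \<open>From here on the tree is handled through indices, \<open>b j\<close> being the vertex of
  index \<open>j\<close>. Since \<open>P j < j\<close>, an upward loop meets parents before children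
  and a downward loop children before parents.\<close>

definition indexed_tree :: "nat \<Rightarrow> nat set set \<Rightarrow> (nat \<Rightarrow> nat) \<Rightarrow> (nat \<Rightarrow> nat) \<Rightarrow> (nat \<Rightarrow> nat) \<Rightarrow> nat \<Rightarrow> bool" where
  "indexed_tree n E b P dep far \<longleftrightarrow> bij_betw b {..<n} {..<n} \<and> (\<forall>j. 0 < j \<and> j < n \<longrightarrow> P j < j) \<and>
     E = (\<lambda>j. {b j, b (P j)}) ` ({..<n} - {0}) \<and> dep 0 = 0 \<and> (\<forall>j. 0 < j \<and> j < n \<longrightarrow> dep j = dep (P j) + 1) \<and>
     far < n \<and> (\<forall>j<n. dep j \<le> dep far)"

definition set_parent :: com where
  "set_parent = block
    [Store ''P'' (Var ''j'') (Cell ''ix'' (Cell ''sum'' (Cell ''b'' (Var ''j'')))),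
     Store ''dep'' (Var ''j'') (Plus (Cell ''dep'' (Cell ''P'' (Var ''j''))) (Const 1)),
     Cond (Less (Cell ''dep'' (Var ''far'')) (Cell ''dep'' (Var ''j''))) (Set ''far'' (Var ''j'')) Skip]"

definition set_parents :: com where
  "set_parents = For ''j'' (Const 1) ''n'' set_parent"

lemma ends_set_parents:
  assumes s: "s ''n'' 0 = n" "0 < n" "s ''dep'' 0 = 0" "s ''far'' 0 = 0"
    and less: "\<And>j. 0 < j \<Longrightarrow> j < n \<Longrightarrow> s ''ix'' (s ''sum'' (s ''b'' j)) < j"
  shows "ends set_parents s ((n + 1) * (max_cost set_parent + 40))
    (\<lambda>s'. (\<forall>j. 0 < j \<and> j < n \<longrightarrow> s' ''P'' j = s ''ix'' (s ''sum'' (s ''b'' j))) \<and> s' ''dep'' 0 = 0 \<and>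
      (\<forall>j. 0 < j \<and> j < n \<longrightarrow> s' ''dep'' j = s' ''dep'' (s' ''P'' j) + 1) \<and>
      s' ''far'' 0 < n \<and> (\<forall>j<n. s' ''dep'' j \<le> s' ''dep'' (s' ''far'' 0)))"
proof -
  define par where "par j = s ''ix'' (s ''sum'' (s ''b'' j))" for j
  define I where "I i s' \<longleftrightarrow> (\<forall>j. 0 < j \<and> j < i \<longrightarrow> s' ''P'' j = par j) \<and> s' ''dep'' 0 = 0 \<and>
      (\<forall>j. 0 < j \<and> j < i \<longrightarrow> s' ''dep'' j = s' ''dep'' (par j) + 1) \<and>
      s' ''far'' 0 < i \<and> (\<forall>j<i. s' ''dep'' j \<le> s' ''dep'' (s' ''far'' 0))" for i and s' :: memory
  have "ends set_parents s (11 + n * (max_cost set_parent + 12)) (\<lambda>s'. I (s ''n'' 0) s')"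
    unfolding set_parents_def
  proof (rule ends_For)
    show "I (aval (Const 1) s) (s(''j'' := (s ''j'')(0 := aval (Const 1) s)))" using s by (auto simp: I_def)
    fix i s1 assume I: "I i s1" and i0: "aval (Const 1) s \<le> i" "i < s ''n'' 0" and i1: "s1 ''j'' 0 = i"
      and fr: "\<And>x. x \<notin> insert ''j'' (writes set_parent) \<Longrightarrow> s1 x = s x"
    have i: "0 < i" "i < n" using i0 s by simp_all
    have pi: "par i < i" using less[OF i] by (simp add: par_def)
    have fr': "s1 ''ix'' (s1 ''sum'' (s1 ''b'' i)) = par i" using fr by (simp add: set_parent_def par_def)
    have pj: "par j < i" if "0 < j" "j < i" for j using less[of j] that i by (simp add: par_def)
    define dp where "dp = (s1 ''dep'')(i := s1 ''dep'' (par i) + 1)"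
    define fa where "fa = (if s1 ''dep'' (s1 ''far'' 0) < dp i then i else s1 ''far'' 0)"
    let ?s2 = "(run set_parent s1)(''j'' := (s1 ''j'')(0 := Suc i))"
    have fi: "s1 ''far'' 0 < i" using I by (simp add: I_def)
    have new: "?s2 ''P'' = (s1 ''P'')(i := par i)" "?s2 ''dep'' = dp" "?s2 ''far'' 0 = fa"
      using i1 fr' pi fi by (simp_all add: set_parent_def dp_def fa_def)
    have mx: "s1 ''dep'' j \<le> s1 ''dep'' (s1 ''far'' 0)" if "j < i" for j using I that by (simp add: I_def)
    have "dp j \<le> dp fa" if "j < Suc i" for j
      using mx[of j] that fi by (cases "j = i") (auto simp: dp_def fa_def)
    then show "I (Suc i) ?s2"
      using I i pi pj fi unfolding I_def new by (auto simp: dp_def fa_def less_Suc_eq)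
  qed (use s in \<open>simp_all add: set_parent_def\<close>)
  then show ?thesis
    by (rule ends_mono) (rule loop_time, use s in \<open>auto simp: I_def par_def\<close>)
qed

definition search :: com where
  "search = Seq read_edges (Seq push_leaves (Seq eliminate set_parents))"

definition search_cost :: nat where
  "search_cost = max_cost read_edge + max_cost push_leaf + max_cost eliminate_leaf + max_cost set_parent + 160"

lemma ends_search:
  assumes T: "tree {..<n} E" and el: "edge_list es E"
  shows "ends search (input_memory n es) ((n + 1) * search_cost)
    (\<lambda>s. indexed_tree n E (s ''b'') (s ''P'') (s ''dep'') (s ''far'' 0))"
proof -
  let ?s = "input_memory n es"
  have n: "0 < n" using T by (auto simp: tree_def connected_graph_def)
  then have r: "0 \<in> {..<n}" by simp
  obtain \<rho> :: "nat \<Rightarrow> nat" and par where rooted: "\<forall>v\<in>{..<n} - {0}. par v \<in> {..<n} \<and> \<rho> (par v) < \<rho> v"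
    "E = (\<lambda>v. {v, par v}) ` ({..<n} - {0})" using tree_rooted[OF T r] by blast
  interpret rooted_graph n E par \<rho> by standard (use n rooted in auto)
  have sg: "simple_graph {..<n} E" using T by (simp add: tree_def)
  have len: "length es = n - 1" using tree_card_edges[OF T] edge_list_nth(3)[OF el] by simp
  have init: "?s ''n'' 0 = n" "\<And>i. i < n - 1 \<Longrightarrow> ?s ''end1'' i = fst (es ! i) \<and> ?s ''end2'' i = snd (es ! i)"
    using len by (simp_all add: input_memory_def)
  have zero: "?s x = (\<lambda>_. 0)" if "x \<notin> {''n'', ''end1'', ''end2''}" for x
    using that by (auto simp: input_memory_def)
  have time: "(n + 1) * (max_cost read_edge + 40) + ((n + 1) * (max_cost push_leaf + 40) +
     ((n + 1) * (max_cost eliminate_leaf + 40) + (n + 1) * (max_cost set_parent + 40))) \<le> (n + 1) * search_cost"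
    unfolding search_cost_def by (simp add: algebra_simps)
  have "ends search ?s ((n + 1) * (max_cost read_edge + 40) + ((n + 1) * (max_cost push_leaf + 40) +
     ((n + 1) * (max_cost eliminate_leaf + 40) + (n + 1) * (max_cost set_parent + 40))))
    (\<lambda>s. indexed_tree n E (s ''b'') (s ''P'') (s ''dep'') (s ''far'' 0))"
    unfolding search_def
  proof (rule ends_SeqI[OF ends_read_edges[OF el sg len, of ?s, OF init] _ order_refl])
    fix s1 assume fr1: "\<And>x. x \<notin> writes read_edges \<Longrightarrow> s1 x = ?s x"
      and q1: "\<forall>v. s1 ''deg'' v = card (nbrs E v) \<and> s1 ''sum'' v = \<Sum> (nbrs E v)"
    have z1: "s1 x = (\<lambda>_. 0)" if "x \<in> {''b'', ''ix'', ''dep'', ''far''}" for x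
      using fr1[of x] zero[of x] that by (auto simp: read_edges_def read_edge_def)
    have n1: "s1 ''n'' 0 = n" using fr1 init by (simp add: read_edges_def read_edge_def)
    show "ends (Seq push_leaves (Seq eliminate set_parents)) s1 ((n + 1) * (max_cost push_leaf + 40) +
     ((n + 1) * (max_cost eliminate_leaf + 40) + (n + 1) * (max_cost set_parent + 40)))
      (\<lambda>s. indexed_tree n E (s ''b'') (s ''P'') (s ''dep'') (s ''far'' 0))"
    proof (rule ends_SeqI[OF ends_push_leaves[of s1 n, OF n1 n] _ order_refl])
      show "s1 ''b'' = (\<lambda>_. 0)" using z1 by simp
      fix s2 assume fr2: "\<And>x. x \<notin> writes push_leaves \<Longrightarrow> s2 x = s1 x"
        and q2: "1 \<le> s2 ''t'' 0 \<and> s2 ''t'' 0 \<le> n \<and> s2 ''b'' 0 = 0 \<and> inj_on (s2 ''b'') {s2 ''t'' 0..<n} \<and>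
          s2 ''b'' ` {s2 ''t'' 0..<n} = {v. 1 \<le> v \<and> v < n \<and> s1 ''deg'' v = 1}"
      have s21: "s2 x = s1 x" if "x \<in> {''n'', ''ix'', ''deg'', ''sum'', ''dep'', ''far''}" for x
        using fr2[of x] that by (auto simp: push_leaves_def push_leaf_def)
      have n2: "s2 ''n'' 0 = n" using s21 n1 by simp
      have e2: "elim_inv n (s2 ''t'' 0) (s2 ''b'') (s2 ''ix'') (s2 ''deg'') (s2 ''sum'')"
        by (rule elim_init) (use q2 q1 s21 z1 in simp_all)
      show "ends (Seq eliminate set_parents) s2 ((n + 1) * (max_cost eliminate_leaf + 40) + (n + 1) * (max_cost set_parent + 40))
        (\<lambda>s. indexed_tree n E (s ''b'') (s ''P'') (s ''dep'') (s ''far'' 0))"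
      proof (rule ends_SeqI[OF ends_eliminate[of s2, OF n2 e2] _ order_refl])
        fix s3 assume fr3: "\<And>x. x \<notin> writes eliminate \<Longrightarrow> s3 x = s2 x"
          and q3: "elim_inv 1 (s3 ''t'' 0) (s3 ''b'') (s3 ''ix'') (s3 ''deg'') (s3 ''sum'')"
        note fin = elim_final[OF q3]
        have s32: "s3 x = s2 x" if "x \<in> {''n'', ''dep'', ''far''}" for x
          using fr3[of x] that by (auto simp: eliminate_def eliminate_leaf_def)
        have n3: "s3 ''n'' 0 = n" using s32 n2 by simp
        have less: "s3 ''ix'' (s3 ''sum'' (s3 ''b'' j)) < j" if "0 < j" "j < n" for j using fin(3)[OF that] by simp
        have z3: "s3 ''dep'' 0 = 0" "s3 ''far'' 0 = 0" using s32 s21 z1 by simp_all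
        show "ends set_parents s3 ((n + 1) * (max_cost set_parent + 40))
          (\<lambda>s. indexed_tree n E (s ''b'') (s ''P'') (s ''dep'') (s ''far'' 0))"
        proof (rule ends_mono[OF ends_set_parents[of s3 n, OF n3 n z3 less] order_refl])
          fix s4 assume fr4: "\<And>x. x \<notin> writes set_parents \<Longrightarrow> s4 x = s3 x"
            and q4: "(\<forall>j. 0 < j \<and> j < n \<longrightarrow> s4 ''P'' j = s3 ''ix'' (s3 ''sum'' (s3 ''b'' j))) \<and> s4 ''dep'' 0 = 0 \<and>
              (\<forall>j. 0 < j \<and> j < n \<longrightarrow> s4 ''dep'' j = s4 ''dep'' (s4 ''P'' j) + 1) \<and>
              s4 ''far'' 0 < n \<and> (\<forall>j<n. s4 ''dep'' j \<le> s4 ''dep'' (s4 ''far'' 0))"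
          have b4: "s4 ''b'' = s3 ''b''" using fr4 by (simp add: set_parents_def set_parent_def)
          have P4: "s4 ''P'' j < j" "s3 ''b'' (s4 ''P'' j) = par (s3 ''b'' j)" if "0 < j" "j < n" for j
            using fin(3)[OF that] q4 that by auto
          have "s3 ''b'' ` ({..<n} - {0}) = {..<n} - {0}"
          proof -
            have "s3 ''b'' ` ({..<n} - {0}) = s3 ''b'' ` {..<n} - s3 ''b'' ` {0}"
              by (rule inj_on_image_set_diff[OF bij_betw_imp_inj_on[OF fin(1)]]) (use n in auto)
            then show ?thesis using fin(1,2) by (simp add: bij_betw_def)
          qed
          then have "E = (\<lambda>v. {v, par v}) ` s3 ''b'' ` ({..<n} - {0})" using rooted(2) by simp
          also have "\<dots> = (\<lambda>j. {s3 ''b'' j, s3 ''b'' (s4 ''P'' j)}) ` ({..<n} - {0})"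
            unfolding image_image by (rule image_cong) (use P4 in auto)
          finally show "indexed_tree n E (s4 ''b'') (s4 ''P'') (s4 ''dep'') (s4 ''far'' 0)"
            unfolding indexed_tree_def b4 using q4 P4 fin(1) by auto
        qed
      qed
    qed
  qed (use zero in simp_all)
  then show ?thesis by (rule ends_mono[OF _ time])
qed

section \<open>Computing the layout\<close>

definition add_size :: com where
  "add_size = block
    [Set ''j'' (Minus (Var ''n'') (Var ''i'')), Set ''u'' (Cell ''P'' (Var ''j'')),
     Cond (Conj (Less (Const 0) (Cell ''sp'' (Var ''u'')))
         (Less (Cell ''sz'' (Var ''j'')) (Plus (Cell ''sz'' (Cell ''sp'' (Var ''u''))) (Const 1))))
       Skip (Store ''sp'' (Var ''u'') (Var ''j'')),
     Store ''sz'' (Var ''u'') (Plus (Plus (Cell ''sz'' (Var ''u'')) (Cell ''sz'' (Var ''j''))) (Const 1))]"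

definition add_sizes :: com where
  "add_sizes = For ''i'' (Const 1) ''n'' add_size"

text \<open>The value 0 of \<open>sp\<close> means that no child has been seen, as the root is never
  a child. With \<open>P j < j\<close>, the entry \<open>sz j\<close> is final once
  \<open>m \<le> j\<close>.\<close>

definition sized :: "nat \<Rightarrow> (nat \<Rightarrow> nat) \<Rightarrow> nat \<Rightarrow> (nat \<Rightarrow> nat) \<Rightarrow> (nat \<Rightarrow> nat) \<Rightarrow> bool" where
  "sized n P m sz sp \<longleftrightarrow> (\<forall>u. let C = {j. m \<le> j \<and> j < n \<and> P j = u} in
     sz u = (\<Sum>j\<in>C. sz j + 1) \<and> (C = {} \<longrightarrow> sp u = 0) \<and>
     (C \<noteq> {} \<longrightarrow> sp u \<in> C \<and> (\<forall>j\<in>C. sz j \<le> sz (sp u))))"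

lemma sized_step:
  assumes sized: "sized n P (Suc j) sz sp" and j: "0 < j" "j < n" and P: "P j < j"
  defines "u \<equiv> P j"
  defines "sz' \<equiv> sz(u := sz u + sz j + 1)"
    and "sp' \<equiv> (if 0 < sp u \<and> sz j < sz (sp u) + 1 then sp else sp(u := j))"
  shows "sized n P j sz' sp'"
  unfolding sized_def Let_def
proof
  fix v
  let ?C = "{l. Suc j \<le> l \<and> l < n \<and> P l = v}" and ?C' = "{l. j \<le> l \<and> l < n \<and> P l = v}"
  have old: "sz v = (\<Sum>l\<in>?C. sz l + 1)" "?C = {} \<Longrightarrow> sp v = 0"
    "?C \<noteq> {} \<Longrightarrow> sp v \<in> ?C" "\<And>l. l \<in> ?C \<Longrightarrow> sz l \<le> sz (sp v)"
    using spec[OF sized[unfolded sized_def Let_def], of v] by (simp, simp, simp, fastforce)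
  \<comment> \<open>The update happens at \<open>P j\<close>, which lies below
    \<open>j\<close>.\<close>
  have szl: "sz' l = sz l" if "j \<le> l" for l using that P by (auto simp: sz'_def u_def)
  have sum: "(\<Sum>l\<in>?C. sz' l + 1) = (\<Sum>l\<in>?C. sz l + 1)" by (rule sum.cong) (use szl in auto)
  show "sz' v = (\<Sum>l\<in>?C'. sz' l + 1) \<and> (?C' = {} \<longrightarrow> sp' v = 0) \<and>
     (?C' \<noteq> {} \<longrightarrow> sp' v \<in> ?C' \<and> (\<forall>l\<in>?C'. sz' l \<le> sz' (sp' v)))"
  proof (cases "v = u")
    case False
    then have C': "?C' = ?C" by (auto simp: u_def Suc_le_eq le_less)
    have "sp' v = sp v" "sz' v = sz v" using False by (auto simp: sp'_def sz'_def)
    moreover have "sz' l \<le> sz' (sp v)" if "l \<in> ?C" for l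
    proof -
      have "sp v \<in> ?C" using old(3) that by blast
      then show ?thesis using old(4)[OF that] szl[of l] szl[of "sp v"] that by simp
    qed
    ultimately show ?thesis unfolding C' sum using old by auto
  next
    case True
    have C': "?C' = insert j ?C" using True j by (auto simp: u_def Suc_le_eq le_less)
    have "sz' v = (\<Sum>l\<in>?C'. sz' l + 1)"
    proof -
      have "(\<Sum>l\<in>insert j ?C. sz' l + 1) = (sz' j + 1) + (\<Sum>l\<in>?C. sz' l + 1)"
        by (rule sum.insert) auto
      moreover have "sz' v = sz v + sz j + 1" using True by (simp add: sz'_def)
      ultimately show ?thesis unfolding C' using sum szl[of j] old(1) by linarith
    qed
    moreover have "sp' v \<in> ?C' \<and> (\<forall>l\<in>?C'. sz' l \<le> sz' (sp' v))"
    proof (cases "0 < sp u \<and> sz j < sz (sp u) + 1")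
      case T: True
      then have "?C \<noteq> {}" using old(2) True by auto
      then have s: "sp v \<in> ?C" using old(3) by blast
      have e: "sp' v = sp v" using T True by (simp add: sp'_def)
      have "sz' l \<le> sz' (sp v)" if l: "l \<in> ?C'" for l
      proof -
        have "sz l \<le> sz (sp v)" using l T True old(4)[of l] unfolding C' by auto
        then show ?thesis using szl[of l] szl[of "sp v"] l s by simp
      qed
      then show ?thesis unfolding e using s unfolding C' by blast
    next
      case F: False
      have e: "sp' v = j" using F True unfolding sp'_def by (simp del: de_Morgan_conj)
      have "sz' l \<le> sz' j" if l: "l \<in> ?C'" for l
      proof (cases "l = j")
        case lj: False
        then have lC: "l \<in> ?C" using l C' by blast
        then have "sp v \<in> ?C" using old(3) by blast
        then have "0 < sp u" using True by simp
        then have "sz (sp u) \<le> sz j" using F by auto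
        then show ?thesis using old(4)[OF lC] szl[of l] szl[of j] l True by simp
      qed simp
      then show ?thesis unfolding e using C' by blast
    qed
    ultimately show ?thesis unfolding C' by blast
  qed
qed

lemma ends_add_sizes:
  assumes s: "s ''n'' 0 = n" "0 < n" "s ''sz'' = (\<lambda>_. 0)" "s ''sp'' = (\<lambda>_. 0)"
    and P: "\<And>j. 0 < j \<Longrightarrow> j < n \<Longrightarrow> s ''P'' j < j"
  shows "ends add_sizes s ((n + 1) * (max_cost add_size + 40)) (\<lambda>s'. sized n (s ''P'') 1 (s' ''sz'') (s' ''sp''))"
proof -
  define I where "I i s' \<longleftrightarrow> sized n (s ''P'') (n + 1 - i) (s' ''sz'') (s' ''sp'')" for i and s' :: memory
  have "ends add_sizes s (11 + n * (max_cost add_size + 12)) (\<lambda>s'. I (s ''n'' 0) s')"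
    unfolding add_sizes_def
  proof (rule ends_For)
    show "I (aval (Const 1) s) (s(''i'' := (s ''i'')(0 := aval (Const 1) s)))"
      using s by (auto simp: I_def sized_def)
    fix i s1 assume I: "I i s1" and i0: "aval (Const 1) s \<le> i" "i < s ''n'' 0" and i1: "s1 ''i'' 0 = i"
      and fr: "\<And>x. x \<notin> insert ''i'' (writes add_size) \<Longrightarrow> s1 x = s x"
    have i: "1 \<le> i" "i < n" using i0 s by simp_all
    have sn: "s1 ''n'' 0 = n" "s1 ''P'' = s ''P''" using fr s by (simp_all add: add_size_def)
    define j where "j = n - i"
    have j: "0 < j" "j < n" "n + 1 - i = Suc j" "n + 1 - Suc i = j" using i by (auto simp: j_def)
    note st = sized_step[OF I[unfolded I_def j(3)] j(1,2) P[OF j(1,2)]]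
    let ?s2 = "(run add_size s1)(''i'' := (s1 ''i'')(0 := Suc i))" and ?u = "s ''P'' j"
    have "?s2 ''sz'' = (s1 ''sz'')(?u := s1 ''sz'' ?u + s1 ''sz'' j + 1)"
      using i1 sn by (simp add: add_size_def j_def)
    moreover have "?s2 ''sp'' = (if 0 < s1 ''sp'' ?u \<and> s1 ''sz'' j < s1 ''sz'' (s1 ''sp'' ?u) + 1 then s1 ''sp''
      else (s1 ''sp'')(?u := j))"
      using i1 sn by (simp add: add_size_def j_def)
    ultimately show "I (Suc i) ?s2" unfolding I_def j(4) using st by simp
  qed (use s in \<open>simp_all add: add_size_def\<close>)
  then show ?thesis
    by (rule ends_mono) (rule loop_time, use s in \<open>auto simp: I_def\<close>)
qed

section \<open>The path to a deepest vertex\<close>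

definition mark_path :: com where
  "mark_path = Cond (Less (Const 0) (Var ''x''))
     (block [Store ''sp'' (Cell ''P'' (Var ''x'')) (Var ''x''), Set ''x'' (Cell ''P'' (Var ''x''))]) Skip"

definition mark_paths :: com where
  "mark_paths = Seq (Set ''x'' (Var ''far'')) (For ''i'' (Const 1) ''n'' mark_path)"

text \<open>A counting loop can replace a climb of unknown length: \<open>x\<close> drops in each of
  the \<open>n - 1\<close> iterations until it is 0, and then nothing changes. The size of the part
  marked so far plus the depth of \<open>x\<close> is invariant.\<close>

lemma ends_mark_paths:
  assumes s: "s ''n'' 0 = n" "0 < n" "s ''far'' 0 < n"
    and P: "\<And>j. 0 < j \<Longrightarrow> j < n \<Longrightarrow> s ''P'' j < j"
    and dep: "s ''dep'' 0 = 0" "\<And>j. 0 < j \<Longrightarrow> j < n \<Longrightarrow> s ''dep'' j = s ''dep'' (s ''P'' j) + 1"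
  shows "ends mark_paths s ((n + 1) * (max_cost mark_path + 40)) (\<lambda>s'. \<exists>C\<subseteq>{..<n}. 0 \<in> C \<and>
      card C = s ''dep'' (s ''far'' 0) + 1 \<and> (\<forall>v\<in>C - {0}. s ''P'' v \<in> C \<and> s' ''sp'' (s ''P'' v) = v) \<and>
      (\<forall>u. s' ''sp'' u = s ''sp'' u \<or> u \<in> C \<and> 0 < s' ''sp'' u \<and> s' ''sp'' u < n \<and> s ''P'' (s' ''sp'' u) = u))"
proof -
  define I where "I i s' \<longleftrightarrow> s' ''x'' 0 \<le> n - i \<and> (\<exists>C\<subseteq>{s' ''x'' 0..<n}. s' ''x'' 0 \<in> C \<and>
      card C + s ''dep'' (s' ''x'' 0) = s ''dep'' (s ''far'' 0) + 1 \<and>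
      (\<forall>v\<in>C - {s' ''x'' 0}. s ''P'' v \<in> C \<and> s' ''sp'' (s ''P'' v) = v) \<and>
      (\<forall>u. s' ''sp'' u = s ''sp'' u \<or> u \<in> C \<and> 0 < s' ''sp'' u \<and> s' ''sp'' u < n \<and> s ''P'' (s' ''sp'' u) = u))"
    for i and s' :: memory
  let ?s = "run (Set ''x'' (Var ''far'')) s"
  have s': "?s ''n'' 0 = n" "?s ''x'' 0 = s ''far'' 0" "\<And>x. x \<noteq> ''x'' \<Longrightarrow> ?s x = s x" using s by auto
  have "ends (For ''i'' (Const 1) ''n'' mark_path) ?s (11 + n * (max_cost mark_path + 12)) (\<lambda>s'. I (?s ''n'' 0) s')"
  proof (rule ends_For)
    show "I (aval (Const 1) ?s) (?s(''i'' := (?s ''i'')(0 := aval (Const 1) ?s)))"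
      unfolding I_def using s by (intro conjI exI[of _ "{s ''far'' 0}"]) auto
    fix i s1 assume I: "I i s1" and i0: "aval (Const 1) ?s \<le> i" "i < ?s ''n'' 0" and i1: "s1 ''i'' 0 = i"
      and fr: "\<And>x. x \<notin> insert ''i'' (writes mark_path) \<Longrightarrow> s1 x = ?s x"
    have i: "1 \<le> i" "i < n" using i0 s' by simp_all
    have sP: "s1 ''P'' = s ''P''" using fr s' by (simp add: mark_path_def)
    define x where "x = s1 ''x'' 0"
    obtain C where x: "x \<le> n - i" and C: "C \<subseteq> {x..<n}" "x \<in> C" "card C + s ''dep'' x = s ''dep'' (s ''far'' 0) + 1"
      "\<And>v. v \<in> C - {x} \<Longrightarrow> s ''P'' v \<in> C \<and> s1 ''sp'' (s ''P'' v) = v"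
      "\<And>u. s1 ''sp'' u = s ''sp'' u \<or> u \<in> C \<and> 0 < s1 ''sp'' u \<and> s1 ''sp'' u < n \<and> s ''P'' (s1 ''sp'' u) = u"
      using I unfolding I_def x_def[symmetric] by blast
    let ?s2 = "(run mark_path s1)(''i'' := (s1 ''i'')(0 := Suc i))"
    show "I (Suc i) ?s2"
    proof (cases "0 < x")
      case False
      then have "run mark_path s1 = s1" by (simp add: mark_path_def x_def)
      then have "?s2 ''x'' 0 = x" "?s2 ''sp'' = s1 ''sp''" by (simp_all add: x_def)
      then show ?thesis unfolding I_def
        using x C False by (intro conjI exI[of _ C] ballI allI) simp_all
    next
      case True
      define y where "y = s ''P'' x"
      have xn: "x < n" using C by auto
      have yx: "y < x" using P[OF True xn] by (simp add: y_def)
      have new: "?s2 ''x'' 0 = y" "?s2 ''sp'' = (s1 ''sp'')(y := x)"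
        using True sP by (simp_all add: mark_path_def x_def y_def)
      have yC: "y \<notin> C" using C(1) yx by auto
      have finC: "finite C" using C(1) finite_subset by blast
      show ?thesis unfolding I_def new
      proof (intro conjI exI[of _ "insert y C"] ballI allI)
        show "y \<le> n - Suc i" using x yx by simp
        show "insert y C \<subseteq> {y..<n}" using C(1) yx xn by auto
        show "card (insert y C) + s ''dep'' y = s ''dep'' (s ''far'' 0) + 1"
          using yC finC C(3) dep(2)[OF True xn] by (simp add: y_def)
        fix v assume v: "v \<in> insert y C - {y}"
        show "s ''P'' v \<in> insert y C" using v C(4)[of v] by (cases "v = x") (auto simp: y_def)
        show "((s1 ''sp'')(y := x)) (s ''P'' v) = v"
          using v C(4)[of v] yC by (cases "v = x") (auto simp: y_def)
      next
        fix u
        show "((s1 ''sp'')(y := x)) u = s ''sp'' u \<or> u \<in> insert y C \<and> 0 < ((s1 ''sp'')(y := x)) u \<and>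
          ((s1 ''sp'')(y := x)) u < n \<and> s ''P'' (((s1 ''sp'')(y := x)) u) = u"
          using C(5)[of u] True xn by (auto simp: y_def)
      qed simp
    qed
  qed (use s s' in \<open>simp_all add: mark_path_def\<close>)
  then have "ends mark_paths s (5 + (11 + n * (max_cost mark_path + 12))) (\<lambda>s'. I (?s ''n'' 0) s')"
    unfolding mark_paths_def by (intro ends_Seq ends_run[of "Set _ _"]) simp_all
  then show ?thesis
  proof (rule ends_mono)
    show "5 + (11 + n * (max_cost mark_path + 12)) \<le> (n + 1) * (max_cost mark_path + 40)"
      using loop_time[of n n 16] by simp
    fix s2 assume "I (?s ''n'' 0) s2"
    then obtain C where C: "s2 ''x'' 0 = 0" "C \<subseteq> {s2 ''x'' 0..<n}" "s2 ''x'' 0 \<in> C"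
      "card C + s ''dep'' (s2 ''x'' 0) = s ''dep'' (s ''far'' 0) + 1"
      "\<forall>v\<in>C - {s2 ''x'' 0}. s ''P'' v \<in> C \<and> s2 ''sp'' (s ''P'' v) = v"
      "\<forall>u. s2 ''sp'' u = s ''sp'' u \<or> u \<in> C \<and> 0 < s2 ''sp'' u \<and> s2 ''sp'' u < n \<and> s ''P'' (s2 ''sp'' u) = u"
      unfolding I_def s' by auto
    then show "\<exists>C\<subseteq>{..<n}. 0 \<in> C \<and> card C = s ''dep'' (s ''far'' 0) + 1 \<and>
      (\<forall>v\<in>C - {0}. s ''P'' v \<in> C \<and> s2 ''sp'' (s ''P'' v) = v) \<and>
      (\<forall>u. s2 ''sp'' u = s ''sp'' u \<or> u \<in> C \<and> 0 < s2 ''sp'' u \<and> s2 ''sp'' u < n \<and> s ''P'' (s2 ''sp'' u) = u)"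
      using dep(1) by (intro exI[of _ C]) auto
  qed
qed

section \<open>Positions in preorder\<close>

definition place :: com where
  "place = block
    [Set ''u'' (Cell ''P'' (Var ''j'')),
     Cond (Conj (Neg (Less (Cell ''sp'' (Var ''u'')) (Var ''j''))) (Neg (Less (Var ''j'') (Cell ''sp'' (Var ''u'')))))
       (block [Store ''pos'' (Var ''j'') (Minus (Plus (Cell ''pos'' (Var ''u'')) (Cell ''sz'' (Var ''u''))) (Cell ''sz'' (Var ''j''))),
          Store ''lam'' (Var ''j'') (Cell ''lam'' (Var ''u''))])
       (block [Store ''pos'' (Var ''j'') (Plus (Plus (Cell ''pos'' (Var ''u'')) (Const 1)) (Cell ''nx'' (Var ''u''))),
          Store ''nx'' (Var ''u'') (Plus (Plus (Cell ''nx'' (Var ''u'')) (Cell ''sz'' (Var ''j''))) (Const 1)),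
          Store ''lam'' (Var ''j'') (Plus (Cell ''lam'' (Var ''u'')) (Const 1))])]"

definition place_all :: com where
  "place_all = For ''j'' (Const 1) ''n'' place"

definition placed :: "nat \<Rightarrow> (nat \<Rightarrow> nat) \<Rightarrow> (nat \<Rightarrow> nat) \<Rightarrow> (nat \<Rightarrow> nat) \<Rightarrow> (nat \<Rightarrow> nat) \<Rightarrow> (nat \<Rightarrow> nat) \<Rightarrow> nat \<Rightarrow> bool" where
  "placed n P sz sp pos lam i \<longleftrightarrow> pos 0 = 0 \<and> lam 0 = 0 \<and> (\<forall>j. 0 < j \<and> j < i \<longrightarrow>
     (sp (P j) = j \<longrightarrow> pos j = pos (P j) + sz (P j) - sz j \<and> lam j = lam (P j)) \<and>
     (sp (P j) \<noteq> j \<longrightarrow> lam j = lam (P j) + 1 \<and>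
        pos j = pos (P j) + 1 + (\<Sum>l\<in>{l. 0 < l \<and> l < j \<and> P l = P j \<and> l \<noteq> sp (P j)}. sz l + 1)))"

text \<open>One upward pass is enough because parents are placed before their children.
  \<open>nx u\<close> accumulates the room taken by the earlier children of \<open>u\<close>,
  leaving out the one visited last.\<close>

lemma ends_place_all:
  assumes s: "s ''n'' 0 = n" "0 < n" "s ''pos'' 0 = 0" "s ''lam'' 0 = 0" "s ''nx'' = (\<lambda>_. 0)"
    and P: "\<And>j. 0 < j \<Longrightarrow> j < n \<Longrightarrow> s ''P'' j < j"
  shows "ends place_all s ((n + 1) * (max_cost place + 40))
    (\<lambda>s'. placed n (s ''P'') (s ''sz'') (s ''sp'') (s' ''pos'') (s' ''lam'') n)"
proof -
  let ?P = "s ''P''" and ?sz = "s ''sz''" and ?sp = "s ''sp''"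
  let ?S = "\<lambda>i u. \<Sum>l\<in>{l. 0 < l \<and> l < i \<and> ?P l = u \<and> l \<noteq> ?sp u}. ?sz l + 1"
  define I where "I i s' \<longleftrightarrow> placed n ?P ?sz ?sp (s' ''pos'') (s' ''lam'') i \<and> (\<forall>u. s' ''nx'' u = ?S i u)"
    for i and s' :: memory
  have "ends place_all s (11 + n * (max_cost place + 12)) (\<lambda>s'. I (s ''n'' 0) s')"
    unfolding place_all_def
  proof (rule ends_For)
    have "{l. 0 < l \<and> l < Suc 0 \<and> ?P l = u \<and> l \<noteq> ?sp u} = {}" for u by auto
    then show "I (aval (Const 1) s) (s(''j'' := (s ''j'')(0 := aval (Const 1) s)))"
      using s unfolding I_def placed_def by simp
    fix i s1 assume I: "I i s1" and i0: "aval (Const 1) s \<le> i" "i < s ''n'' 0" and i1: "s1 ''j'' 0 = i"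
      and fr: "\<And>x. x \<notin> insert ''j'' (writes place) \<Longrightarrow> s1 x = s x"
    have i: "0 < i" "i < n" using i0 s by simp_all
    have sn: "s1 ''P'' = ?P" "s1 ''sz'' = ?sz" "s1 ''sp'' = ?sp" using fr by (simp_all add: place_def)
    define u where "u = ?P i"
    have ui: "u < i" using P[OF i] by (simp add: u_def)
    have Pj: "?P j < i" if "0 < j" "j < i" for j using P[of j] that i by simp
    let ?s2 = "(run place s1)(''j'' := (s1 ''j'')(0 := Suc i))"
    have pl: "placed n ?P ?sz ?sp (s1 ''pos'') (s1 ''lam'') i" and nx: "\<And>u. s1 ''nx'' u = ?S i u"
      using I by (auto simp: I_def)
    have set: "{l. 0 < l \<and> l < Suc i \<and> ?P l = v \<and> l \<noteq> ?sp v} =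
      (if v = u \<and> ?sp u \<noteq> i then insert i {l. 0 < l \<and> l < i \<and> ?P l = v \<and> l \<noteq> ?sp v}
       else {l. 0 < l \<and> l < i \<and> ?P l = v \<and> l \<noteq> ?sp v})" for v
      using i by (auto simp: u_def less_Suc_eq)
    show "I (Suc i) ?s2"
    proof (cases "?sp u = i")
      case True
      have new: "?s2 ''pos'' = (s1 ''pos'')(i := s1 ''pos'' u + ?sz u - ?sz i)"
        "?s2 ''lam'' = (s1 ''lam'')(i := s1 ''lam'' u)" "?s2 ''nx'' = s1 ''nx''"
        using i1 sn True by (simp_all add: place_def u_def)
      have "placed n ?P ?sz ?sp (?s2 ''pos'') (?s2 ''lam'') (Suc i)"
        unfolding placed_def new
      proof (intro conjI allI impI; (elim conjE)?)
        fix j assume j: "0 < j" "j < Suc i"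
        { assume "?sp (?P j) = j"
          then show "((s1 ''pos'')(i := s1 ''pos'' u + ?sz u - ?sz i)) j
              = ((s1 ''pos'')(i := s1 ''pos'' u + ?sz u - ?sz i)) (?P j) + ?sz (?P j) - ?sz j"
            "((s1 ''lam'')(i := s1 ''lam'' u)) j = ((s1 ''lam'')(i := s1 ''lam'' u)) (?P j)"
            using pl j Pj[of j] ui unfolding placed_def by (cases "j = i"; simp add: u_def)+ }
        { assume "?sp (?P j) \<noteq> j"
          moreover from this have "j \<noteq> i" using True by (auto simp: u_def)
          ultimately show "((s1 ''lam'')(i := s1 ''lam'' u)) j = ((s1 ''lam'')(i := s1 ''lam'' u)) (?P j) + 1"
            "((s1 ''pos'')(i := s1 ''pos'' u + ?sz u - ?sz i)) j
              = ((s1 ''pos'')(i := s1 ''pos'' u + ?sz u - ?sz i)) (?P j) + 1 + ?S j (?P j)"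
            using pl j Pj[of j] unfolding placed_def by simp_all }
      qed (use pl i in \<open>simp_all add: placed_def\<close>)
      moreover have "?s2 ''nx'' v = ?S (Suc i) v" for v unfolding new set using True nx[of v] by simp
      ultimately show ?thesis unfolding I_def by blast
    next
      case False
      have c: "\<not> (\<not> ?sp u < i \<and> \<not> i < ?sp u)" using False by auto
      have new: "?s2 ''pos'' = (s1 ''pos'')(i := s1 ''pos'' u + 1 + s1 ''nx'' u)"
        "?s2 ''lam'' = (s1 ''lam'')(i := s1 ''lam'' u + 1)"
        "?s2 ''nx'' = (s1 ''nx'')(u := s1 ''nx'' u + ?sz i + 1)"
        using i1 sn c ui by (simp_all add: place_def u_def del: de_Morgan_conj)
      have "placed n ?P ?sz ?sp (?s2 ''pos'') (?s2 ''lam'') (Suc i)"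
        unfolding placed_def new
      proof (intro conjI allI impI; (elim conjE)?)
        fix j assume j: "0 < j" "j < Suc i"
        { assume "?sp (?P j) = j"
          moreover from this have "j \<noteq> i" using False by (auto simp: u_def)
          ultimately show "((s1 ''pos'')(i := s1 ''pos'' u + 1 + s1 ''nx'' u)) j
              = ((s1 ''pos'')(i := s1 ''pos'' u + 1 + s1 ''nx'' u)) (?P j) + ?sz (?P j) - ?sz j"
            "((s1 ''lam'')(i := s1 ''lam'' u + 1)) j = ((s1 ''lam'')(i := s1 ''lam'' u + 1)) (?P j)"
            using pl j Pj[of j] unfolding placed_def by simp_all }
        { assume "?sp (?P j) \<noteq> j"
          then show "((s1 ''lam'')(i := s1 ''lam'' u + 1)) j = ((s1 ''lam'')(i := s1 ''lam'' u + 1)) (?P j) + 1"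
            "((s1 ''pos'')(i := s1 ''pos'' u + 1 + s1 ''nx'' u)) j
              = ((s1 ''pos'')(i := s1 ''pos'' u + 1 + s1 ''nx'' u)) (?P j) + 1 + ?S j (?P j)"
            using pl j Pj[of j] ui nx[of u] unfolding placed_def by (cases "j = i"; simp add: u_def)+ }
      qed (use pl i in \<open>simp_all add: placed_def\<close>)
      moreover have "?s2 ''nx'' v = ?S (Suc i) v" for v
        unfolding new set using False nx by simp
      ultimately show ?thesis unfolding I_def by blast
    qed
  qed (use s in \<open>simp_all add: place_def\<close>)
  then show ?thesis
    by (rule ends_mono) (rule loop_time, use s in \<open>auto simp: I_def\<close>)
qed

text \<open>\<open>lm\<close> is \<open>lam\<close> indexed by position. Of the initial colouring
  only the number \<open>n div 2\<close> of ones matters, since the first round recolours the whole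
  cycle.\<close>

definition init_slot :: com where
  "init_slot = block
    [Store ''lm'' (Cell ''pos'' (Var ''j'')) (Cell ''lam'' (Var ''j'')), Store ''seg'' (Var ''j'') (Var ''j''),
     Cond (Less (Plus (Plus (Var ''j'') (Var ''j'')) (Const 1)) (Var ''n'')) (Store ''col'' (Var ''j'') (Const 1)) Skip]"

definition init_slots :: com where
  "init_slots = For ''j'' (Const 0) ''n'' init_slot"

lemma ends_init_slots:
  assumes s: "s ''n'' 0 = n" "s ''col'' = (\<lambda>_. 0)" and inj: "inj_on (s ''pos'') {..<n}"
  shows "ends init_slots s ((n + 1) * (max_cost init_slot + 40))
    (\<lambda>s'. \<forall>j<n. s' ''lm'' (s ''pos'' j) = s ''lam'' j \<and> s' ''seg'' j = j \<and> s' ''col'' j = (if j + j + 1 < n then 1 else 0))"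
proof -
  define I where "I i s' \<longleftrightarrow> (\<forall>j<i. s' ''lm'' (s ''pos'' j) = s ''lam'' j \<and> s' ''seg'' j = j) \<and>
     (\<forall>j. s' ''col'' j = (if j < i \<and> j + j + 1 < n then 1 else 0))" for i and s' :: memory
  have "ends init_slots s (11 + n * (max_cost init_slot + 12)) (\<lambda>s'. I (s ''n'' 0) s')"
    unfolding init_slots_def
  proof (rule ends_For)
    show "I (aval (Const 0) s) (s(''j'' := (s ''j'')(0 := aval (Const 0) s)))" using s by (simp add: I_def)
    fix i s1 assume I: "I i s1" and i0: "i < s ''n'' 0" and i1: "s1 ''j'' 0 = i"
      and fr: "\<And>x. x \<notin> insert ''j'' (writes init_slot) \<Longrightarrow> s1 x = s x"
    have sn: "s1 ''n'' 0 = n" "s1 ''pos'' = s ''pos''" "s1 ''lam'' = s ''lam''"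
      using fr s by (simp_all add: init_slot_def)
    let ?s2 = "(run init_slot s1)(''j'' := (s1 ''j'')(0 := Suc i))"
    have new: "?s2 ''lm'' = (s1 ''lm'')(s ''pos'' i := s ''lam'' i)" "?s2 ''seg'' = (s1 ''seg'')(i := i)"
      "?s2 ''col'' = (if i + i + 1 < n then (s1 ''col'')(i := 1) else s1 ''col'')"
      using sn i1 by (simp_all add: init_slot_def)
    have ne: "s ''pos'' j \<noteq> s ''pos'' i" if "j < i" for j using inj_onD[OF inj, of j i] that i0 s by auto
    show "I (Suc i) ?s2" using I ne unfolding I_def new by (auto simp: less_Suc_eq)
  qed (use s in \<open>simp_all add: init_slot_def\<close>)
  then show ?thesis
    by (rule ends_mono) (rule loop_time, use s in \<open>auto simp: I_def\<close>)
qed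

section \<open>Searching for a heavy arc\<close>

text \<open>Reduction modulo \<open>z\<close> of an index below \<open>2 * z\<close>, on a machine
  without division.\<close>

definition wrap :: com where
  "wrap = Cond (Less (Var ''j'') (Var ''z'')) Skip (Set ''j'' (Minus (Var ''j'') (Var ''z'')))"

lemma wrap_mod: "a < 2 * z \<Longrightarrow> (if a < z then a else a - z) = a mod (z :: nat)"
  by (auto simp: mod_if le_mod_geq)

lemma run_wrap:
  assumes "s ''j'' 0 < 2 * s ''z'' 0"
  shows "run wrap s = s(''j'' := (s ''j'')(0 := s ''j'' 0 mod s ''z'' 0))"
  using wrap_mod[OF assms] by (auto simp: wrap_def fun_eq_iff)

lemma wrap_simps [simp]: "loop_free wrap" "writes wrap = {''j''}"
  by (auto simp: wrap_def)

definition count_slot :: com where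
  "count_slot = block
    [Cond (Less (Cell ''lm'' (Cell ''seg'' (Var ''i''))) (Const 1)) (Set ''k'' (Plus (Var ''k'') (Const 1))) Skip,
     Set ''m'' (Plus (Var ''m'') (Cell ''col'' (Cell ''seg'' (Var ''i''))))]"

definition count_slots :: com where
  "count_slots = Seq (block [Set ''k'' (Const 0), Set ''m'' (Const 0)]) (For ''i'' (Const 0) ''z'' count_slot)"

definition zero_slots :: "memory \<Rightarrow> nat set" where
  "zero_slots s = {i. i < s ''z'' 0 \<and> s ''lm'' (s ''seg'' i) = 0}"

lemma ends_count_slots:
  "ends count_slots s ((s ''z'' 0 + 1) * (max_cost count_slot + 40))
    (\<lambda>s'. s' ''k'' 0 = card (zero_slots s) \<and> s' ''m'' 0 = (\<Sum>i<s ''z'' 0. s ''col'' (s ''seg'' i)))"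
proof -
  let ?z = "s ''z'' 0"
  define I where "I i s' \<longleftrightarrow> s' ''k'' 0 = card {l. l < i \<and> s ''lm'' (s ''seg'' l) = 0} \<and>
    s' ''m'' 0 = (\<Sum>l<i. s ''col'' (s ''seg'' l))" for i and s' :: memory
  let ?s = "run (block [Set ''k'' (Const 0), Set ''m'' (Const 0)]) s"
  have s': "?s ''z'' 0 = ?z" by simp
  have "ends (For ''i'' (Const 0) ''z'' count_slot) ?s (11 + ?z * (max_cost count_slot + 12)) (\<lambda>s'. I (?s ''z'' 0) s')"
  proof (rule ends_For)
    show "I (aval (Const 0) ?s) (?s(''i'' := (?s ''i'')(0 := aval (Const 0) ?s)))" by (simp add: I_def)
    fix i s1 assume I: "I i s1" and i1: "s1 ''i'' 0 = i"
      and fr: "\<And>x. x \<notin> insert ''i'' (writes count_slot) \<Longrightarrow> s1 x = ?s x"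
    have sn: "s1 ''lm'' = s ''lm''" "s1 ''seg'' = s ''seg''" "s1 ''col'' = s ''col''"
      using fr by (simp_all add: count_slot_def)
    have "{l. l < Suc i \<and> s ''lm'' (s ''seg'' l) = 0} = (if s ''lm'' (s ''seg'' i) = 0
      then insert i {l. l < i \<and> s ''lm'' (s ''seg'' l) = 0} else {l. l < i \<and> s ''lm'' (s ''seg'' l) = 0})"
      by (auto simp: less_Suc_eq)
    then show "I (Suc i) ((run count_slot s1)(''i'' := (s1 ''i'')(0 := Suc i)))"
      using I i1 sn unfolding I_def by (simp add: count_slot_def)
  qed (simp_all add: count_slot_def)
  then have "ends count_slots s (8 + (11 + ?z * (max_cost count_slot + 12))) (\<lambda>s'. I (?s ''z'' 0) s')"
    unfolding count_slots_def by (intro ends_Seq ends_run[of "block _"]) simp_all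
  then show ?thesis
  proof (rule ends_mono)
    show "8 + (11 + ?z * (max_cost count_slot + 12)) \<le> (?z + 1) * (max_cost count_slot + 40)"
      using loop_time[of ?z ?z 19] by simp
  qed (auto simp: I_def zero_slots_def)
qed

section \<open>The sweep and its invariant\<close>

definition heavy_run :: "nat \<Rightarrow> nat set \<Rightarrow> nat \<Rightarrow> nat \<Rightarrow> nat \<Rightarrow> bool" where
  "heavy_run z X \<nu> f l \<longleftrightarrow> (\<exists>s e. heavy_arc z X \<nu> s e \<and>
     f = Min (shifted z X \<nu> \<inter> {s<..<e}) \<and> l = Max (shifted z X \<nu> \<inter> {s<..<e}))"

text \<open>Flag 2 is a hit, a path slot whose translate is again a path slot. It is stored as a
  range of length one, so that the choice of the cut need not distinguish it from a run.\<close>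

definition found :: "nat \<Rightarrow> nat set \<Rightarrow> nat \<Rightarrow> nat \<Rightarrow> nat \<Rightarrow> nat \<Rightarrow> bool" where
  "found z X \<nu> fd f l \<longleftrightarrow> fd = 0 \<or> fd = 1 \<and> heavy_run z X \<nu> f l \<or> fd = 2 \<and> l = f \<and> f \<in> X \<and> f \<in> shifted z X \<nu>"

text \<open>The state of the sweep before slot \<open>i\<close>. \<open>facc\<close> and
  \<open>lacc\<close> are copies of \<open>acc\<close> taken at the first and the last shifted point
  of the arc, so their difference is \<open>card X * (Max H - Min H)\<close>.\<close>

definition open_arc :: "nat \<Rightarrow> nat set \<Rightarrow> nat \<Rightarrow> nat \<Rightarrow> nat \<Rightarrow> nat \<Rightarrow> nat \<Rightarrow> nat \<Rightarrow> nat \<Rightarrow> nat \<Rightarrow> nat \<Rightarrow> bool" where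
  "open_arc z X \<nu> s i acc aq facc lacc tf te \<longleftrightarrow> (let H = shifted z X \<nu> \<inter> {s<..<i} in
     s \<in> X \<and> s < i \<and> (\<forall>x\<in>X. \<not> (s < x \<and> x < i)) \<and> acc = card X * (i - s) \<and> aq = z * card H \<and>
     (H \<noteq> {} \<longrightarrow> tf = Min H \<and> te = Max H \<and> facc = card X * (tf - s) \<and> lacc = card X * (te - s)))"

text \<open>The completeness half of the sweep: this holds as long as the flag is 0.\<close>

definition missed :: "nat \<Rightarrow> nat set \<Rightarrow> nat \<Rightarrow> nat \<Rightarrow> bool" where
  "missed z X \<nu> i \<longleftrightarrow> (\<forall>x\<in>X. x < i \<longrightarrow> x \<notin> shifted z X \<nu>) \<and> (\<forall>s e. e < i \<longrightarrow> \<not> heavy_arc z X \<nu> s e)"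

lemma finite_shifted [simp]: "finite (shifted z X \<nu>)"
  by (simp add: shifted_def)

text \<open>Moving \<open>facc\<close> to the right avoids a subtraction, and the \<open>+ 1\<close>
  turns \<open>\<le>\<close> into the available \<open><\<close>. Since \<open>z\<close> is
  positive, \<open>0 < aq\<close> tests whether the arc has a shifted point.\<close>

lemma close_arc_iff:
  assumes "open_arc z X \<nu> s e acc aq facc lacc tf te" "0 < z" "e \<le> z" "e = z \<or> e \<in> X"
  shows "0 < aq \<and> acc + lacc < aq + facc + 1 \<longleftrightarrow> heavy_arc z X \<nu> s e"
    "heavy_arc z X \<nu> s e \<Longrightarrow> heavy_run z X \<nu> tf te"
proof -
  let ?H = "shifted z X \<nu> \<inter> {s<..<e}"
  have arc: "arc z X s e" and acc: "acc = card X * (e - s)" and aq: "aq = z * card ?H"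
    and H: "?H \<noteq> {} \<Longrightarrow> tf = Min ?H \<and> te = Max ?H \<and> facc = card X * (tf - s) \<and> lacc = card X * (te - s)"
    using assms unfolding open_arc_def arc_def Let_def by auto
  have fin: "finite ?H" by simp
  have main: "acc + lacc < aq + facc + 1 \<longleftrightarrow> card X * ((e - s) + (Max ?H - Min ?H)) \<le> z * card ?H" if ne: "?H \<noteq> {}"
  proof -
    have "Min ?H \<in> ?H" using fin ne by (rule Min_in)
    moreover have "Min ?H \<le> Max ?H" by (rule Min_le[OF fin Max_in[OF fin ne]])
    ultimately have "te - s = (tf - s) + (Max ?H - Min ?H)" using H[OF ne] by auto
    then have "lacc = facc + card X * (Max ?H - Min ?H)" using H[OF ne] by (metis distrib_left)
    then show ?thesis using acc aq by (simp add: distrib_left, linarith)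
  qed
  have "0 < aq \<longleftrightarrow> ?H \<noteq> {}" using aq assms(2) fin by (simp add: card_gt_0_iff)
  then show "0 < aq \<and> acc + lacc < aq + facc + 1 \<longleftrightarrow> heavy_arc z X \<nu> s e"
    using main arc unfolding heavy_arc_def Let_def by blast
  show "heavy_run z X \<nu> tf te" if "heavy_arc z X \<nu> s e"
  proof -
    have "?H \<noteq> {}" using that unfolding heavy_arc_def Let_def by blast
    then show ?thesis using that H unfolding heavy_run_def by blast
  qed
qed

lemma missed_Suc:
  assumes a: "arc z X s i" and m: "missed z X \<nu> i" and h: "i \<in> X \<Longrightarrow> i \<notin> shifted z X \<nu>" "\<not> heavy_arc z X \<nu> s i"
  shows "missed z X \<nu> (Suc i)"
  unfolding missed_def
proof (intro conjI ballI allI impI)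
  fix x assume "x \<in> X" "x < Suc i"
  then show "x \<notin> shifted z X \<nu>" using m h by (cases "x = i") (auto simp: missed_def)
next
  fix s' e assume e: "e < Suc i"
  show "\<not> heavy_arc z X \<nu> s' e"
  proof (cases "e = i")
    case True
    show ?thesis
    proof
      assume g: "heavy_arc z X \<nu> s' e"
      then have a': "arc z X s' i" using True by (simp add: heavy_arc_def)
      have "i - 1 \<in> {s..<i}" "i - 1 \<in> {s'..<i}" using a a' by (auto simp: arc_def)
      then have "s' = s" using arc_unique[OF a' a] by blast
      then show False using g h True by simp
    qed
  qed (use m e in \<open>auto simp: missed_def\<close>)
qed

lemma missed_Suc_no_point:
  assumes "missed z X \<nu> i" "i \<notin> X" "i \<noteq> z"
  shows "missed z X \<nu> (Suc i)"
  using assms unfolding missed_def heavy_arc_def arc_def by (metis less_antisym)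

text \<open>Before slot 0 no arc is open; \<open>aq = 0\<close> then keeps \<open>close_arc\<close>
  from acting on stale values of the other counters.\<close>

definition sweep_inv :: "nat \<Rightarrow> nat set \<Rightarrow> nat \<Rightarrow> nat \<Rightarrow> memory \<Rightarrow> bool" where
  "sweep_inv z X \<nu> i s \<longleftrightarrow> found z X \<nu> (s ''fd'' 0) (s ''fi'' 0) (s ''la'' 0) \<and>
     (s ''fd'' 0 = 0 \<longrightarrow> missed z X \<nu> i) \<and> (i = 0 \<longrightarrow> s ''aq'' 0 = 0) \<and>
     (0 < i \<longrightarrow> (\<exists>a. open_arc z X \<nu> a i (s ''acc'' 0) (s ''aq'' 0) (s ''facc'' 0) (s ''lacc'' 0) (s ''tf'' 0) (s ''tl'' 0)))"

text \<open>Without multiplication, the two sides of the inequality in \<open>heavy_arc\<close> are accumulated along the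
  sweep: \<open>acc\<close> grows by \<open>card X\<close> at each slot, and \<open>aq\<close> grows by \<open>z\<close> at each shifted point.\<close>

definition close_arc :: com where
  "close_arc = Cond (Conj (Less (Const 0) (Var ''aq''))
       (Less (Plus (Var ''acc'') (Var ''lacc'')) (Plus (Plus (Var ''aq'') (Var ''facc'')) (Const 1))))
     (block [Set ''fd'' (Const 1), Set ''fi'' (Var ''tf''), Set ''la'' (Var ''tl'')]) Skip"

definition sweep_slot :: com where
  "sweep_slot = block
    [Set ''j'' (Plus (Var ''i'') (Var ''nu'')), wrap,
     Cond (Less (Cell ''lm'' (Cell ''seg'' (Var ''i''))) (Const 1))
       (block [close_arc, Set ''acc'' (Const 0), Set ''aq'' (Const 0),
          Cond (Less (Cell ''lm'' (Cell ''seg'' (Var ''j''))) (Const 1))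
            (block [Set ''fd'' (Const 2), Set ''fi'' (Var ''i''), Set ''la'' (Var ''i'')]) Skip])
       (Cond (Less (Cell ''lm'' (Cell ''seg'' (Var ''j''))) (Const 1))
          (block [Cond (Less (Const 0) (Var ''aq'')) Skip (block [Set ''tf'' (Var ''i''), Set ''facc'' (Var ''acc'')]),
             Set ''aq'' (Plus (Var ''aq'') (Var ''z'')), Set ''tl'' (Var ''i''), Set ''lacc'' (Var ''acc'')]) Skip),
     Set ''acc'' (Plus (Var ''acc'') (Var ''k''))]"

definition sweep :: com where
  "sweep = Seq (block [Set ''acc'' (Const 0), Set ''aq'' (Const 0), Set ''fd'' (Const 0)])
     (Seq (For ''i'' (Const 0) ''z'' sweep_slot) close_arc)"

lemma writes_close_arc [simp]: "writes close_arc = {''fd'', ''fi'', ''la''}" "loop_free close_arc"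
  by (auto simp: close_arc_def)

lemma run_close_arc:
  assumes z: "0 < z" "i \<le> z" "i = z \<or> i \<in> X" and inv: "sweep_inv z X \<nu> i s"
  defines "s' \<equiv> run close_arc s"
  shows "found z X \<nu> (s' ''fd'' 0) (s' ''fi'' 0) (s' ''la'' 0)"
    "s' ''fd'' 0 = 0 \<Longrightarrow> i \<in> X \<longrightarrow> i \<notin> shifted z X \<nu> \<Longrightarrow> missed z X \<nu> (Suc i)"
proof -
  let ?c = "0 < s ''aq'' 0 \<and> s ''acc'' 0 + s ''lacc'' 0 < s ''aq'' 0 + s ''facc'' 0 + 1"
  have fd: "found z X \<nu> (s ''fd'' 0) (s ''fi'' 0) (s ''la'' 0)" using inv by (simp add: sweep_inv_def)
  have no: "s' = s" if "\<not> ?c" using that by (auto simp: s'_def close_arc_def)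
  have yes: "s' ''fd'' 0 = 1" "s' ''fi'' 0 = s ''tf'' 0" "s' ''la'' 0 = s ''tl'' 0" if ?c
    using that by (auto simp: s'_def close_arc_def)
  have "found z X \<nu> (s' ''fd'' 0) (s' ''fi'' 0) (s' ''la'' 0) \<and>
    (s' ''fd'' 0 = 0 \<longrightarrow> (i \<in> X \<longrightarrow> i \<notin> shifted z X \<nu>) \<longrightarrow> missed z X \<nu> (Suc i))"
  proof (cases "i = 0")
    case True
    then have "\<not> ?c" using inv by (simp add: sweep_inv_def)
    moreover have "missed z X \<nu> (Suc 0)" if "0 \<notin> shifted z X \<nu>"
      using that by (auto simp: missed_def heavy_arc_def arc_def)
    moreover have "0 \<in> X" using True z by simp
    ultimately show ?thesis using fd no True by simp
  next
    case False
    then obtain a where a: "open_arc z X \<nu> a i (s ''acc'' 0) (s ''aq'' 0) (s ''facc'' 0) (s ''lacc'' 0) (s ''tf'' 0) (s ''tl'' 0)"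
      using inv by (auto simp: sweep_inv_def)
    have arc: "arc z X a i" using a z unfolding open_arc_def arc_def Let_def by auto
    show ?thesis
    proof (cases ?c)
      case True
      then have "heavy_run z X \<nu> (s ''tf'' 0) (s ''tl'' 0)" using close_arc_iff[OF a z(1,2,3)] by blast
      then show ?thesis using yes[OF True] by (simp add: found_def)
    next
      case F: False
      then have "\<not> heavy_arc z X \<nu> a i" using close_arc_iff(1)[OF a z(1,2,3)] by blast
      then show ?thesis using no[OF F] fd inv missed_Suc[OF arc] by (auto simp: sweep_inv_def)
    qed
  qed
  then show "found z X \<nu> (s' ''fd'' 0) (s' ''fi'' 0) (s' ''la'' 0)"
    "s' ''fd'' 0 = 0 \<Longrightarrow> i \<in> X \<longrightarrow> i \<notin> shifted z X \<nu> \<Longrightarrow> missed z X \<nu> (Suc i)" by blast+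
qed

text \<open>A path slot closes one arc, opens the next and may be a hit. A shifted point off the
  path extends the current run. Any other slot only advances \<open>acc\<close>.\<close>

lemma sweep_slot_correct:
  assumes inv: "sweep_inv z X \<nu> i s" and s: "s ''z'' 0 = z" "s ''i'' 0 = i" "s ''nu'' 0 = \<nu>" "s ''k'' 0 = card X"
    and X: "X = zero_slots s" and i: "i < z" and nu: "\<nu> \<le> z" and X0: "0 \<in> X"
  shows "sweep_inv z X \<nu> (Suc i) ((run sweep_slot s)(''i'' := (s ''i'')(0 := Suc i)))"
proof -
  define j where "j = (i + \<nu>) mod z"
  define s1 where "s1 = s(''j'' := (s ''j'')(0 := j))"
  have w: "run wrap (s(''j'' := (s ''j'')(0 := i + \<nu>))) = s1"
    using run_wrap[of "s(''j'' := (s ''j'')(0 := i + \<nu>))"] s i nu by (simp add: s1_def j_def)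
  have jz: "j < z" using i by (simp add: j_def)
  have iX: "i \<in> X \<longleftrightarrow> s ''lm'' (s ''seg'' i) = 0" using X s i by (simp add: zero_slots_def)
  have iC: "i \<in> shifted z X \<nu> \<longleftrightarrow> s ''lm'' (s ''seg'' j) = 0"
    using X s i jz by (simp add: shifted_def zero_slots_def j_def)
  have inv1: "sweep_inv z X \<nu> i s1" using inv by (simp add: sweep_inv_def s1_def)
  let ?r = "(run sweep_slot s)(''i'' := (s ''i'')(0 := Suc i))"
  have z: "0 < z" using i by simp
  have old: "\<exists>a. open_arc z X \<nu> a i (s ''acc'' 0) (s ''aq'' 0) (s ''facc'' 0) (s ''lacc'' 0) (s ''tf'' 0) (s ''tl'' 0)"
    if "i \<notin> X" using inv X0 that by (cases "i = 0") (auto simp: sweep_inv_def)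
  consider "i \<in> X" | "i \<notin> X" "i \<in> shifted z X \<nu>" | "i \<notin> X" "i \<notin> shifted z X \<nu>" by blast
  then show ?thesis
  proof cases
    case 1
    define s2 where "s2 = run close_arc s1"
    note c = run_close_arc[OF z _ _ inv1, folded s2_def]
    have s2: "s2 x = s1 x" if "x \<notin> {''fd'', ''fi'', ''la''}" for x
      using exec_run[of close_arc s1] exec_writes[of close_arc s1] that unfolding s2_def by fastforce
    have run: "run sweep_slot s = run (block [Set ''acc'' (Const 0), Set ''aq'' (Const 0),
          Cond (Less (Cell ''lm'' (Cell ''seg'' (Var ''j''))) (Const 1))
            (block [Set ''fd'' (Const 2), Set ''fi'' (Var ''i''), Set ''la'' (Var ''i'')]) Skip,
          Set ''acc'' (Plus (Var ''acc'') (Var ''k''))]) s2"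
      using 1 iX s w by (simp add: sweep_slot_def s1_def s2_def)
    have sv: "s2 ''lm'' (s2 ''seg'' (s2 ''j'' 0)) = s ''lm'' (s ''seg'' j)" "s2 ''i'' 0 = i" "s2 ''k'' 0 = card X"
      using s2 s by (simp_all add: s1_def)
    have new: "?r ''acc'' 0 = card X" "?r ''aq'' 0 = 0"
      unfolding run using sv by simp_all
    have fds: "i \<in> shifted z X \<nu> \<Longrightarrow> ?r ''fd'' 0 = 2 \<and> ?r ''fi'' 0 = i \<and> ?r ''la'' 0 = i"
      "i \<notin> shifted z X \<nu> \<Longrightarrow> ?r ''fd'' 0 = s2 ''fd'' 0 \<and> ?r ''fi'' 0 = s2 ''fi'' 0 \<and> ?r ''la'' 0 = s2 ''la'' 0"
      unfolding run iC using sv by simp_all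
    have none: "shifted z X \<nu> \<inter> {i<..<Suc i} = {}" by auto
    have "open_arc z X \<nu> i (Suc i) (?r ''acc'' 0) (?r ''aq'' 0) (?r ''facc'' 0) (?r ''lacc'' 0) (?r ''tf'' 0) (?r ''tl'' 0)"
      unfolding open_arc_def Let_def none new using 1 by auto
    moreover have "found z X \<nu> (?r ''fd'' 0) (?r ''fi'' 0) (?r ''la'' 0) \<and> (?r ''fd'' 0 = 0 \<longrightarrow> missed z X \<nu> (Suc i))"
    proof (cases "i \<in> shifted z X \<nu>")
      case True
      then show ?thesis using fds(1) 1 by (simp add: found_def)
    next
      case False
      then show ?thesis using fds(2)[OF False] c i 1 by simp
    qed
    ultimately show ?thesis unfolding sweep_inv_def by blast
  next
    case 2
    obtain a where a: "open_arc z X \<nu> a i (s ''acc'' 0) (s ''aq'' 0) (s ''facc'' 0) (s ''lacc'' 0) (s ''tf'' 0) (s ''tl'' 0)"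
      using old[OF 2(1)] by blast
    let ?H = "shifted z X \<nu> \<inter> {a<..<i}" and ?H' = "shifted z X \<nu> \<inter> {a<..<Suc i}"
    have A: "a \<in> X" "a < i" "\<forall>x\<in>X. \<not> (a < x \<and> x < i)" "s ''acc'' 0 = card X * (i - a)" "s ''aq'' 0 = z * card ?H"
      "?H \<noteq> {} \<Longrightarrow> s ''tf'' 0 = Min ?H \<and> s ''tl'' 0 = Max ?H \<and> s ''facc'' 0 = card X * (s ''tf'' 0 - a) \<and> s ''lacc'' 0 = card X * (s ''tl'' 0 - a)"
      using a unfolding open_arc_def Let_def by auto
    have H': "?H' = insert i ?H" using 2 A(2) by auto
    have aq: "0 < s ''aq'' 0 \<longleftrightarrow> ?H \<noteq> {}" using A(5) z by (simp add: card_gt_0_iff)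
    have lmi: "\<not> s ''lm'' (s ''seg'' i) < 1" "s ''lm'' (s ''seg'' j) < 1" using 2 iX iC by auto
    have new: "?r ''acc'' 0 = s ''acc'' 0 + card X" "?r ''aq'' 0 = s ''aq'' 0 + z" "?r ''tl'' 0 = i" "?r ''lacc'' 0 = s ''acc'' 0"
      "?r ''tf'' 0 = (if ?H \<noteq> {} then s ''tf'' 0 else i)" "?r ''facc'' 0 = (if ?H \<noteq> {} then s ''facc'' 0 else s ''acc'' 0)"
      "?r ''fd'' 0 = s ''fd'' 0" "?r ''fi'' 0 = s ''fi'' 0" "?r ''la'' 0 = s ''la'' 0"
      using lmi s w unfolding aq[symmetric] by (simp_all add: sweep_slot_def s1_def)
    have fin: "finite ?H" by simp
    have lt: "x < i" if "x \<in> ?H" for x using that by simp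
    have Mx: "Max ?H' = i" unfolding H' using fin lt by (intro Max_eqI) (auto intro: less_imp_le)
    have Mn: "Min ?H' = (if ?H \<noteq> {} then Min ?H else i)"
    proof (cases "?H = {}")
      case False
      have "Min ?H \<in> ?H" using Min_in[OF fin False] .
      then have "Min ?H < i" by (rule lt)
      then have "Min (insert i ?H) = Min ?H" using Min_insert[OF fin False, of i] by simp
      then show ?thesis unfolding H' using False by argo
    qed (simp add: H')
    have "card ?H' = Suc (card ?H)" unfolding H' using fin lt by (subst card_insert_disjoint) auto
    then have aq': "s ''aq'' 0 + z = z * card ?H'" using A(5) by simp
    have acc': "s ''acc'' 0 + card X = card X * (Suc i - a)" using A(2,4) by (simp add: Suc_diff_le)
    have "open_arc z X \<nu> a (Suc i) (?r ''acc'' 0) (?r ''aq'' 0) (?r ''facc'' 0) (?r ''lacc'' 0) (?r ''tf'' 0) (?r ''tl'' 0)"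
      unfolding open_arc_def Let_def new Mx Mn aq' acc'
    proof (intro conjI impI ballI)
      fix x assume "x \<in> X" then show "\<not> (a < x \<and> x < Suc i)" using A(3) 2(1) by (auto simp: less_Suc_eq)
    qed (use A in auto)
    moreover have "s ''fd'' 0 = 0 \<longrightarrow> missed z X \<nu> (Suc i)"
      using inv missed_Suc_no_point[of z X \<nu> i] 2(1) i by (auto simp: sweep_inv_def)
    ultimately show ?thesis using inv unfolding sweep_inv_def new by blast
  next
    case 3
    obtain a where a: "open_arc z X \<nu> a i (s ''acc'' 0) (s ''aq'' 0) (s ''facc'' 0) (s ''lacc'' 0) (s ''tf'' 0) (s ''tl'' 0)"
      using old[OF 3(1)] by blast
    have lmi: "\<not> s ''lm'' (s ''seg'' i) < 1" "\<not> s ''lm'' (s ''seg'' j) < 1" using 3 iX iC by auto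
    have new: "?r ''acc'' 0 = s ''acc'' 0 + card X" "?r ''aq'' 0 = s ''aq'' 0" "?r ''tl'' 0 = s ''tl'' 0" "?r ''lacc'' 0 = s ''lacc'' 0"
      "?r ''tf'' 0 = s ''tf'' 0" "?r ''facc'' 0 = s ''facc'' 0"
      "?r ''fd'' 0 = s ''fd'' 0" "?r ''fi'' 0 = s ''fi'' 0" "?r ''la'' 0 = s ''la'' 0"
      using lmi s w by (simp_all add: sweep_slot_def s1_def)
    have H': "shifted z X \<nu> \<inter> {a<..<Suc i} = shifted z X \<nu> \<inter> {a<..<i}" using 3 by (auto simp: less_Suc_eq)
    have "a < i" "s ''acc'' 0 = card X * (i - a)" using a unfolding open_arc_def Let_def by auto
    then have acc': "s ''acc'' 0 + card X = card X * (Suc i - a)" by (simp add: Suc_diff_le)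
    have "open_arc z X \<nu> a (Suc i) (?r ''acc'' 0) (?r ''aq'' 0) (?r ''facc'' 0) (?r ''lacc'' 0) (?r ''tf'' 0) (?r ''tl'' 0)"
      using a 3(1) unfolding open_arc_def Let_def new acc' H' by (auto simp: less_Suc_eq)
    moreover have "s ''fd'' 0 = 0 \<longrightarrow> missed z X \<nu> (Suc i)"
      using inv missed_Suc_no_point[of z X \<nu> i] 3(1) i by (auto simp: sweep_inv_def)
    ultimately show ?thesis using inv unfolding sweep_inv_def new by blast
  qed
qed

lemma ends_sweep:
  assumes s: "s ''z'' 0 = z" "s ''nu'' 0 = \<nu>" "s ''k'' 0 = card X" and X: "X = zero_slots s" and z: "0 < z" and nu: "\<nu> \<le> z" and X0: "0 \<in> X"
  shows "ends sweep s ((z + 1) * (max_cost sweep_slot + max_cost close_arc + 60))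
    (\<lambda>s'. found z X \<nu> (s' ''fd'' 0) (s' ''fi'' 0) (s' ''la'' 0) \<and>
      (s' ''fd'' 0 = 0 \<longrightarrow> (\<forall>x\<in>X. x \<notin> shifted z X \<nu>) \<and> (\<forall>s e. \<not> heavy_arc z X \<nu> s e)))"
proof -
  let ?c0 = "block [Set ''acc'' (Const 0), Set ''aq'' (Const 0), Set ''fd'' (Const 0)]"
  let ?s = "run ?c0 s"
  have Xz: "X \<subseteq> {..<z}" using X s by (auto simp: zero_slots_def)
  have "ends (For ''i'' (Const 0) ''z'' sweep_slot) ?s (11 + z * (max_cost sweep_slot + 12))
    (\<lambda>s'. sweep_inv z X \<nu> (?s ''z'' 0) s')"
  proof (rule ends_For)
    show "sweep_inv z X \<nu> (aval (Const 0) ?s) (?s(''i'' := (?s ''i'')(0 := aval (Const 0) ?s)))"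
      by (simp add: sweep_inv_def found_def missed_def)
    fix i s1 assume I: "sweep_inv z X \<nu> i s1" and i0: "i < ?s ''z'' 0" and i1: "s1 ''i'' 0 = i"
      and fr: "\<And>x. x \<notin> insert ''i'' (writes sweep_slot) \<Longrightarrow> s1 x = ?s x"
    have sn: "s1 ''z'' 0 = z" "s1 ''nu'' 0 = \<nu>" "s1 ''k'' 0 = card X" "s1 ''seg'' = s ''seg''" "s1 ''lm'' = s ''lm''"
      using fr s by (simp_all add: sweep_slot_def)
    show "sweep_inv z X \<nu> (Suc i) ((run sweep_slot s1)(''i'' := (s1 ''i'')(0 := Suc i)))"
      by (rule sweep_slot_correct[OF I sn(1) i1 sn(2,3) _ _ nu X0]) (use X s sn i0 in \<open>simp_all add: zero_slots_def\<close>)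
  qed (use s in \<open>simp_all add: sweep_slot_def\<close>)
  then have "ends (Seq (For ''i'' (Const 0) ''z'' sweep_slot) close_arc) ?s ((11 + z * (max_cost sweep_slot + 12)) + max_cost close_arc)
    (\<lambda>s'. found z X \<nu> (s' ''fd'' 0) (s' ''fi'' 0) (s' ''la'' 0) \<and>
      (s' ''fd'' 0 = 0 \<longrightarrow> (\<forall>x\<in>X. x \<notin> shifted z X \<nu>) \<and> (\<forall>s e. \<not> heavy_arc z X \<nu> s e)))"
  proof (rule ends_SeqI[OF _ _ order_refl])
    fix s1 assume "sweep_inv z X \<nu> (?s ''z'' 0) s1"
    then have inv: "sweep_inv z X \<nu> z s1" using s by simp
    \<comment> \<open>The last arc ends at \<open>z\<close>, which is not a slot, and is closed
      after the loop.\<close>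
    note c = run_close_arc[OF z order_refl disjI1[OF refl] inv]
    have zX: "z \<notin> X" using Xz by auto
    have "(\<forall>x\<in>X. x \<notin> shifted z X \<nu>) \<and> (\<forall>s e. \<not> heavy_arc z X \<nu> s e)" if "run close_arc s1 ''fd'' 0 = 0"
    proof -
      have m: "missed z X \<nu> (Suc z)" using c(2)[OF that] zX by simp
      have "e \<le> z" if "heavy_arc z X \<nu> a e" for a e using that by (simp add: heavy_arc_def arc_def)
      then show ?thesis using m Xz unfolding missed_def by (metis le_imp_less_Suc lessThan_iff less_SucI subsetD)
    qed
    then show "ends close_arc s1 (max_cost close_arc) (\<lambda>s'. found z X \<nu> (s' ''fd'' 0) (s' ''fi'' 0) (s' ''la'' 0) \<and>
      (s' ''fd'' 0 = 0 \<longrightarrow> (\<forall>x\<in>X. x \<notin> shifted z X \<nu>) \<and> (\<forall>s e. \<not> heavy_arc z X \<nu> s e)))"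
      using c(1) by (intro ends_run) simp_all
  qed
  then have "ends sweep s (12 + ((11 + z * (max_cost sweep_slot + 12)) + max_cost close_arc))
    (\<lambda>s'. found z X \<nu> (s' ''fd'' 0) (s' ''fi'' 0) (s' ''la'' 0) \<and>
      (s' ''fd'' 0 = 0 \<longrightarrow> (\<forall>x\<in>X. x \<notin> shifted z X \<nu>) \<and> (\<forall>s e. \<not> heavy_arc z X \<nu> s e)))"
    unfolding sweep_def by (intro ends_Seq[of ?c0] ends_run[of ?c0]) simp_all
  then show ?thesis
  proof (rule ends_mono)
    have "23 + z * (max_cost sweep_slot + 12) \<le> (z + 1) * (max_cost sweep_slot + 40)" by (rule loop_time) simp_all
    moreover have "(z + 1) * (max_cost sweep_slot + 40) + max_cost close_arc \<le> (z + 1) * (max_cost sweep_slot + max_cost close_arc + 60)"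
      by (simp add: distrib_left)
    ultimately show "12 + ((11 + z * (max_cost sweep_slot + 12)) + max_cost close_arc) \<le> (z + 1) * (max_cost sweep_slot + max_cost close_arc + 60)"
      by linarith
  qed
qed

section \<open>One round of the refinement\<close>

definition choose_slot :: com where
  "choose_slot = Cond (Less (Cell ''lm'' (Cell ''seg'' (Var ''i''))) (Cell ''lm'' (Cell ''seg'' (Var ''r'')))) (Set ''r'' (Var ''i'')) Skip"

definition choose_cut :: com where
  "choose_cut = Seq (block [Set ''r'' (Var ''fi''), Set ''e'' (Plus (Var ''la'') (Const 1))])
     (For ''i'' (Var ''fi'') ''e'' choose_slot)"

lemma ends_choose_cut:
  assumes s: "s ''fi'' 0 \<le> s ''la'' 0" "s ''la'' 0 < z"
  shows "ends choose_cut s ((z + 1) * (max_cost choose_slot + 40))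
    (\<lambda>s'. s' ''r'' 0 \<in> {s ''fi'' 0..s ''la'' 0} \<and>
      (\<forall>i\<in>{s ''fi'' 0..s ''la'' 0}. s ''lm'' (s ''seg'' (s' ''r'' 0)) \<le> s ''lm'' (s ''seg'' i)))"
proof -
  let ?f = "s ''fi'' 0" and ?l = "s ''la'' 0" and ?v = "\<lambda>i. s ''lm'' (s ''seg'' i)"
  define I where "I i s' \<longleftrightarrow> s' ''r'' 0 \<in> {?f..?l} \<and> (\<forall>j\<in>{?f..<i}. ?v (s' ''r'' 0) \<le> ?v j)" for i and s' :: memory
  let ?c0 = "block [Set ''r'' (Var ''fi''), Set ''e'' (Plus (Var ''la'') (Const 1))]"
  let ?s = "run ?c0 s"
  have e: "?s ''e'' 0 = ?l + 1" by simp
  have "ends (For ''i'' (Var ''fi'') ''e'' choose_slot) ?s (12 + (?l + 1) * (max_cost choose_slot + 12)) (\<lambda>s'. I (?s ''e'' 0) s')"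
  proof (rule ends_For)
    show "I (aval (Var ''fi'') ?s) (?s(''i'' := (?s ''i'')(0 := aval (Var ''fi'') ?s)))" using s by (simp add: I_def)
    fix i s1 assume I: "I i s1" and i0: "aval (Var ''fi'') ?s \<le> i" "i < ?s ''e'' 0" and i1: "s1 ''i'' 0 = i"
      and fr: "\<And>x. x \<notin> insert ''i'' (writes choose_slot) \<Longrightarrow> s1 x = ?s x"
    have sn: "s1 ''lm'' = s ''lm''" "s1 ''seg'' = s ''seg''" using fr by (simp_all add: choose_slot_def)
    let ?s2 = "(run choose_slot s1)(''i'' := (s1 ''i'')(0 := Suc i))"
    have new: "?s2 ''r'' 0 = (if ?v i < ?v (s1 ''r'' 0) then i else s1 ''r'' 0)"
      using sn i1 by (simp add: choose_slot_def)
    have i: "?f \<le> i" "i \<le> ?l" using i0 by simp_all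
    have old: "?v (s1 ''r'' 0) \<le> ?v j" if "?f \<le> j" "j < i" for j using I that by (simp add: I_def)
    have "?v (?s2 ''r'' 0) \<le> ?v j" if "j \<in> {?f..<Suc i}" for j
      using that old[of j] unfolding new by (cases "j = i") auto
    then show "I (Suc i) ?s2" using I i unfolding I_def new by (simp split: if_splits)
  qed (use s in \<open>simp_all add: choose_slot_def\<close>)
  then have "ends choose_cut s (20 + (12 + (?l + 1) * (max_cost choose_slot + 12))) (\<lambda>s'. I (?s ''e'' 0) s')"
    unfolding choose_cut_def by (intro ends_Seq[of ?c0] ends_run[of ?c0]) simp_all
  then show ?thesis
  proof (rule ends_mono)
    show "20 + (12 + (?l + 1) * (max_cost choose_slot + 12)) \<le> (z + 1) * (max_cost choose_slot + 40)"
      using loop_time[of "?l + 1" z 32] s by simp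
  qed (auto simp: I_def)
qed

definition recolor_slot :: com where
  "recolor_slot = block
    [Set ''j'' (Plus (Var ''r'') (Var ''i'')), wrap,
     Cond (Less (Var ''i'') (Var ''nu'')) (Store ''col'' (Cell ''seg'' (Var ''j'')) (Var ''c''))
       (Store ''col'' (Cell ''seg'' (Var ''j'')) (Minus (Const 1) (Var ''c'')))]"

definition recolor :: com where
  "recolor = For ''i'' (Const 0) ''z'' recolor_slot"

lemma ends_recolor:
  assumes s: "s ''z'' 0 = z" "s ''r'' 0 = r" "r < z" and inj: "inj_on (s ''seg'') {..<z}"
  shows "ends recolor s ((z + 1) * (max_cost recolor_slot + 40))
    (\<lambda>s'. recolored (s ''seg'') z r (s ''nu'' 0) (s ''c'' 0) (s ''col'') (s' ''col''))"
proof -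
  let ?w = "s ''seg''" and ?v = "\<lambda>i. if i < s ''nu'' 0 then s ''c'' 0 else 1 - s ''c'' 0"
  define I where "I i s' \<longleftrightarrow> (\<forall>l<i. s' ''col'' (?w ((r + l) mod z)) = ?v l) \<and>
    (\<forall>p. p \<notin> ?w ` {..<z} \<longrightarrow> s' ''col'' p = s ''col'' p)" for i and s' :: memory
  have "ends recolor s (11 + z * (max_cost recolor_slot + 12)) (\<lambda>s'. I (s ''z'' 0) s')"
    unfolding recolor_def
  proof (rule ends_For)
    show "I (aval (Const 0) s) (s(''i'' := (s ''i'')(0 := aval (Const 0) s)))" by (simp add: I_def)
    fix i s1 assume I: "I i s1" and i0: "i < s ''z'' 0" and i1: "s1 ''i'' 0 = i"
      and fr: "\<And>x. x \<notin> insert ''i'' (writes recolor_slot) \<Longrightarrow> s1 x = s x"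
    have i: "i < z" using i0 s by simp
    have sn: "s1 ''z'' 0 = z" "s1 ''r'' 0 = r" "s1 ''nu'' = s ''nu''" "s1 ''c'' = s ''c''" "s1 ''seg'' = ?w"
      using fr s by (simp_all add: recolor_slot_def)
    have w: "run wrap (s1(''j'' := (s1 ''j'')(0 := r + i))) = s1(''j'' := (s1 ''j'')(0 := (r + i) mod z))"
      using run_wrap[of "s1(''j'' := (s1 ''j'')(0 := r + i))"] sn i s(3) by simp
    let ?s2 = "(run recolor_slot s1)(''i'' := (s1 ''i'')(0 := Suc i))"
    have new: "?s2 ''col'' = (s1 ''col'')(?w ((r + i) mod z) := ?v i)"
      using sn i1 w by (simp add: recolor_slot_def)
    have ne: "?w ((r + l) mod z) \<noteq> ?w ((r + i) mod z)" if "l < i" for l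
    proof
      assume "?w ((r + l) mod z) = ?w ((r + i) mod z)"
      then have "(l + r) mod z = (i + r) mod z" using inj_onD[OF inj, of "(r + l) mod z" "(r + i) mod z"] i
        by (simp add: add.commute)
      then show False using inj_onD[OF bij_betw_imp_inj_on[OF bij_betw_add_mod[of z r]], of l i] i that by simp
    qed
    have "?w ((r + i) mod z) \<in> ?w ` {..<z}" using i by simp
    then have out: "p \<noteq> ?w ((r + i) mod z)" if "p \<notin> ?w ` {..<z}" for p using that by metis
    show "I (Suc i) ?s2"
      unfolding I_def new
    proof (intro conjI allI impI)
      fix l assume "l < Suc i"
      then show "((s1 ''col'')(?w ((r + i) mod z) := ?v i)) (?w ((r + l) mod z)) = ?v l"
        using I ne[of l] unfolding I_def by (cases "l = i") auto
    next
      fix p assume "p \<notin> ?w ` {..<z}"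
      then show "((s1 ''col'')(?w ((r + i) mod z) := ?v i)) p = s ''col'' p"
        using I out[of p] unfolding I_def by simp
    qed
  qed (use s in \<open>simp_all add: recolor_slot_def\<close>)
  then show ?thesis
    by (rule ends_mono) (rule loop_time, use s in \<open>auto simp: I_def recolored_def\<close>)
qed

text \<open>The index is reduced twice because \<open>fi + nu + i\<close> can exceed
  \<open>2 * z\<close>.\<close>

definition copy_slot :: com where
  "copy_slot = block
    [Set ''j'' (Plus (Var ''fi'') (Var ''nu'')), wrap, Set ''j'' (Plus (Var ''j'') (Var ''i'')), wrap,
     Store ''tmp'' (Var ''i'') (Cell ''seg'' (Var ''j''))]"

definition back_slot :: com where
  "back_slot = Store ''seg'' (Var ''i'') (Cell ''tmp'' (Var ''i''))"

text \<open>The copy goes through \<open>tmp\<close>, since source and target in \<open>seg\<close>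
  may overlap.\<close>

definition shrink :: com where
  "shrink = Seq (Set ''e'' (Plus (Minus (Var ''la'') (Var ''fi'')) (Const 1)))
     (Seq (For ''i'' (Const 0) ''e'' copy_slot) (Seq (For ''i'' (Const 0) ''e'' back_slot) (Set ''z'' (Var ''e''))))"

lemma ends_shrink:
  assumes s: "s ''z'' 0 = z" "s ''fi'' 0 \<le> s ''la'' 0" "s ''la'' 0 < z" "s ''nu'' 0 \<le> z"
  shows "ends shrink s ((z + 1) * (max_cost copy_slot + max_cost back_slot + 120))
    (\<lambda>s'. s' ''z'' 0 = s ''la'' 0 - s ''fi'' 0 + 1 \<and>
      (\<forall>i<s ''la'' 0 - s ''fi'' 0 + 1. s' ''seg'' i = s ''seg'' ((s ''fi'' 0 + s ''nu'' 0 + i) mod z)))"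
proof -
  let ?f = "s ''fi'' 0" and ?l = "s ''la'' 0" and ?n = "s ''nu'' 0" and ?w = "s ''seg''"
  let ?e = "?l - ?f + 1" and ?c0 = "Set ''e'' (Plus (Minus (Var ''la'') (Var ''fi'')) (Const 1))"
  let ?s = "run ?c0 s"
  have e: "?s ''e'' 0 = ?e" "?e \<le> z" using s by simp_all
  define I where "I i s' \<longleftrightarrow> (\<forall>l<i. s' ''tmp'' l = ?w ((?f + ?n + l) mod z))" for i and s' :: memory
  have 1: "ends (For ''i'' (Const 0) ''e'' copy_slot) ?s (11 + ?e * (max_cost copy_slot + 12)) (\<lambda>s'. I (?s ''e'' 0) s')"
  proof (rule ends_For)
    fix i s1 assume I: "I i s1" and i0: "i < ?s ''e'' 0" and i1: "s1 ''i'' 0 = i"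
      and fr: "\<And>x. x \<notin> insert ''i'' (writes copy_slot) \<Longrightarrow> s1 x = ?s x"
    have i: "i < z" using i0 s by simp
    have sn: "s1 ''z'' 0 = z" "s1 ''fi'' 0 = ?f" "s1 ''nu'' 0 = ?n" "s1 ''seg'' = ?w"
      using fr s by (simp_all add: copy_slot_def)
    let ?a = "(?f + ?n) mod z"
    have az: "?a < z" using i by simp
    have w1: "run wrap (s1(''j'' := (s1 ''j'')(0 := ?f + ?n))) = s1(''j'' := (s1 ''j'')(0 := ?a))"
      using run_wrap[of "s1(''j'' := (s1 ''j'')(0 := ?f + ?n))"] sn s by simp
    have w2: "run wrap (s1(''j'' := (s1 ''j'')(0 := ?a + i))) = s1(''j'' := (s1 ''j'')(0 := (?f + ?n + i) mod z))"
      using run_wrap[of "s1(''j'' := (s1 ''j'')(0 := ?a + i))"] sn i az by (simp add: mod_add_left_eq)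
    let ?s2 = "(run copy_slot s1)(''i'' := (s1 ''i'')(0 := Suc i))"
    have "?s2 ''tmp'' = (s1 ''tmp'')(i := ?w ((?f + ?n + i) mod z))"
      using sn i1 w1 w2 by (simp add: copy_slot_def)
    then show "I (Suc i) ?s2" using I unfolding I_def by (simp add: less_Suc_eq)
  qed (use e in \<open>simp_all add: copy_slot_def I_def\<close>)
  have 2: "ends (For ''i'' (Const 0) ''e'' back_slot) s1 (11 + ?e * (max_cost back_slot + 12))
      (\<lambda>s'. \<forall>l<?e. s' ''seg'' l = ?w ((?f + ?n + l) mod z))"
    if I1: "I ?e s1" and e1: "s1 ''e'' 0 = ?e" for s1
  proof -
    define K where "K i s' \<longleftrightarrow> (\<forall>l<i. s' ''seg'' l = ?w ((?f + ?n + l) mod z))" for i and s' :: memory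
    have "ends (For ''i'' (Const 0) ''e'' back_slot) s1 (11 + ?e * (max_cost back_slot + 12)) (\<lambda>s'. K (s1 ''e'' 0) s')"
    proof (rule ends_For)
      fix i s2 assume K: "K i s2" and i0: "i < s1 ''e'' 0" and i1: "s2 ''i'' 0 = i"
        and fr: "\<And>x. x \<notin> insert ''i'' (writes back_slot) \<Longrightarrow> s2 x = s1 x"
      have "s2 ''tmp'' = s1 ''tmp''" using fr by (simp add: back_slot_def)
      moreover have "s1 ''tmp'' i = ?w ((?f + ?n + i) mod z)" using I1 i0 unfolding e1 I_def by blast
      ultimately show "K (Suc i) ((run back_slot s2)(''i'' := (s2 ''i'')(0 := Suc i)))"
        using K i1 unfolding K_def by (simp add: back_slot_def less_Suc_eq)
    qed (use e1 in \<open>simp_all add: back_slot_def K_def\<close>)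
    then show ?thesis unfolding e1 K_def .
  qed
  let ?Q = "\<lambda>s'. s' ''z'' 0 = ?e \<and> (\<forall>i<?e. s' ''seg'' i = ?w ((?f + ?n + i) mod z))"
  have "ends (Seq (For ''i'' (Const 0) ''e'' copy_slot) (Seq (For ''i'' (Const 0) ''e'' back_slot) (Set ''z'' (Var ''e'')))) ?s
    ((11 + ?e * (max_cost copy_slot + 12)) + ((11 + ?e * (max_cost back_slot + 12)) + 5)) ?Q"
  proof (rule ends_SeqI[OF 1 _ order_refl])
    fix s1 assume fr1: "\<And>x. x \<notin> writes (For ''i'' (Const 0) ''e'' copy_slot) \<Longrightarrow> s1 x = ?s x" and q1: "I (?s ''e'' 0) s1"
    have e1: "s1 ''e'' 0 = ?e" using fr1[of "''e''"] e by (simp add: copy_slot_def)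
    have q1': "I ?e s1" using q1 e by simp
    show "ends (Seq (For ''i'' (Const 0) ''e'' back_slot) (Set ''z'' (Var ''e''))) s1 ((11 + ?e * (max_cost back_slot + 12)) + 5) ?Q"
    proof (rule ends_SeqI[OF 2[OF q1' e1] _ order_refl])
      fix s2 assume fr2: "\<And>x. x \<notin> writes (For ''i'' (Const 0) ''e'' back_slot) \<Longrightarrow> s2 x = s1 x"
        and q2: "\<forall>l<?e. s2 ''seg'' l = ?w ((?f + ?n + l) mod z)"
      have "s2 ''e'' 0 = ?e" using fr2[of "''e''"] e1 by (simp add: back_slot_def)
      then show "ends (Set ''z'' (Var ''e'')) s2 5 ?Q" using q2 by (intro ends_run) simp_all
    qed
  qed
  then have "ends shrink s (9 + ((11 + ?e * (max_cost copy_slot + 12)) + ((11 + ?e * (max_cost back_slot + 12)) + 5))) ?Q"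
    unfolding shrink_def by (intro ends_Seq[of ?c0] ends_run[of ?c0]) simp_all
  then show ?thesis
  proof (rule ends_mono)
    have "20 + ?e * (max_cost copy_slot + 12) \<le> (z + 1) * (max_cost copy_slot + 40)"
      "16 + ?e * (max_cost back_slot + 12) \<le> (z + 1) * (max_cost back_slot + 40)"
      by (rule loop_time; use e in simp)+
    moreover have "(z + 1) * (max_cost copy_slot + max_cost back_slot + 120)
      = (z + 1) * (max_cost copy_slot + 40) + (z + 1) * (max_cost back_slot + 40) + (z + 1) * 40" by (simp add: distrib_left)
    ultimately show "9 + ((11 + ?e * (max_cost copy_slot + 12)) + ((11 + ?e * (max_cost back_slot + 12)) + 5))
      \<le> (z + 1) * (max_cost copy_slot + max_cost back_slot + 120)" by linarith
  qed
qed

section \<open>Trying both shifts\<close>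

definition find_cut :: com where
  "find_cut = Seq (block [Set ''nu'' (Var ''m''), Set ''c'' (Const 1)])
     (Seq sweep (Cond (Less (Const 0) (Var ''fd'')) Skip
       (Seq (block [Set ''nu'' (Minus (Var ''z'') (Var ''m'')), Set ''c'' (Const 0)]) sweep)))"

abbreviation "sweep_cost \<equiv> max_cost sweep_slot + max_cost close_arc + 60"

lemma writes_sweep [simp]: "writes sweep = {''acc'', ''aq'', ''fd'', ''fi'', ''la'', ''i'', ''j'', ''tf'', ''facc'', ''tl'', ''lacc''}"
  by (auto simp: sweep_def sweep_slot_def)

text \<open>If the sweep with shift \<open>m\<close> fails, there are neither hits nor heavy arcs
  for \<open>m\<close>, and \<open>heavy_arc_exists\<close> guarantees that the sweep with shift
  \<open>z - m\<close> succeeds.\<close>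

lemma ends_find_cut:
  assumes s: "s ''z'' 0 = z" "s ''m'' 0 = m" "s ''k'' 0 = card X" and X: "X = zero_slots s" and z: "0 < z" and m: "m \<le> z" and X0: "0 \<in> X"
  shows "ends find_cut s ((z + 1) * (2 * sweep_cost + 40))
    (\<lambda>s'. s' ''fd'' 0 \<noteq> 0 \<and> found z X (s' ''nu'' 0) (s' ''fd'' 0) (s' ''fi'' 0) (s' ''la'' 0) \<and>
      (s' ''nu'' 0 = m \<and> s' ''c'' 0 = 1 \<or> s' ''nu'' 0 = z - m \<and> s' ''c'' 0 = 0))" (is "ends _ _ _ ?Q")
proof -
  let ?T = "(z + 1) * sweep_cost"
  let ?c0 = "block [Set ''nu'' (Var ''m''), Set ''c'' (Const 1)]" and ?c1 = "block [Set ''nu'' (Minus (Var ''z'') (Var ''m'')), Set ''c'' (Const 0)]"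
  let ?s = "run ?c0 s"
  have Xz: "X \<subseteq> {..<z}" using X s by (auto simp: zero_slots_def)
  have 1: "ends sweep ?s ?T (\<lambda>s'. found z X m (s' ''fd'' 0) (s' ''fi'' 0) (s' ''la'' 0) \<and>
      (s' ''fd'' 0 = 0 \<longrightarrow> (\<forall>x\<in>X. x \<notin> shifted z X m) \<and> (\<forall>s e. \<not> heavy_arc z X m s e)))"
    by (rule ends_sweep) (use s X z m X0 in \<open>simp_all add: zero_slots_def\<close>)
  have "ends (Seq sweep (Cond (Less (Const 0) (Var ''fd'')) Skip (Seq ?c1 sweep))) ?s (?T + (5 + (11 + ?T))) ?Q"
  proof (rule ends_SeqI[OF 1 _ order_refl])
    fix s1 assume fr0: "\<And>x. x \<notin> writes sweep \<Longrightarrow> s1 x = ?s x"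
      and q: "found z X m (s1 ''fd'' 0) (s1 ''fi'' 0) (s1 ''la'' 0) \<and>
      (s1 ''fd'' 0 = 0 \<longrightarrow> (\<forall>x\<in>X. x \<notin> shifted z X m) \<and> (\<forall>s e. \<not> heavy_arc z X m s e))"
    have fr: "s1 x = ?s x" if "x \<in> {''nu'', ''c'', ''z'', ''m'', ''k'', ''lm'', ''seg''}" for x
      using fr0[of x] that by auto
    have "ends (Cond (Less (Const 0) (Var ''fd'')) Skip (Seq ?c1 sweep)) s1 (1 + bcost (Less (Const 0) (Var ''fd'')) + (11 + ?T)) ?Q"
    proof (rule ends_CondI)
      assume "bval (Less (Const 0) (Var ''fd'')) s1"
      then have "?Q s1" using q fr s by simp
      then show "ends Skip s1 (11 + ?T) ?Q" by (intro ends_run) simp_all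
    next
      assume "\<not> bval (Less (Const 0) (Var ''fd'')) s1"
      then have nohit: "\<And>x. x \<in> X \<Longrightarrow> x \<notin> shifted z X m" and nog: "\<And>s e. \<not> heavy_arc z X m s e"
        using q by auto
      \<comment> \<open>A hit for the inverse shift becomes a hit for \<open>m\<close> after
        translation.\<close>
      have nohit': "x \<notin> shifted z X (z - m)" if x: "x \<in> X" for x
      proof
        assume "x \<in> shifted z X (z - m)"
        then have y: "(x + (z - m)) mod z \<in> X" and "x < z" by (auto simp: shifted_def)
        moreover have "((x + (z - m)) mod z + (z - (z - m))) mod z = x"
          by (rule add_mod_shift_inverse) (use \<open>x < z\<close> in auto)
        ultimately have "(x + (z - m)) mod z \<in> shifted z X m" using x m z by (simp add: shifted_def)
        then show False using nohit y by blast
      qed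
      let ?s1 = "run ?c1 s1"
      have "ends sweep ?s1 ?T (\<lambda>s'. found z X (z - m) (s' ''fd'' 0) (s' ''fi'' 0) (s' ''la'' 0) \<and>
        (s' ''fd'' 0 = 0 \<longrightarrow> (\<forall>x\<in>X. x \<notin> shifted z X (z - m)) \<and> (\<forall>s e. \<not> heavy_arc z X (z - m) s e)))"
        by (rule ends_sweep) (use s X z m X0 fr in \<open>simp_all add: zero_slots_def\<close>)
      then have "ends sweep ?s1 ?T ?Q"
      proof (rule ends_mono[OF _ order_refl])
        fix s2 assume fr2: "\<And>x. x \<notin> writes sweep \<Longrightarrow> s2 x = ?s1 x"
          and q2: "found z X (z - m) (s2 ''fd'' 0) (s2 ''fi'' 0) (s2 ''la'' 0) \<and>
            (s2 ''fd'' 0 = 0 \<longrightarrow> (\<forall>x\<in>X. x \<notin> shifted z X (z - m)) \<and> (\<forall>s e. \<not> heavy_arc z X (z - m) s e))"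
        have "s2 ''nu'' = ?s1 ''nu''" "s2 ''c'' = ?s1 ''c''" using fr2 by auto
        then have "s2 ''nu'' 0 = z - m" "s2 ''c'' 0 = 0" using fr s by simp_all
        moreover have "s2 ''fd'' 0 \<noteq> 0"
          using q2 heavy_arc_exists[OF z Xz X0 m nohit nohit'] nog by blast
        ultimately show "?Q s2" using q2 by simp
      qed
      then show "ends (Seq ?c1 sweep) s1 (11 + ?T) ?Q"
        by (intro ends_Seq[of ?c1] ends_run[of ?c1]) simp_all
    qed
    then show "ends (Cond (Less (Const 0) (Var ''fd'')) Skip (Seq ?c1 sweep)) s1 (5 + (11 + ?T)) ?Q"
      by simp
  qed
  then have "ends find_cut s (9 + (?T + (5 + (11 + ?T)))) ?Q"
    unfolding find_cut_def by (intro ends_Seq[of ?c0] ends_run[of ?c0]) simp_all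
  then show ?thesis by (rule ends_mono) (simp_all add: algebra_simps)
qed

definition round_body :: com where
  "round_body = Seq count_slots (Seq find_cut (Seq choose_cut (Seq recolor
     (Cond (Less (Const 1) (Var ''fd'')) (Set ''z'' (Const 0)) shrink))))"

abbreviation "round_cost \<equiv> max_cost count_slot + 2 * sweep_cost + max_cost choose_slot + max_cost recolor_slot +
   max_cost copy_slot + max_cost back_slot + 400"

section \<open>Correctness and total cost of the rounds\<close>

context cut_profile
begin

text \<open>\<open>Y\<close> is the total budget: the price of \<open>Q\<close> and the budget of
  the current segment together stay within \<open>D * Y\<close>. Length 0 signals that every colour
  change has been paid for.\<close>

definition round_inv :: "real \<Rightarrow> nat \<Rightarrow> memory \<Rightarrow> bool" where
  "round_inv Y N s \<longleftrightarrow> s ''lm'' = lm \<and> (\<forall>p<n. s ''col'' p \<le> 1) \<and> (\<Sum>p<n. s ''col'' p) = N \<and>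
     (if s ''z'' 0 = 0
      then \<exists>Q. finite Q \<and> (\<forall>p<n. s ''col'' p \<noteq> s ''col'' (prev p) \<longrightarrow> p \<in> Q) \<and> real (sum c Q) \<le> real D * Y
      else \<exists>Q. segment (s ''seg'') (s ''z'' 0) Q \<and> bounded_outside (s ''seg'') (s ''z'' 0) (s ''col'') Q \<and>
         real (sum c Q) \<le> real D * (Y - budget (real (s ''z'' 0) / card (zeros (s ''seg'') (s ''z'' 0)))))"

lemma ends_round_body:
  assumes inv: "round_inv Y N s" and z0: "0 < s ''z'' 0"
  shows "ends round_body s ((s ''z'' 0 + 1) * round_cost) (\<lambda>s'. round_inv Y N s' \<and> 2 * s' ''z'' 0 \<le> s ''z'' 0)"
    (is "ends _ _ _ ?R")
proof -
  define z where "z = s ''z'' 0"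
  define w where "w = s ''seg''"
  define X where "X = zeros w z"
  obtain Q where seg: "segment w z Q" and bd: "bounded_outside w z (s ''col'') Q"
    and G: "real (sum c Q) \<le> real D * (Y - budget (real z / card X))"
    using inv z0 unfolding round_inv_def z_def w_def X_def by auto
  have lms: "s ''lm'' = lm" and col1: "\<And>p. p < n \<Longrightarrow> s ''col'' p \<le> 1" and colN: "(\<Sum>p<n. s ''col'' p) = N"
    using inv by (auto simp: round_inv_def)
  have z: "0 < z" "z \<le> n" and inj: "inj_on w {..<z}" and wn: "\<And>i. i < z \<Longrightarrow> w i < n" and lm00: "lm (w 0) = 0"
    using seg by (auto simp: segment_def)
  have XX: "zero_slots t = X" if "t ''z'' 0 = z" "t ''lm'' = lm" "t ''seg'' = w" for t
    using that by (simp add: zero_slots_def X_def zeros_def)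
  have X0: "0 \<in> X" using z lm00 by (simp add: X_def zeros_def)
  define m where "m = (\<Sum>i<z. s ''col'' (w i))"
  have mz: "m \<le> z"
  proof -
    have "m \<le> (\<Sum>i<z. 1)" unfolding m_def by (rule sum_mono) (use col1 wn in auto)
    then show ?thesis by simp
  qed
  let ?T1 = "(z + 1) * (max_cost count_slot + 40)" and ?T2 = "(z + 1) * (2 * sweep_cost + 40)"
    and ?T3 = "(z + 1) * (max_cost choose_slot + 40)" and ?T4 = "(z + 1) * (max_cost recolor_slot + 40)"
    and ?T5 = "(z + 1) * (max_cost copy_slot + max_cost back_slot + 120)"
  have "ends round_body s (?T1 + (?T2 + (?T3 + (?T4 + (5 + ?T5))))) ?R"
    unfolding round_body_def
  proof (rule ends_SeqI[OF ends_count_slots[of s, folded z_def w_def] _ order_refl])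
    fix s1 assume fr1: "\<And>x. x \<notin> writes count_slots \<Longrightarrow> s1 x = s x"
      and q1: "s1 ''k'' 0 = card (zero_slots s) \<and> s1 ''m'' 0 = (\<Sum>i<z. s ''col'' (w i))"
    have c1: "s1 x = s x" if "x \<in> {''z'', ''seg'', ''lm'', ''col''}" for x
      using fr1[of x] that by (auto simp: count_slots_def count_slot_def)
    have v1: "s1 ''z'' 0 = z" "s1 ''seg'' = w" "s1 ''lm'' = lm" "s1 ''k'' 0 = card X" "s1 ''m'' 0 = m"
      using c1 lms q1 XX[of s] by (simp_all add: z_def w_def m_def)
    have x1: "X = zero_slots s1" using XX v1 by simp
    show "ends (Seq find_cut (Seq choose_cut (Seq recolor (Cond (Less (Const 1) (Var ''fd'')) (Set ''z'' (Const 0)) shrink))))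
        s1 (?T2 + (?T3 + (?T4 + (5 + ?T5)))) ?R"
    proof (rule ends_SeqI[OF ends_find_cut[OF v1(1,5,4) x1 z(1) mz X0] _ order_refl])
      fix s2 assume fr2: "\<And>x. x \<notin> writes find_cut \<Longrightarrow> s2 x = s1 x"
        and q2: "s2 ''fd'' 0 \<noteq> 0 \<and> found z X (s2 ''nu'' 0) (s2 ''fd'' 0) (s2 ''fi'' 0) (s2 ''la'' 0) \<and>
          (s2 ''nu'' 0 = m \<and> s2 ''c'' 0 = 1 \<or> s2 ''nu'' 0 = z - m \<and> s2 ''c'' 0 = 0)"
      define \<nu> where "\<nu> = s2 ''nu'' 0"
      define f where "f = s2 ''fi'' 0"
      define l where "l = s2 ''la'' 0"
      define cc where "cc = s2 ''c'' 0"
      have c2: "s2 x = s x" if "x \<in> {''z'', ''seg'', ''lm'', ''col''}" for x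
        using fr2[of x] c1[of x] that by (auto simp: find_cut_def)
      have nuz: "\<nu> \<le> z" using q2 mz by (auto simp: \<nu>_def)
      have cases: "s2 ''fd'' 0 = 1 \<and> heavy_run z X \<nu> f l \<or> s2 ''fd'' 0 = 2 \<and> l = f \<and> f \<in> X \<and> f \<in> shifted z X \<nu>"
        using q2 unfolding found_def \<nu>_def f_def l_def by argo
      have fl: "f \<le> l" "l < z"
      proof -
        have "f \<le> l \<and> l < z"
        proof (cases "s2 ''fd'' 0 = 1")
          case True
          then obtain a e where h: "heavy_arc z X \<nu> a e" "f = Min (shifted z X \<nu> \<inter> {a<..<e})" "l = Max (shifted z X \<nu> \<inter> {a<..<e})"
            using cases unfolding heavy_run_def by auto
          have ne: "shifted z X \<nu> \<inter> {a<..<e} \<noteq> {}" using h(1) unfolding heavy_arc_def Let_def by blast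
          have fin: "finite (shifted z X \<nu> \<inter> {a<..<e})" by simp
          have "l \<in> shifted z X \<nu> \<inter> {a<..<e}" unfolding h(3) by (rule Max_in[OF fin ne])
          then show ?thesis unfolding h(2) using Min_le[OF fin] by (auto simp: shifted_def)
        next
          case False
          then show ?thesis using cases by (auto simp: X_def zeros_def)
        qed
        then show "f \<le> l" "l < z" by auto
      qed
      show "ends (Seq choose_cut (Seq recolor (Cond (Less (Const 1) (Var ''fd'')) (Set ''z'' (Const 0)) shrink))) s2
         (?T3 + (?T4 + (5 + ?T5))) ?R"
      proof (rule ends_SeqI[OF ends_choose_cut[of s2 z] _ order_refl])
        show "s2 ''fi'' 0 \<le> s2 ''la'' 0" "s2 ''la'' 0 < z" using fl by (simp_all add: f_def l_def)
        fix s3 assume fr3: "\<And>x. x \<notin> writes choose_cut \<Longrightarrow> s3 x = s2 x"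
          and q3: "s3 ''r'' 0 \<in> {s2 ''fi'' 0..s2 ''la'' 0} \<and>
             (\<forall>i\<in>{s2 ''fi'' 0..s2 ''la'' 0}. s2 ''lm'' (s2 ''seg'' (s3 ''r'' 0)) \<le> s2 ''lm'' (s2 ''seg'' i))"
        define r where "r = s3 ''r'' 0"
        have r: "r \<in> {f..l}" "\<And>i. i \<in> {f..l} \<Longrightarrow> lm (w r) \<le> lm (w i)"
          using q3 c2 lms by (simp_all add: r_def f_def l_def w_def)
        have c32: "s3 x = s2 x" if "x \<in> {''z'', ''seg'', ''lm'', ''col'', ''fd'', ''fi'', ''la'', ''nu'', ''c''}" for x
          using fr3[of x] that by (auto simp: choose_cut_def choose_slot_def)
        have rz: "r < z" using r fl by simp
        have v3: "s3 ''z'' 0 = z" "s3 ''seg'' = w" using c32 c2 by (simp_all add: z_def w_def)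
        show "ends (Seq recolor (Cond (Less (Const 1) (Var ''fd'')) (Set ''z'' (Const 0)) shrink)) s3 (?T4 + (5 + ?T5)) ?R"
        proof (rule ends_SeqI[OF ends_recolor[of s3 z r] _ order_refl])
          show "s3 ''z'' 0 = z" "s3 ''r'' 0 = r" "r < z" "inj_on (s3 ''seg'') {..<z}"
            using v3 rz inj by (simp_all add: r_def)
          fix s4 assume fr4: "\<And>x. x \<notin> writes recolor \<Longrightarrow> s4 x = s3 x"
            and q4: "recolored (s3 ''seg'') z r (s3 ''nu'' 0) (s3 ''c'' 0) (s3 ''col'') (s4 ''col'')"
          have c4: "s4 x = s2 x" if "x \<in> {''z'', ''seg'', ''lm'', ''fd'', ''fi'', ''la'', ''nu'', ''c''}" for x
            using fr4[of x] c32[of x] that by (auto simp: recolor_def recolor_slot_def)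
          have rec: "recolored w z r \<nu> cc (s ''col'') (s4 ''col'')"
            using q4 v3 c32 c2 by (simp add: \<nu>_def cc_def)
          have cc1: "cc \<le> 1" using q2 by (auto simp: cc_def)
          have sum4: "(\<Sum>p<n. s4 ''col'' p) = N"
            using sum_recolored[OF rec z inj wn m_def mz] q2 colN by (simp add: \<nu>_def cc_def)
          have col4: "s4 ''col'' p \<le> 1" if p: "p < n" for p
          proof (cases "p \<in> w ` {..<z}")
            case True
            then obtain i where i: "i < z" "p = w i" by auto
            define j where "j = (i + (z - r)) mod z"
            have "(r + j) mod z = i" using add_mod_shift_inverse[of i z "z - r"] i rz by (simp add: j_def add.commute)
            moreover have "j < z" using i by (simp add: j_def)
            ultimately have "s4 ''col'' p = (if j < \<nu> then cc else 1 - cc)" using rec i unfolding recolored_def by metis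
            then show ?thesis using cc1 by simp
          next
            case False
            then show ?thesis using rec col1[OF p] unfolding recolored_def by simp
          qed
          have lm4: "s4 ''lm'' = lm" using c4 c2 lms by simp
          have "ends (Cond (Less (Const 1) (Var ''fd'')) (Set ''z'' (Const 0)) shrink) s4 (1 + bcost (Less (Const 1) (Var ''fd'')) + ?T5) ?R"
          proof (rule ends_CondI)
            assume "bval (Less (Const 1) (Var ''fd'')) s4"
            then have "s2 ''fd'' 0 \<noteq> 1" using c4 by simp
            then have hit: "l = f" "f \<in> X" "f \<in> shifted z X \<nu>" using cases by auto
            then have rf: "r = f" using r by simp
            have "r \<in> zeros w z" "(r + \<nu>) mod z \<in> zeros w z" using hit rf by (auto simp: X_def shifted_def)
            then obtain Q' where Q': "finite Q'" "\<forall>p<n. s4 ''col'' p \<noteq> s4 ''col'' (prev p) \<longrightarrow> p \<in> Q'" "sum c Q' \<le> sum c Q + 2 * D"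
              using recolor_hit[OF seg bd rec _ _ nuz] by blast
            \<comment> \<open>The two cuts of a hit are affordable at any density.\<close>
            have "2 \<le> budget (real z / card X)" by (simp add: budget_def)
            then have "real D * 2 \<le> real D * budget (real z / card X)" by (intro mult_left_mono) auto
            moreover have "real (sum c Q') \<le> real (sum c Q) + 2 * D" using Q'(3) by (metis of_nat_add of_nat_le_iff of_nat_mult of_nat_numeral)
            ultimately have "real (sum c Q') \<le> real D * Y" using G by (simp add: right_diff_distrib)
            then show "ends (Set ''z'' (Const 0)) s4 ?T5 ?R"
              using Q' sum4 col4 lm4 unfolding round_inv_def by (intro ends_run) auto
          next
            assume "\<not> bval (Less (Const 1) (Var ''fd'')) s4"
            then have "s2 ''fd'' 0 \<noteq> 2" using c4 by simp
            then have "heavy_run z X \<nu> f l" using cases by auto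
            then obtain a e where h: "heavy_arc z X \<nu> a e" "f = Min (shifted z X \<nu> \<inter> {a<..<e})" "l = Max (shifted z X \<nu> \<inter> {a<..<e})"
              unfolding heavy_run_def by blast
            have v4: "s4 ''z'' 0 = z" "s4 ''fi'' 0 = f" "s4 ''la'' 0 = l" "s4 ''nu'' 0 = \<nu>" "s4 ''seg'' = w"
              using c4 c2 by (simp_all add: z_def w_def f_def l_def \<nu>_def)
            have "ends shrink s4 ?T5 (\<lambda>s'. s' ''z'' 0 = l - f + 1 \<and> (\<forall>i<l - f + 1. s' ''seg'' i = w ((f + \<nu> + i) mod z)))"
              using ends_shrink[of s4 z] v4 fl nuz by simp
            then show "ends shrink s4 ?T5 ?R"
            proof (rule ends_mono[OF _ order_refl])
              fix s5 assume fr5: "\<And>x. x \<notin> writes shrink \<Longrightarrow> s5 x = s4 x"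
                and q5: "s5 ''z'' 0 = l - f + 1 \<and> (\<forall>i<l - f + 1. s5 ''seg'' i = w ((f + \<nu> + i) mod z))"
              have c5: "s5 ''lm'' = lm" "s5 ''col'' = s4 ''col''" using fr5 lm4 by (simp_all add: shrink_def copy_slot_def back_slot_def)
              have q5': "s5 ''seg'' j = w ((f + \<nu> + j) mod z)" if "j < l - f + 1" for j using q5 that by blast
              note run = recolor_run[OF seg bd rec nuz h(1)[unfolded X_def] refl h(2)[unfolded X_def] h(3)[unfolded X_def] r q5' G[unfolded X_def]]
              show "?R s5" unfolding round_inv_def c5
                using run q5 sum4 col4 by (auto simp: z_def[symmetric])
            qed
          qed
          then show "ends (Cond (Less (Const 1) (Var ''fd'')) (Set ''z'' (Const 0)) shrink) s4 (5 + ?T5) ?R" by simp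
        qed
      qed
    qed
  qed
  then show ?thesis unfolding z_def[symmetric]
    by (rule ends_mono) (simp_all add: algebra_simps)
qed

text \<open>The potential is proportional to \<open>z\<close>. A round costs at most
  \<open>2 * z * round_cost\<close>, and since \<open>z\<close> at least halves, half of the
  potential is released to pay for it.\<close>

lemma ends_rounds:
  assumes inv: "round_inv Y N s"
  shows "ends (While (Less (Const 0) (Var ''z'')) round_body) s (s ''z'' 0 * (4 * round_cost + 20) + 6)
    (\<lambda>s'. (\<forall>p<n. s' ''col'' p \<le> 1) \<and> (\<Sum>p<n. s' ''col'' p) = N \<and>
      (\<exists>Q. finite Q \<and> (\<forall>p<n. s' ''col'' p \<noteq> s' ''col'' (prev p) \<longrightarrow> p \<in> Q) \<and> real (sum c Q) \<le> real D * Y))"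
proof -
  let ?b = "Less (Const 0) (Var ''z'')"
  have "ends (While ?b round_body) s (s ''z'' 0 * (4 * round_cost + 20) + 1 + bcost ?b) (\<lambda>s'. round_inv Y N s' \<and> \<not> bval ?b s')"
  proof (rule ends_While[where \<Phi> = "\<lambda>s. s ''z'' 0 * (4 * round_cost + 20)"])
    fix s1 assume i: "round_inv Y N s1" and b: "bval ?b s1"
    let ?z = "s1 ''z'' 0"
    have z: "0 < ?z" using b by simp
    have "ends round_body s1 ((?z + 1) * round_cost) (\<lambda>s'. round_inv Y N s' \<and>
      1 + bcost ?b + (?z + 1) * round_cost + s' ''z'' 0 * (4 * round_cost + 20) \<le> ?z * (4 * round_cost + 20))"
    proof (rule ends_mono[OF ends_round_body[OF i z] order_refl])
      fix s2 assume q: "round_inv Y N s2 \<and> 2 * s2 ''z'' 0 \<le> ?z"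
      have "s2 ''z'' 0 * (4 * round_cost + 20) = (2 * s2 ''z'' 0) * (2 * round_cost + 10)" by (simp add: algebra_simps)
      also have "\<dots> \<le> ?z * (2 * round_cost + 10)" using q by (intro mult_le_mono1) simp
      finally have 1: "s2 ''z'' 0 * (4 * round_cost + 20) \<le> ?z * (2 * round_cost + 10)" .
      have "(?z + 1) * round_cost \<le> (?z * 2) * round_cost" using z by (intro mult_le_mono1) simp
      then have 2: "(?z + 1) * round_cost + 10 \<le> ?z * (2 * round_cost + 10)" using z by (simp only: distrib_left mult.assoc)
      have 3: "?z * (4 * round_cost + 20) = ?z * (2 * round_cost + 10) + ?z * (2 * round_cost + 10)" by (simp add: algebra_simps)
      have "bcost ?b = 4" by simp
      then show "round_inv Y N s2 \<and> 1 + bcost ?b + (?z + 1) * round_cost + s2 ''z'' 0 * (4 * round_cost + 20) \<le> ?z * (4 * round_cost + 20)"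
        using q 1 2 3 by linarith
    qed
    then show "\<exists>T. ends round_body s1 T (\<lambda>s'. round_inv Y N s' \<and>
      1 + bcost ?b + T + s' ''z'' 0 * (4 * round_cost + 20) \<le> ?z * (4 * round_cost + 20))" by blast
  qed (rule inv)
  then show ?thesis
  proof (rule ends_mono)
    fix s' assume "round_inv Y N s' \<and> \<not> bval ?b s'"
    then have "round_inv Y N s'" "s' ''z'' 0 = 0" by simp_all
    then show "(\<forall>p<n. s' ''col'' p \<le> 1) \<and> (\<Sum>p<n. s' ''col'' p) = N \<and>
      (\<exists>Q. finite Q \<and> (\<forall>p<n. s' ''col'' p \<noteq> s' ''col'' (prev p) \<longrightarrow> p \<in> Q) \<and> real (sum c Q) \<le> real D * Y)"
      unfolding round_inv_def by presburger
  qed simp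
qed

end

section \<open>The bisection program\<close>

lemma (in tree_layout) cut_profile_layout:
  assumes D: "\<And>u. u < n \<Longrightarrow> card (ch u) + (if u = 0 then 0 else 1) \<le> D"
    and lm: "\<And>v. v < n \<Longrightarrow> lm (pos v) = lam v"
  shows "cut_profile n lm (\<lambda>p. card (crossing p)) D"
proof
  show "0 < n" by (rule n_pos)
  show "lm 0 = 0" using lm[OF n_pos] pos_root lam_root by simp
  show "card (crossing 0) = 0" by simp
  show "card (crossing p) \<le> max 1 (lm p) * D" if "p < n" for p
    using vertex_at[OF that] crossing_pos_le_lam[OF D] lm by metis
  show "card (crossing ((p + 1) mod n)) \<le> D" if p: "p < n" "lm p = 0" for p
  \<comment> \<open>After the last position comes position 0, where nothing crosses.\<close>
  proof (cases "p + 1 = n")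
    case False
    obtain v where v: "v < n" "pos v = p" using vertex_at[OF p(1)] by blast
    then have "lam v = 0" using lm[OF v(1)] p by simp
    moreover have "(p + 1) mod n = Suc (pos v)" using p v False by simp
    ultimately show ?thesis using crossing_after_path_le[OF D v(1)] by metis
  qed simp
  fix x i i' e
  assume x: "x < n" "lm x = 0" and ii: "x < i" "i \<le> i'" "i' < e" "e \<le> n"
    and noX: "\<And>p. x < p \<Longrightarrow> p < e \<Longrightarrow> lm p \<noteq> 0" and e: "e = n \<or> lm e = 0"
  obtain v where v: "v < n" "pos v = x" using vertex_at[OF x(1)] by blast
  have "\<exists>u<n. pos u \<in> {i..i'} \<and> 2 ^ lam u * (i' - i + 1) \<le> 4 * (e - pos v)"
  proof (rule exists_small_lam_arc)
    show "lam v = 0" using lm[OF v(1)] v x by simp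
    show "lam u \<noteq> 0" if "u < n" "pos v < pos u" "pos u < e" for u using noX[of "pos u"] lm[of u] that v by simp
    show "lam u = 0" if "u < n" "pos u = e" for u using e lm[of u] pos_less[of u] that by auto
  qed (use v ii in auto)
  then show "\<exists>p\<in>{i..i'}. 2 ^ lm p * (i' - i + 1) \<le> 4 * (e - x)"
    using lm v by metis
qed

text \<open>A vertex with \<open>lam u \<noteq> 0\<close> is not in \<open>C\<close>, so marking has
  left its \<open>sp\<close> alone and its last child is still the heaviest. On \<open>C\<close> the
  marked child comes last, which keeps \<open>lam\<close> at 0 along the path.\<close>

lemma tree_layout_intro:
  assumes n: "0 < n" and P: "\<And>j. 0 < j \<Longrightarrow> j < n \<Longrightarrow> P j < j" and sized: "sized n P 1 sz sp0"
    and C: "C \<subseteq> {..<n}" "\<And>v. v \<in> C - {0} \<Longrightarrow> P v \<in> C \<and> sp (P v) = v"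
    and sp: "\<And>u. sp u = sp0 u \<or> u \<in> C \<and> 0 < sp u \<and> sp u < n \<and> P (sp u) = u"
    and placed: "placed n P sz sp pos lam n"
  shows "tree_layout n P sz sp pos lam" "v \<in> C \<Longrightarrow> lam v = 0"
proof -
  have pl0: "pos 0 = 0" "lam 0 = 0"
    and pl: "\<And>j. 0 < j \<Longrightarrow> j < n \<Longrightarrow> sp (P j) = j \<Longrightarrow> pos j = pos (P j) + sz (P j) - sz j \<and> lam j = lam (P j)"
      "\<And>j. 0 < j \<Longrightarrow> j < n \<Longrightarrow> sp (P j) \<noteq> j \<Longrightarrow> lam j = lam (P j) + 1 \<and>
        pos j = pos (P j) + 1 + (\<Sum>l\<in>{l. 0 < l \<and> l < j \<and> P l = P j \<and> l \<noteq> sp (P j)}. sz l + 1)"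
    using placed unfolding placed_def by blast+
  have C0: "lam v = 0" if "v \<in> C" for v
    using that
  proof (induction v rule: less_induct)
    case (less v)
    show ?case
    proof (cases "v = 0")
      case False
      then have "P v \<in> C" "sp (P v) = v" "0 < v" "v < n" using C less.prems by auto
      then show ?thesis using less.IH[of "P v"] P[of v] pl(1)[of v] by simp
    qed (use pl0 in simp)
  qed
  have ch: "children n P u = {j. 1 \<le> j \<and> j < n \<and> P j = u}" for u by (auto simp: children_def)
  have S: "sz u = (\<Sum>j\<in>children n P u. sz j + 1)" "children n P u \<noteq> {} \<Longrightarrow> sp0 u \<in> children n P u"
    "\<And>j. j \<in> children n P u \<Longrightarrow> sz j \<le> sz (sp0 u)" for u
    using spec[OF sized[unfolded sized_def Let_def], of u] unfolding ch[of u] by (argo, argo, blast)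
  show "lam v = 0" if "v \<in> C" using C0 that .
  show "tree_layout n P sz sp pos lam"
  proof
    fix u assume "u < n" and ne: "children n P u \<noteq> {}"
    show "sp u \<in> children n P u" using sp[of u] S(2)[OF ne] by (auto simp: children_def)
  next
    fix u j assume "u < n" "lam u \<noteq> 0" and j: "j \<in> children n P u"
    then have "sp u = sp0 u" using sp[of u] C0 by auto
    then show "sz j \<le> sz (sp u)" using S(3)[OF j] by simp
  next
    fix u j assume j: "j \<in> children n P u" "sp u = j"
    then show "pos j = pos u + sz u - sz j" "lam j = lam u" using pl(1)[of j] by (auto simp: children_def)
  next
    fix u j assume j: "j \<in> children n P u" "sp u \<noteq> j"
    then have "0 < j" "j < n" "P j = u" by (auto simp: children_def)
    moreover from this have "{l. 0 < l \<and> l < j \<and> P l = P j \<and> l \<noteq> sp (P j)} = {l \<in> children n P u. l < j \<and> l \<noteq> sp u}"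
      by (auto simp: children_def)
    ultimately show "pos j = pos u + 1 + (\<Sum>l\<in>{l \<in> children n P u. l < j \<and> l \<noteq> sp u}. sz l + 1)" "lam j = lam u + 1"
      using pl(2)[of j] j(2) by auto
  qed (rule n P S(1) pl0; assumption)+
qed

definition layout :: com where
  "layout = Seq add_sizes (Seq mark_paths (Seq place_all init_slots))"

definition layout_cost :: nat where
  "layout_cost = max_cost add_size + max_cost mark_path + max_cost place + max_cost init_slot + 160"

definition laid_out :: "nat \<Rightarrow> memory \<Rightarrow> bool" where
  "laid_out n s \<longleftrightarrow> (\<exists>sz sp lam. tree_layout n (s ''P'') sz sp (s ''pos'') lam \<and>
     s ''dep'' (s ''far'' 0) + 1 \<le> card {v. v < n \<and> lam v = 0} \<and> (\<forall>v<n. s ''lm'' (s ''pos'' v) = lam v)) \<and>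
     (\<forall>j<n. s ''seg'' j = j \<and> s ''col'' j = (if j + j + 1 < n then 1 else 0))"

lemma ends_layout:
  assumes s: "s ''n'' 0 = n" "0 < n" and idx: "indexed_tree n E (s ''b'') (s ''P'') (s ''dep'') (s ''far'' 0)"
    and zero: "\<And>x. x \<in> {''sz'', ''sp'', ''pos'', ''lam'', ''nx'', ''col''} \<Longrightarrow> s x = (\<lambda>_. 0)"
  shows "ends layout s ((n + 1) * layout_cost) (laid_out n)"
proof -
  let ?P = "s ''P''"
  have P: "\<And>j. 0 < j \<Longrightarrow> j < n \<Longrightarrow> ?P j < j" and far: "s ''far'' 0 < n" and dep: "s ''dep'' 0 = 0"
    "\<And>j. 0 < j \<Longrightarrow> j < n \<Longrightarrow> s ''dep'' j = s ''dep'' (?P j) + 1"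
    using idx by (auto simp: indexed_tree_def)
  let ?T1 = "(n + 1) * (max_cost add_size + 40)" and ?T2 = "(n + 1) * (max_cost mark_path + 40)"
    and ?T3 = "(n + 1) * (max_cost place + 40)" and ?T4 = "(n + 1) * (max_cost init_slot + 40)"
  have z0: "s ''sz'' = (\<lambda>_. 0)" "s ''sp'' = (\<lambda>_. 0)" using zero by simp_all
  have "ends layout s (?T1 + (?T2 + (?T3 + ?T4))) (laid_out n)"
    unfolding layout_def
  proof (rule ends_SeqI[OF ends_add_sizes[of s n, OF s z0 P] _ order_refl])
    fix s1 assume fr1: "\<And>x. x \<notin> writes add_sizes \<Longrightarrow> s1 x = s x" and q1: "sized n ?P 1 (s1 ''sz'') (s1 ''sp'')"
    have c1: "s1 x = s x" if "x \<in> {''n'', ''P'', ''dep'', ''far'', ''pos'', ''lam'', ''nx'', ''col''}" for x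
      using fr1[of x] that by (auto simp: add_sizes_def add_size_def)
    have v1: "s1 ''n'' 0 = n" "s1 ''P'' = ?P" "s1 ''dep'' = s ''dep''" "s1 ''far'' 0 = s ''far'' 0" using c1 s by simp_all
    show "ends (Seq mark_paths (Seq place_all init_slots)) s1 (?T2 + (?T3 + ?T4)) (laid_out n)"
    proof (rule ends_SeqI[OF ends_mark_paths[of s1 n] _ order_refl])
      fix s2 assume fr2: "\<And>x. x \<notin> writes mark_paths \<Longrightarrow> s2 x = s1 x"
        and q2: "\<exists>C\<subseteq>{..<n}. 0 \<in> C \<and> card C = s1 ''dep'' (s1 ''far'' 0) + 1 \<and>
          (\<forall>v\<in>C - {0}. s1 ''P'' v \<in> C \<and> s2 ''sp'' (s1 ''P'' v) = v) \<and>
          (\<forall>u. s2 ''sp'' u = s1 ''sp'' u \<or> u \<in> C \<and> 0 < s2 ''sp'' u \<and> s2 ''sp'' u < n \<and> s1 ''P'' (s2 ''sp'' u) = u)"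
      have c2: "s2 x = s1 x" if "x \<in> {''n'', ''P'', ''dep'', ''far'', ''pos'', ''lam'', ''nx'', ''col'', ''sz''}" for x
        using fr2[of x] that by (auto simp: mark_paths_def mark_path_def)
      have v2: "s2 ''n'' 0 = n" "s2 ''P'' = ?P" "s2 ''dep'' = s ''dep''" "s2 ''far'' 0 = s ''far'' 0"
        "s2 ''sz'' = s1 ''sz''" "s2 ''pos'' 0 = 0" "s2 ''lam'' 0 = 0" "s2 ''nx'' = (\<lambda>_. 0)" "s2 ''col'' = (\<lambda>_. 0)"
        using c2 v1 c1 zero by simp_all
      obtain C where C: "C \<subseteq> {..<n}" "0 \<in> C" "card C = s ''dep'' (s ''far'' 0) + 1"
          "\<And>v. v \<in> C - {0} \<Longrightarrow> ?P v \<in> C \<and> s2 ''sp'' (?P v) = v"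
          "\<And>u. s2 ''sp'' u = s1 ''sp'' u \<or> u \<in> C \<and> 0 < s2 ''sp'' u \<and> s2 ''sp'' u < n \<and> ?P (s2 ''sp'' u) = u"
        using q2 unfolding v1 by blast
      show "ends (Seq place_all init_slots) s2 (?T3 + ?T4) (laid_out n)"
      proof (rule ends_SeqI[OF ends_place_all[of s2 n] _ order_refl])
        fix s3 assume fr3: "\<And>x. x \<notin> writes place_all \<Longrightarrow> s3 x = s2 x"
          and q3: "placed n (s2 ''P'') (s2 ''sz'') (s2 ''sp'') (s3 ''pos'') (s3 ''lam'') n"
        have c3: "s3 x = s2 x" if "x \<in> {''n'', ''P'', ''dep'', ''far'', ''col''}" for x
          using fr3[of x] that by (auto simp: place_all_def place_def)
        have v3: "s3 ''n'' 0 = n" "s3 ''P'' = ?P" "s3 ''dep'' = s ''dep''" "s3 ''far'' 0 = s ''far'' 0" "s3 ''col'' = (\<lambda>_. 0)"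
          using c3 v2 by simp_all
        note intro = tree_layout_intro[OF s(2) P q1 C(1,4,5) q3[unfolded v2]]
        interpret tree_layout n ?P "s1 ''sz''" "s2 ''sp''" "s3 ''pos''" "s3 ''lam''" by (rule intro(1))
        have "C \<subseteq> {v. v < n \<and> s3 ''lam'' v = 0}" using C(1) intro(2) by auto
        then have card: "s ''dep'' (s ''far'' 0) + 1 \<le> card {v. v < n \<and> s3 ''lam'' v = 0}"
          unfolding C(3)[symmetric] by (rule card_mono[rotated]) simp
        show "ends init_slots s3 ?T4 (laid_out n)"
        proof (rule ends_mono[OF ends_init_slots[of s3 n, OF v3(1,5) bij_betw_imp_inj_on[OF bij_pos]] order_refl])
          fix s4 assume fr4: "\<And>x. x \<notin> writes init_slots \<Longrightarrow> s4 x = s3 x"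
            and q4: "\<forall>j<n. s4 ''lm'' (s3 ''pos'' j) = s3 ''lam'' j \<and> s4 ''seg'' j = j \<and> s4 ''col'' j = (if j + j + 1 < n then 1 else 0)"
          have c4: "s4 ''P'' = ?P" "s4 ''dep'' = s ''dep''" "s4 ''far'' 0 = s ''far'' 0" "s4 ''pos'' = s3 ''pos''"
            using fr4 v3 by (simp_all add: init_slots_def init_slot_def)
          show "laid_out n s4" unfolding laid_out_def c4 using q4 card tree_layout_axioms by blast
        qed
      qed (use v2 s(2) P in simp_all)
    qed (use v1 s(2) P far dep in simp_all)
  qed
  then show ?thesis by (rule ends_mono) (simp_all add: layout_cost_def algebra_simps)
qed

section \<open>Reading off the bisection\<close>

definition write_slot :: com where
  "write_slot = Store ''black'' (Cell ''b'' (Var ''j'')) (Cell ''col'' (Cell ''pos'' (Var ''j'')))"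

definition write_output :: com where
  "write_output = For ''j'' (Const 0) ''n'' write_slot"

lemma ends_write_output:
  assumes s: "s ''n'' 0 = n" and inj: "inj_on (s ''b'') {..<n}"
  shows "ends write_output s ((n + 1) * (max_cost write_slot + 40))
    (\<lambda>s'. \<forall>j<n. s' ''black'' (s ''b'' j) = s ''col'' (s ''pos'' j))"
proof -
  define I where "I i s' \<longleftrightarrow> (\<forall>j<i. s' ''black'' (s ''b'' j) = s ''col'' (s ''pos'' j))" for i and s' :: memory
  have "ends write_output s (11 + n * (max_cost write_slot + 12)) (\<lambda>s'. I (s ''n'' 0) s')"
    unfolding write_output_def
  proof (rule ends_For)
    show "I (aval (Const 0) s) (s(''j'' := (s ''j'')(0 := aval (Const 0) s)))" by (simp add: I_def)
    fix i s1 assume I: "I i s1" and i0: "i < s ''n'' 0" and i1: "s1 ''j'' 0 = i"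
      and fr: "\<And>x. x \<notin> insert ''j'' (writes write_slot) \<Longrightarrow> s1 x = s x"
    have sn: "s1 ''b'' = s ''b''" "s1 ''col'' = s ''col''" "s1 ''pos'' = s ''pos''" using fr by (simp_all add: write_slot_def)
    have ne: "s ''b'' j \<noteq> s ''b'' i" if "j < i" for j using inj_onD[OF inj, of j i] that i0 s by auto
    show "I (Suc i) ((run write_slot s1)(''j'' := (s1 ''j'')(0 := Suc i)))"
      using I ne sn i1 unfolding I_def by (simp add: write_slot_def less_Suc_eq)
  qed (use s in \<open>simp_all add: write_slot_def\<close>)
  then show ?thesis by (rule ends_mono) (rule loop_time, use s in \<open>auto simp: I_def\<close>)
qed

text \<open>The edges from \<open>b u\<close> to its children and to its parent are distinct, which
  allows the maximum degree as the bound \<open>D\<close> of the layout.\<close>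

lemma indexed_tree_children_le:
  assumes idx: "indexed_tree n E b P dep far" and u: "u < n"
  shows "card (children n P u) + (if u = 0 then 0 else 1) \<le> max_degree {..<n} E"
proof -
  have inj: "inj_on b {..<n}" and bn: "\<And>j. j < n \<Longrightarrow> b j < n" and P: "\<And>j. 0 < j \<Longrightarrow> j < n \<Longrightarrow> P j < j"
    and E: "E = (\<lambda>j. {b j, b (P j)}) ` ({..<n} - {0})"
    using idx by (auto simp: indexed_tree_def bij_betw_def)
  have bi: "b i = b j \<longleftrightarrow> i = j" if "i < n" "j < n" for i j using inj that by (auto dest: inj_onD)
  let ?A = "children n P u \<union> (if u = 0 then {} else {u})"
  have A: "?A \<subseteq> {..<n} - {0}" using u by (auto simp: children_def)
  have injE: "inj_on (\<lambda>j. {b j, b (P j)}) ({..<n} - {0})"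
  proof (rule inj_onI)
    fix i j assume ij: "i \<in> {..<n} - {0}" "j \<in> {..<n} - {0}" "{b i, b (P i)} = {b j, b (P j)}"
    then have p: "P i < i" "P j < j" "i < n" "j < n" using P by auto
    then have "b i = b j \<or> b i = b (P j) \<and> b (P i) = b j" using ij(3) by (auto simp: doubleton_eq_iff)
    then show "i = j" using bi[of i j] bi[of i "P j"] bi[of "P i" j] p by auto
  qed
  have fE: "finite E" unfolding E by simp
  have "u \<notin> children n P u" using P[of u] u by (auto simp: children_def)
  then have "card (children n P u) + (if u = 0 then 0 else 1) = card ?A"
    by (auto simp: children_def)
  also have "\<dots> = card ((\<lambda>j. {b j, b (P j)}) ` ?A)"
    by (rule card_image[symmetric, OF inj_on_subset[OF injE A]])
  also have "\<dots> \<le> degree E (b u)"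
    unfolding degree_def
  proof (rule card_mono)
    show "finite {e \<in> E. b u \<in> e}" using fE by simp
    show "(\<lambda>j. {b j, b (P j)}) ` ?A \<subseteq> {e \<in> E. b u \<in> e}"
    proof
      fix e assume "e \<in> (\<lambda>j. {b j, b (P j)}) ` ?A"
      then obtain j where j: "j \<in> ?A" "e = {b j, b (P j)}" by blast
      then have "e \<in> E" using A unfolding E by blast
      moreover have "b u \<in> e" using j by (auto simp: children_def split: if_splits)
      ultimately show "e \<in> {e \<in> E. b u \<in> e}" by simp
    qed
  qed
  also have "\<dots> \<le> max_degree {..<n} E" unfolding max_degree_def by (rule Max_ge) (use bn u in auto)
  finally show ?thesis .
qed

lemma indexed_tree_path_length:
  assumes idx: "indexed_tree n E b P dep far" and p: "is_path {..<n} E p"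
  shows "length p \<le> 2 * dep far + 1"
proof -
  have bij: "bij_betw b {..<n} {..<n}" and P: "\<And>j. 0 < j \<Longrightarrow> j < n \<Longrightarrow> P j < j"
    and E: "E = (\<lambda>j. {b j, b (P j)}) ` ({..<n} - {0})" and dep: "\<And>j. 0 < j \<Longrightarrow> j < n \<Longrightarrow> dep j = dep (P j) + 1"
    and far: "\<And>j. j < n \<Longrightarrow> dep j \<le> dep far"
    using idx by (auto simp: indexed_tree_def)
  have inj: "inj_on b {..<n}" and im: "b ` {..<n} = {..<n}" using bij by (auto simp: bij_betw_def)
  have n: "0 < n" using p by (cases n) (auto simp: is_path_def)
  define g where "g = inv_into {..<n} b"
  have gb: "g (b j) = j" if "j < n" for j using that inj by (simp add: g_def)
  have V: "{..<n} - {b 0} = b ` ({..<n} - {0})"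
    using inj_on_image_set_diff[OF inj, of "{..<n}" "{0}"] n im by simp
  show ?thesis
  proof (rule path_length_le[of E "\<lambda>v. b (P (g v))" "{..<n}" "b 0" "\<lambda>v. dep (g v)", OF _ _ _ p])
    show "E = (\<lambda>v. {v, b (P (g v))}) ` ({..<n} - {b 0})"
      unfolding V image_image E by (rule image_cong) (use gb in auto)
    show "dep (g v) = dep (g (b (P (g v)))) + 1" if v: "v \<in> {..<n} - {b 0}" for v
    proof -
      obtain j where j: "j \<in> {..<n} - {0}" "v = b j" using v unfolding V by blast
      then have "P j < j" "j < n" using P by auto
      then show ?thesis using j gb[of j] gb[of "P j"] dep[of j] by simp
    qed
    show "dep (g v) \<le> dep far" if v: "v \<in> {..<n}" for v
    proof -
      have "v \<in> b ` {..<n}" using v im by simp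
      then obtain j where "j < n" "v = b j" by auto
      then show ?thesis using gb far by simp
    qed
  qed
qed

definition bisect :: com where
  "bisect = Seq search (Seq layout (Seq (Set ''z'' (Var ''n''))
     (Seq (While (Less (Const 0) (Var ''z'')) round_body) write_output)))"

definition bisect_cost :: nat where
  "bisect_cost = 2 * search_cost + 2 * layout_cost + (4 * round_cost + 20) + 2 * (max_cost write_slot + 40) + 12"

lemma sum_initial_colour: "(\<Sum>p<n. if p + p + 1 < n then 1 else 0) = n div (2 :: nat)"
proof -
  have "(\<Sum>p<n. if p + p + 1 < n then 1 else (0 :: nat)) = card ({..<n} \<inter> {p. p + p + 1 < n})"
    by (simp add: sum.If_cases)
  also have "{..<n} \<inter> {p. p + p + 1 < n} = {..<n div 2}" by auto
  finally show ?thesis by simp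
qed

lemma writes_search: "writes search = {''e'', ''i'', ''u'', ''v'', ''deg'', ''sum'', ''t'', ''b'', ''h'', ''w'', ''ix'', ''p'', ''j'', ''P'', ''dep'', ''far''}"
  by (auto simp: search_def read_edges_def read_edge_def push_leaves_def push_leaf_def eliminate_def eliminate_leaf_def
      set_parents_def set_parent_def)

lemma writes_layout: "writes layout = {''i'', ''j'', ''u'', ''sp'', ''sz'', ''x'', ''pos'', ''lam'', ''nx'', ''lm'', ''seg'', ''col''}"
  by (auto simp: layout_def add_sizes_def add_size_def mark_paths_def mark_path_def place_all_def place_def init_slots_def init_slot_def)

lemma writes_round_body: "writes round_body = {''i'', ''k'', ''m'', ''nu'', ''c'', ''r'', ''e'', ''j'', ''col'', ''tmp'', ''seg'', ''z'',
   ''acc'', ''aq'', ''fd'', ''fi'', ''la'', ''tf'', ''facc'', ''tl'', ''lacc''}"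
  by (auto simp: round_body_def count_slots_def count_slot_def find_cut_def choose_cut_def choose_slot_def recolor_def
      recolor_slot_def shrink_def copy_slot_def back_slot_def)

text \<open>An edge is cut only if the colours at the positions of its ends differ, so the crossings
  at the changes collected in \<open>Q\<close> bound the width. A longest path has at most
  \<open>2 * k\<close> vertices, which doubles the 4 of the budget.\<close>

lemma bisect_correct:
  assumes idx: "indexed_tree n E b P dep far"
    and lay: "tree_layout n P sz sp pos lam" and k: "dep far + 1 \<le> k"
    and Q: "finite Q" "\<And>p. p < n \<Longrightarrow> col p \<noteq> col ((p + (n - 1)) mod n) \<Longrightarrow> p \<in> Q"
      "real (\<Sum>p\<in>Q. card (tree_layout.crossing n P pos p)) \<le> real (max_degree {..<n} E) * (4 * (real n / real k))"
    and col: "\<And>p. p < n \<Longrightarrow> col p \<le> (1 :: nat)" "(\<Sum>p<n. col p) = n div 2"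
    and black: "\<And>j. j < n \<Longrightarrow> s ''black'' (b j) = col (pos j)"
  shows "bisection {..<n} (output_black n s) (output_white n s)"
    "real (width E (output_black n s) (output_white n s)) \<le> 8 * real (max_degree {..<n} E) / rel_diam {..<n} E"
proof -
  interpret tree_layout n P sz sp pos lam by (rule lay)
  let ?B = "output_black n s" and ?W = "output_white n s" and ?D = "max_degree {..<n} E"
  have bij: "bij_betw b {..<n} {..<n}" and E: "E = (\<lambda>j. {b j, b (P j)}) ` ({..<n} - {0})"
    using idx by (auto simp: indexed_tree_def)
  have un: "?B \<union> ?W = {..<n}" "?B \<inter> ?W = {}" by (auto simp: output_black_def output_white_def)
  have "card ?B = (\<Sum>v<n. if s ''black'' v \<noteq> 0 then 1 else 0)"
  proof -
    have "?B = {..<n} \<inter> {v. s ''black'' v \<noteq> 0}" by (auto simp: output_black_def)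
    then show ?thesis by (simp add: sum.If_cases)
  qed
  also have "\<dots> = (\<Sum>j<n. if s ''black'' (b j) \<noteq> 0 then 1 else 0)"
    by (rule sum.reindex_bij_betw[OF bij, symmetric])
  also have "\<dots> = (\<Sum>j<n. col (pos j))"
  proof (rule sum.cong)
    fix j assume "j \<in> {..<n}"
    then show "(if s ''black'' (b j) \<noteq> 0 then 1 else 0) = col (pos j)"
      using black[of j] col(1)[of "pos j"] pos_less[of j] by auto
  qed simp
  also have "\<dots> = (\<Sum>p<n. col p)" by (rule sum.reindex_bij_betw[OF bij_pos])
  finally have cB: "card ?B = n div 2" using col(2) by simp
  have fin: "finite ?B" "finite ?W" by (auto simp: output_black_def output_white_def)
  have "card ?B + card ?W = n" using card_Un_disjoint[OF fin un(2)] un(1) by simp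
  then show "bisection {..<n} ?B ?W" unfolding bisection_def using un cB by auto
  have "width E ?B ?W \<le> card {w. 0 < w \<and> w < n \<and> col (pos w) \<noteq> col (pos (P w))}"
  proof -
    have "{e \<in> E. \<exists>b\<in>?B. \<exists>w\<in>?W. e = {b, w}} \<subseteq>
       (\<lambda>j. {b j, b (P j)}) ` {w. 0 < w \<and> w < n \<and> col (pos w) \<noteq> col (pos (P w))}"
    proof
      fix e assume "e \<in> {e \<in> E. \<exists>b\<in>?B. \<exists>w\<in>?W. e = {b, w}}"
      then obtain x y j where e: "x \<in> ?B" "y \<in> ?W" "e = {x, y}" "0 < j" "j < n" "e = {b j, b (P j)}"
        unfolding E by auto
      have Pn: "P j < n" using P_less[OF e(4,5)] e by simp
      have xy: "s ''black'' x \<noteq> 0" "s ''black'' y = 0" using e by (auto simp: output_black_def output_white_def)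
      have "{x, y} = {b j, b (P j)}" using e by simp
      then have "s ''black'' (b j) \<noteq> s ''black'' (b (P j))" using xy by (auto simp: doubleton_eq_iff)
      then have "col (pos j) \<noteq> col (pos (P j))" using black[of j] black[OF Pn] e by simp
      then show "e \<in> (\<lambda>j. {b j, b (P j)}) ` {w. 0 < w \<and> w < n \<and> col (pos w) \<noteq> col (pos (P w))}" using e by blast
    qed
    then have "width E ?B ?W \<le> card ((\<lambda>j. {b j, b (P j)}) ` {w. 0 < w \<and> w < n \<and> col (pos w) \<noteq> col (pos (P w))})"
      unfolding width_def by (intro card_mono) auto
    also have "\<dots> \<le> card {w. 0 < w \<and> w < n \<and> col (pos w) \<noteq> col (pos (P w))}" by (rule card_image_le) simp
    finally show ?thesis .
  qed
  also have "\<dots> \<le> (\<Sum>p\<in>Q. card (crossing p))"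
  proof (rule crossing_step_le[OF _ Q(1)])
    fix i assume i: "col i \<noteq> col (i - 1)" "0 < i" "i < n"
    then have "i + (n - 1) = n + (i - 1)" by simp
    then have "(i + (n - 1)) mod n = i - 1" using i by (simp only: mod_add_self1) simp
    then show "i \<in> Q" using Q(2)[OF i(3)] i(1) by simp
  qed
  finally have w: "real (width E ?B ?W) \<le> real ?D * (4 * (real n / real k))"
    using order_trans[OF of_nat_mono Q(3)] by blast
  define K where "K = Max {length p | p. is_path {..<n} E p}"
  have bounded: "length p \<le> 2 * k" if "is_path {..<n} E p" for p
    using indexed_tree_path_length[OF idx that] k by simp
  have finP: "finite {length p | p. is_path {..<n} E p}"
    by (rule finite_subset[of _ "{..2 * k}"]) (use bounded in auto)
  have one: "1 \<in> {length p | p. is_path {..<n} E p}"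
    using is_path_singleton[of 0 "{..<n}" E] n_pos by (force intro!: exI[of _ "[0]"])
  have "K \<in> {length p | p. is_path {..<n} E p}" unfolding K_def by (rule Max_in[OF finP]) (use one in blast)
  then have K2: "K \<le> 2 * k" using bounded by auto
  have K1: "1 \<le> K" unfolding K_def by (rule Max_ge[OF finP one])
  have "real n / real k \<le> 2 * (real n / real K)"
  proof -
    have "real K \<le> 2 * real k" using K2 by (metis of_nat_le_iff of_nat_mult of_nat_numeral)
    then have "real n * real K \<le> real n * (2 * real k)" by (rule mult_left_mono) simp
    moreover have "0 < real K" "0 < real k" using K1 k by auto
    ultimately show ?thesis by (simp add: field_simps)
  qed
  then have "real ?D * (4 * (real n / real k)) \<le> real ?D * (4 * (2 * (real n / real K)))"
    by (intro mult_left_mono) auto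
  also have "\<dots> = 8 * real ?D / rel_diam {..<n} E" by (simp add: rel_diam_def K_def)
  finally show "real (width E ?B ?W) \<le> 8 * real ?D / rel_diam {..<n} E" using w by simp
qed

lemma ends_bisect:
  assumes T: "tree {..<n} E" and el: "edge_list es E"
  shows "ends bisect (input_memory n es) (bisect_cost * n) (\<lambda>s. bisection {..<n} (output_black n s) (output_white n s) \<and>
    real (width E (output_black n s) (output_white n s)) \<le> 8 * real (max_degree {..<n} E) / rel_diam {..<n} E)"
    (is "ends _ _ _ ?R")
proof -
  let ?s = "input_memory n es" and ?D = "max_degree {..<n} E"
  let ?loop = "While (Less (Const 0) (Var ''z'')) round_body"
  have n: "0 < n" using T by (auto simp: tree_def connected_graph_def)
  let ?T1 = "(n + 1) * search_cost" and ?T2 = "(n + 1) * layout_cost" and ?T4 = "n * (4 * round_cost + 20) + 6"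
    and ?T5 = "(n + 1) * (max_cost write_slot + 40)"
  have "ends bisect ?s (?T1 + (?T2 + (5 + (?T4 + ?T5)))) ?R"
    unfolding bisect_def
  proof (rule ends_SeqI[OF ends_search[OF T el] _ order_refl])
    fix s1 assume fr1: "\<And>x. x \<notin> writes search \<Longrightarrow> s1 x = ?s x"
      and idx: "indexed_tree n E (s1 ''b'') (s1 ''P'') (s1 ''dep'') (s1 ''far'' 0)"
    define b where "b = s1 ''b''"
    define P where "P = s1 ''P''"
    define dep where "dep = s1 ''dep''"
    define far where "far = s1 ''far'' 0"
    have n1: "s1 ''n'' 0 = n" using fr1[of "''n''"] by (simp add: writes_search input_memory_def)
    have z1: "s1 x = (\<lambda>_. 0)" if "x \<in> {''sz'', ''sp'', ''pos'', ''lam'', ''nx'', ''col''}" for x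
      using fr1[of x] that by (auto simp: writes_search input_memory_def)
    show "ends (Seq layout (Seq (Set ''z'' (Var ''n'')) (Seq ?loop write_output))) s1 (?T2 + (5 + (?T4 + ?T5))) ?R"
    proof (rule ends_SeqI[OF ends_layout[OF n1 n idx z1] _ order_refl])
      fix s2 assume fr2: "\<And>x. x \<notin> writes layout \<Longrightarrow> s2 x = s1 x" and q2: "laid_out n s2"
      have v2: "s2 ''n'' 0 = n" "s2 ''b'' = b" "s2 ''P'' = P" "s2 ''dep'' = dep" "s2 ''far'' 0 = far"
        using fr2 n1 by (simp_all add: writes_layout b_def P_def dep_def far_def)
      define pos where "pos = s2 ''pos''"
      define lm where "lm = s2 ''lm''"
      obtain sz sp lam where lay: "tree_layout n P sz sp pos lam" and k0: "dep far + 1 \<le> card {v. v < n \<and> lam v = 0}"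
        and lms: "\<And>v. v < n \<Longrightarrow> lm (pos v) = lam v"
        and init: "\<And>j. j < n \<Longrightarrow> s2 ''seg'' j = j \<and> s2 ''col'' j = (if j + j + 1 < n then 1 else 0)"
        using q2 unfolding laid_out_def v2 pos_def lm_def by blast
      have idx': "indexed_tree n E b P dep far" using idx by (simp add: b_def P_def dep_def far_def)
      interpret L: tree_layout n P sz sp pos lam by (rule lay)
      define c where "c p = card (L.crossing p)" for p
      interpret cut_profile n lm c ?D
        unfolding c_def by (rule L.cut_profile_layout[OF indexed_tree_children_le[OF idx'] lms])
      define k where "k = card (zeros (\<lambda>i. i) n)"
      have "bij_betw pos {v. v < n \<and> lam v = 0} (zeros (\<lambda>i. i) n)"
        unfolding bij_betw_def
      proof
        show "inj_on pos {v. v < n \<and> lam v = 0}" by (rule inj_onI) (use L.pos_inj in auto)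
        show "pos ` {v. v < n \<and> lam v = 0} = zeros (\<lambda>i. i) n"
        proof
          show "pos ` {v. v < n \<and> lam v = 0} \<subseteq> zeros (\<lambda>i. i) n" using lms L.pos_less by (auto simp: zeros_def)
          show "zeros (\<lambda>i. i) n \<subseteq> pos ` {v. v < n \<and> lam v = 0}"
          proof
            fix p assume p: "p \<in> zeros (\<lambda>i. i) n"
            then obtain v where "v < n" "pos v = p" using L.vertex_at by (auto simp: zeros_def)
            then show "p \<in> pos ` {v. v < n \<and> lam v = 0}" using lms p by (force simp: zeros_def)
          qed
        qed
      qed
      then have k: "dep far + 1 \<le> k" using k0 bij_betw_same_card unfolding k_def by metis
      have kn: "k \<le> n" unfolding k_def using card_mono[of "{..<n}" "zeros (\<lambda>i. i) n"] by (auto simp: zeros_def)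
      define Y where "Y = 4 * (real n / real k)"
      let ?s3 = "run (Set ''z'' (Var ''n'')) s2"
      \<comment> \<open>The array agrees with the identity only on its first \<open>n\<close> cells,
        so the facts about the initial segment have to be established for it as well.\<close>
      have seg_eq: "segment (?s3 ''seg'') n {0} \<and> bounded_outside (?s3 ''seg'') n (?s3 ''col'') {0} \<and> zeros (?s3 ''seg'') n = zeros (\<lambda>i. i) n"
      proof -
        have e: "?s3 ''seg'' i = i" if "i < n" for i using init[OF that] by simp
        define sg where "sg = ?s3 ''seg''"
        have e0: "sg i = i" if "i < n" for i using e[OF that] by (simp add: sg_def)
        have e1: "(sg (i - 1) + 1) mod n = i" if "0 < i" "i < n" for i using e0[of "i - 1"] that by simp
        have e2: "(sg (n - 1) + 1) mod n = 0" using e0[of "n - 1"] n by simp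
        have "segment sg n {0}" unfolding segment_def inj_on_def using e0 e1 e2 n lm_0 by auto
        then have "segment (?s3 ''seg'') n {0}" by (simp add: sg_def)
        moreover have "bounded_outside (?s3 ''seg'') n (?s3 ''col'') {0}"
          using initial_segment(2)[of "?s3 ''col''"] e unfolding bounded_outside_def by (metis less_imp_diff_less)
        moreover have "zeros (?s3 ''seg'') n = zeros (\<lambda>i. i) n" using e by (auto simp: zeros_def)
        ultimately show ?thesis by blast
      qed
      have "1 \<le> real n / real k" using kn k by simp
      \<comment> \<open>For a quotient below 2 the budget is 2, which is at most four times the
        quotient because that is at least 1.\<close>
      then have "budget (real n / real k) \<le> Y" by (auto simp: budget_def Y_def)
      then have G: "real (sum c {0}) \<le> real ?D * (Y - budget (real n / real k))"
        using initial_segment(3) by simp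
      have inv: "round_inv Y (n div 2) ?s3"
      proof -
        have "(\<Sum>p<n. ?s3 ''col'' p) = (\<Sum>p<n. if p + p + 1 < n then 1 else 0)"
          by (rule sum.cong) (use init in simp_all)
        then have "(\<Sum>p<n. ?s3 ''col'' p) = n div 2" using sum_initial_colour by simp
        moreover have "?s3 ''z'' 0 = n" "?s3 ''lm'' = lm" using v2 by (simp_all add: lm_def)
        moreover have "\<forall>p<n. ?s3 ''col'' p \<le> 1" using init by simp
        ultimately show ?thesis unfolding round_inv_def using n seg_eq G unfolding k_def by (simp only: if_False) auto
      qed
      have z3: "?s3 ''z'' 0 = n" using v2 by simp
      have "ends (Seq ?loop write_output) ?s3 (?T4 + ?T5) ?R"
      proof (rule ends_SeqI[OF ends_rounds[OF inv, unfolded z3] _ order_refl])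
        fix s4 assume fr4: "\<And>x. x \<notin> writes ?loop \<Longrightarrow> s4 x = ?s3 x"
          and q4: "(\<forall>p<n. s4 ''col'' p \<le> 1) \<and> (\<Sum>p<n. s4 ''col'' p) = n div 2 \<and>
            (\<exists>Q. finite Q \<and> (\<forall>p<n. s4 ''col'' p \<noteq> s4 ''col'' ((p + (n - 1)) mod n) \<longrightarrow> p \<in> Q) \<and> real (sum c Q) \<le> real ?D * Y)"
        have v4: "s4 ''n'' 0 = n" "s4 ''b'' = b" "s4 ''pos'' = pos"
          using fr4 v2 by (simp_all add: writes_round_body pos_def)
        have injb: "inj_on (s4 ''b'') {..<n}" using idx' v4 by (simp add: indexed_tree_def bij_betw_def)
        obtain Q where Q: "finite Q" "\<And>p. p < n \<Longrightarrow> s4 ''col'' p \<noteq> s4 ''col'' ((p + (n - 1)) mod n) \<Longrightarrow> p \<in> Q"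
          "real (sum c Q) \<le> real ?D * Y" using q4 by blast
        show "ends write_output s4 ?T5 ?R"
        proof (rule ends_mono[OF ends_write_output[of s4 n, OF v4(1) injb] order_refl])
          fix s5 assume "\<forall>j<n. s5 ''black'' (s4 ''b'' j) = s4 ''col'' (s4 ''pos'' j)"
          then have black: "s5 ''black'' (b j) = s4 ''col'' (pos j)" if "j < n" for j using that v4 by simp
          have Q3: "real (\<Sum>p\<in>Q. card (L.crossing p)) \<le> real ?D * (4 * (real n / real k))"
            using Q(3) by (simp add: c_def Y_def)
          show "?R s5"
            using bisect_correct[where col = "s4 ''col''" and s = s5 and pos = pos, OF idx' lay k Q(1,2) Q3 _ _ black] q4 by blast
        qed
      qed
      then show "ends (Seq (Set ''z'' (Var ''n'')) (Seq ?loop write_output)) s2 (5 + (?T4 + ?T5)) ?R"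
        by (intro ends_Seq[of "Set ''z'' (Var ''n'')"] ends_run[of "Set ''z'' (Var ''n'')"]) simp_all
    qed
  qed
  then show ?thesis
  proof (rule ends_mono)
    \<comment> \<open>A tree has a vertex, so \<open>n + 1 \<le> 2 * n\<close> and the additive
      constants are absorbed.\<close>
    have two: "(n + 1) * a \<le> 2 * a * n" for a
    proof -
      have "(n + 1) * a \<le> (2 * n) * a" using n by (intro mult_le_mono1) simp
      then show ?thesis by (simp add: mult.commute mult.left_commute)
    qed
    have "11 \<le> 12 * n" using n by simp
    moreover have "bisect_cost * n = 2 * search_cost * n + 2 * layout_cost * n + n * (4 * round_cost + 20) + 2 * (max_cost write_slot + 40) * n + 12 * n"
      unfolding bisect_cost_def by (simp add: algebra_simps)
    ultimately show "?T1 + (?T2 + (5 + (?T4 + ?T5))) \<le> bisect_cost * n"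
      using two[of search_cost] two[of layout_cost] two[of "max_cost write_slot + 40"] by linarith
  qed
qed

section \<open>The bound for arbitrary vertex sets\<close>

lemma tree_edge_list_exists:
  assumes "tree {..<n} E"
  shows "\<exists>es. edge_list es E"
proof -
  have sg: "simple_graph {..<n} E" using assms by (simp add: tree_def)
  have "E \<subseteq> Pow {..<n}" using sg unfolding simple_graph_def by auto
  then have "finite E" by (rule finite_subset) simp
  then obtain xs where xs: "set xs = E" "distinct xs" using finite_distinct_list by blast
  have "\<exists>a. e = {fst a, snd a}" if "e \<in> E" for e :: "nat set"
    using sg that unfolding simple_graph_def by fastforce
  then obtain f where f: "\<And>e. e \<in> E \<Longrightarrow> e = {fst (f e), snd (f e)}" by metis
  have "(\<lambda>(u, v). {u, v}) (f e) = e" if "e \<in> set xs" for e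
    using f[of e] that xs(1) by (metis case_prod_beta)
  then have "map (\<lambda>(u, v). {u, v}) (map f xs) = xs" unfolding map_map by (intro map_idI) simp
  then show ?thesis using xs unfolding edge_list_def by (intro exI[of _ "map f xs"]) simp
qed

text \<open>Existence is read off from the program: the tree is copied to
  \<open>{..<card V}\<close>, the copy is bisected by the machine, and the two classes are pulled
  back. Degrees, path lengths and widths do not change.\<close>

lemma min_bis_bound:
  assumes T: "tree V E"
  shows "real (min_bis V E) \<le> 8 * real (max_degree V E) / rel_diam V E"
proof -
  have sg: "simple_graph V E" and fin: "finite V" using T by (auto simp: tree_def simple_graph_def)
  obtain f :: "'a \<Rightarrow> nat" where f: "bij_betw f V {..<card V}"
    using ex_bij_betw_finite_nat[OF fin] by (auto simp: atLeast0LessThan)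
  have inj: "inj_on f V" and im: "f ` V = {..<card V}" using f by (auto simp: bij_betw_def)
  define F where "F = (`) f ` E"
  define g where "g = inv_into V f"
  have TF: "tree {..<card V} F" using tree_image[OF inj T] by (simp add: im F_def)
  obtain es where "edge_list es F" using tree_edge_list_exists[OF TF] by blast
  then obtain B W where BW: "bisection {..<card V} B W"
    "real (width F B W) \<le> 8 * real (max_degree {..<card V} F) / rel_diam {..<card V} F"
    using ends_bisect[OF TF] unfolding ends_def by blast
  have sub: "B \<subseteq> f ` V" "W \<subseteq> f ` V" using BW(1) im by (auto simp: bisection_def)
  have img: "f ` g ` A = A" if "A \<subseteq> f ` V" for A
    unfolding g_def using that by (metis image_inv_into_cancel)
  have gV: "g ` A \<subseteq> V" if "A \<subseteq> f ` V" for A using that by (auto simp: g_def inv_into_into)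
  have ginj: "inj_on g (f ` V)" by (simp add: g_def inj_on_inv_into)
  have cards: "card (g ` A) = card A" if "A \<subseteq> f ` V" for A by (rule card_image[OF inj_on_subset[OF ginj that]])
  have "g ` B \<union> g ` W = g ` (f ` V)" using BW(1) im unfolding bisection_def by (metis image_Un)
  also have "\<dots> = V" using graph_image_inverse(1)[OF inj sg] by (simp add: g_def)
  finally have "g ` B \<union> g ` W = V" .
  moreover have "g ` B \<inter> g ` W = {}"
    using BW(1) inj_on_image_Int[OF ginj sub] by (simp add: bisection_def)
  ultimately have "bisection V (g ` B) (g ` W)" using BW(1) cards sub by (simp add: bisection_def)
  then have "min_bis V E \<le> width E (g ` B) (g ` W)" by (rule min_bis_le[OF fin])
  also have "\<dots> = width F B W"
    using width_image[OF inj sg gV[OF sub(1)] gV[OF sub(2)]] img sub by (simp add: F_def)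
  finally have "real (min_bis V E) \<le> real (width F B W)" by simp
  also note BW(2)
  also have "max_degree {..<card V} F = max_degree V E"
  proof -
    have "degree F ` f ` V = degree E ` V"
      unfolding image_image F_def by (rule image_cong) (use degree_image[OF inj sg] in auto)
    then show ?thesis by (simp add: max_degree_def im)
  qed
  also have "rel_diam {..<card V} F = rel_diam V E"
    using path_lengths_image[OF inj sg] by (simp add: rel_diam_def im F_def)
  finally show ?thesis .
qed

theorem theorem1p1:
  shows "(\<forall>(V :: 'a set) E. tree V E \<longrightarrow>
            real (min_bis V E) \<le> 8 * real (max_degree V E) / rel_diam V E) \<and>
         (\<exists>(c :: com) (C :: nat). \<forall>n E es. tree {..<n} E \<and> edge_list es E \<longrightarrow>
            (\<exists>t s. exec c (input_memory n es) t s \<and> t \<le> C * n \<and>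
               bisection {..<n} (output_black n s) (output_white n s) \<and>
               real (width E (output_black n s) (output_white n s))
                 \<le> 8 * real (max_degree {..<n} E) / rel_diam {..<n} E))"
  using min_bis_bound ends_bisect unfolding ends_def by blast

end
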